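(* The ideal $I_p$ is a Hopf ideal of $Y$. In particular, the restricted super Yangian $Y^{[p]}=Y/I_p$ inherits from $Y$ a Hopf (super)algebra structure.
   Context: Let $k$ be an algebraically closed field of characteristic $p>2$. Fix parities $|1|=0$, $|2|=1$. The super Yangian $Y=Y_{1|1}$ is the associative superalgebra over $k$ generated by elements $t_{i,j}^{(r)}$ ($1\le i,j\le 2$, $r>0$) of parity $|i|+|j| \pmod 2$, subject to $[t_{i,j}^{(r)},t_{k,l}^{(s)}]=(-1)^{|i||j|+|i||k|+|j||k|}\sum_{t=0}^{\min(r,s)-1}\big(t_{k,j}^{(t)}t_{i,l}^{(r+s-1-t)}-t_{k,j}^{(r+s-1-t)}t_{i,l}^{(t)}\big)$, with supercommutator bracket and $t_{i,j}^{(0)}=\delta_{i,j}$. Put $t_{i,j}(u)=\sum_{r\ge0}t_{i,j}^{(r)}u^{-r}$, $T(u)=(t_{i,j}(u))$. Define $d_1(u),d_2(u),e(u),f(u)$ by the Gauss factorization $t_{1,1}=d_1$, $t_{1,2}=d_1e$, $t_{2,1}=fd_1$, $t_{2,2}=fd_1e+d_2$. Let $b_1(u)=d_1(u)d_1(u-1)\cdots d_1(u-p+1)$, $b_2(u)=d_2(u)^{-1}\cdots d_2(u-p+1)^{-1}$, $b_i(u)=\sum_r b_i^{(r)}u^{-r}$. The elements $b_i^{(rp)}$ ($i=1,2$, $r>0$) are central; $Z_p(Y)$ is the subalgebra they generate, $Z_p(Y)_+$ the ideal of $Z_p(Y)$ generated by them, and $I_p=Y\,Z_p(Y)_+$. $Y$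 is a Hopf superalgebra with $\Delta(t_{i,j}(u))=\sum_k t_{i,k}(u)\otimes t_{k,j}(u)$, antipode $S(t_{i,j}(u))=t'_{i,j}(u)$, the $(i,j)$-entry of $T(u)^{-1}$, and counit $t_{i,j}(u)\mapsto\delta_{i,j}$. *)

theory Defs
  imports Main "HOL-Computational_Algebra.Polynomial"
begin

section \<open>Free associative algebra over a field (elements = coefficient functions on words)\<close>

type_synonym ('g,'k) fa = "'g list \<Rightarrow> 'k"

definition fa_zero :: "('g,'k::field) fa" where "fa_zero = (\<lambda>w. 0)"
definition fa_one :: "('g,'k::field) fa" where "fa_one = (\<lambda>w. if w = [] then 1 else 0)"
definition fa_word :: "'g list \<Rightarrow> ('g,'k::field) fa" where "fa_word u = (\<lambda>w. if w = u then 1 else 0)"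
definition fa_gen :: "'g \<Rightarrow> ('g,'k::field) fa" where "fa_gen x = fa_word [x]"
definition fa_add :: "('g,'k::field) fa \<Rightarrow> ('g,'k) fa \<Rightarrow> ('g,'k) fa" where
  "fa_add f g = (\<lambda>w. f w + g w)"
definition fa_smult :: "'k::field \<Rightarrow> ('g,'k) fa \<Rightarrow> ('g,'k) fa" where
  "fa_smult c f = (\<lambda>w. c * f w)"
definition fa_neg :: "('g,'k::field) fa \<Rightarrow> ('g,'k) fa" where "fa_neg f = (\<lambda>w. - f w)"
definition fa_sub :: "('g,'k::field) fa \<Rightarrow> ('g,'k) fa \<Rightarrow> ('g,'k) fa" where
  "fa_sub f g = fa_add f (fa_neg g)"
definition fa_mul :: "('g,'k::field) fa \<Rightarrow> ('g,'k) fa \<Rightarrow> ('g,'k) fa" where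
  "fa_mul f g = (\<lambda>w. \<Sum>i\<le>length w. f (take i w) * g (drop i w))"
definition fa_sum :: "('a \<Rightarrow> ('g,'k::field) fa) \<Rightarrow> 'a set \<Rightarrow> ('g,'k) fa" where
  "fa_sum F A = (\<lambda>w. \<Sum>a\<in>A. F a w)"
lemma fa_sum_cong [fundef_cong]:
  "A = B \<Longrightarrow> (\<And>a. a \<in> B \<Longrightarrow> F a = G a) \<Longrightarrow> fa_sum F A = fa_sum G B"
  unfolding fa_sum_def by auto

definition fa_prod_list :: "('g,'k::field) fa list \<Rightarrow> ('g,'k) fa" where
  "fa_prod_list xs = foldr fa_mul xs fa_one"

definition fa_hom :: "('g \<Rightarrow> ('h,'k::field) fa) \<Rightarrow> ('g,'k) fa \<Rightarrow> ('h,'k) fa" where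
  "fa_hom \<phi> f = (\<lambda>v. \<Sum>w\<in>{w. f w \<noteq> 0}. f w * fa_prod_list (map \<phi> w) v)"
definition fa_khom :: "('g \<Rightarrow> 'k::field) \<Rightarrow> ('g,'k) fa \<Rightarrow> 'k" where
  "fa_khom \<psi> f = (\<Sum>w\<in>{w. f w \<noteq> 0}. f w * prod_list (map \<psi> w))"

inductive_set fa_ideal :: "('g,'k::field) fa set \<Rightarrow> ('g,'k) fa set" for R where
  fi_zero: "fa_zero \<in> fa_ideal R"
| fi_gen: "r \<in> R \<Longrightarrow> fa_mul (fa_mul (fa_word u) r) (fa_word v) \<in> fa_ideal R"
| fi_add: "x \<in> fa_ideal R \<Longrightarrow> y \<in> fa_ideal R \<Longrightarrow> fa_add x y \<in> fa_ideal R"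
| fi_smult: "x \<in> fa_ideal R \<Longrightarrow> fa_smult c x \<in> fa_ideal R"

section \<open>Formal series in u^{-1} with coefficients in the free algebra\<close>

type_synonym ('g,'k) ser = "nat \<Rightarrow> ('g,'k) fa"

definition ser_one :: "('g,'k::field) ser" where
  "ser_one = (\<lambda>n. if n = 0 then fa_one else fa_zero)"
definition ser_add :: "('g,'k::field) ser \<Rightarrow> ('g,'k) ser \<Rightarrow> ('g,'k) ser" where
  "ser_add A B = (\<lambda>n. fa_add (A n) (B n))"
definition ser_neg :: "('g,'k::field) ser \<Rightarrow> ('g,'k) ser" where
  "ser_neg A = (\<lambda>n. fa_neg (A n))"
definition ser_mul :: "('g,'k::field) ser \<Rightarrow> ('g,'k) ser \<Rightarrow> ('g,'k) ser" where
  "ser_mul A B = (\<lambda>n. fa_sum (\<lambda>m. fa_mul (A m) (B (n - m))) {..n})"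
definition ser_prod_list :: "('g,'k::field) ser list \<Rightarrow> ('g,'k) ser" where
  "ser_prod_list xs = foldr ser_mul xs ser_one"

text \<open>Inverse of a series with constant term 1: B 0 = 1, B n = - sum_{m=1..n} A m B (n-m).\<close>
function ser_inv :: "('g,'k::field) ser \<Rightarrow> nat \<Rightarrow> ('g,'k) fa" where
  "ser_inv A n = (if n = 0 then fa_one
     else fa_neg (fa_sum (\<lambda>m. fa_mul (A m) (ser_inv A (n - m))) {1..n}))"
  by auto
termination by (relation "measure snd") auto

text \<open>Substitution u \<mapsto> u - a: (u-a)^{-r} = sum_k C(r+k-1,k) a^k u^{-r-k}.\<close>
definition ser_shift :: "nat \<Rightarrow> ('g,'k::field) ser \<Rightarrow> ('g,'k) ser" where
  "ser_shift a A = (\<lambda>n. if n = 0 then A 0 else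
     fa_sum (\<lambda>r. fa_smult (of_nat ((n - 1) choose (n - r)) * of_nat a ^ (n - r)) (A r)) {1..n})"

datatype idx = I1 | I2

type_synonym ('g,'k) mser = "nat \<Rightarrow> idx \<Rightarrow> idx \<Rightarrow> ('g,'k) fa"

function mat_inv :: "('g,'k::field) mser \<Rightarrow> nat \<Rightarrow> idx \<Rightarrow> idx \<Rightarrow> ('g,'k) fa" where
  "mat_inv A n i j = (if n = 0 then (if i = j then fa_one else fa_zero)
     else fa_neg (fa_sum (\<lambda>m. fa_sum (\<lambda>k. fa_mul (A m i k) (mat_inv A (n - m) k j)) UNIV) {1..n}))"
  by auto
termination by (relation "measure (\<lambda>(A,n,i,j). n)") auto

text \<open>Generator Tg i j n stands for t_{i,j}^{(n+1)}.\<close>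
datatype ygen = Tg idx idx nat

definition pidx :: "idx \<Rightarrow> nat" where "pidx i = (if i = I1 then 0 else 1)"
definition ypar :: "ygen \<Rightarrow> nat" where "ypar g = (case g of Tg i j n \<Rightarrow> pidx i + pidx j)"
definition sgn :: "nat \<Rightarrow> 'k::field" where "sgn n = (- 1) ^ n"

definition tc :: "idx \<Rightarrow> idx \<Rightarrow> nat \<Rightarrow> (ygen,'k::field) fa" where
  "tc i j r = (if r = 0 then (if i = j then fa_one else fa_zero) else fa_gen (Tg i j (r - 1)))"

definition yrel :: "idx \<Rightarrow> idx \<Rightarrow> idx \<Rightarrow> idx \<Rightarrow> nat \<Rightarrow> nat \<Rightarrow> (ygen,'k::field) fa" where
  "yrel i j k l r s =
     fa_sub
       (fa_sub (fa_mul (tc i j r) (tc k l s))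
               (fa_smult (sgn ((pidx i + pidx j) * (pidx k + pidx l))) (fa_mul (tc k l s) (tc i j r))))
       (fa_smult (sgn (pidx i * pidx j + pidx i * pidx k + pidx j * pidx k))
          (fa_sum (\<lambda>t. fa_sub (fa_mul (tc k j t) (tc i l (r + s - 1 - t)))
                               (fa_mul (tc k j (r + s - 1 - t)) (tc i l t))) {..<min r s}))"

definition yrels :: "(ygen,'k::field) fa set" where
  "yrels = {yrel i j k l r s | i j k l r s. 0 < r \<and> 0 < s}"

text \<open>Kernel of the projection from the free algebra onto Y.\<close>
definition yker :: "(ygen,'k::field) fa set" where "yker = fa_ideal yrels"

definition tser :: "idx \<Rightarrow> idx \<Rightarrow> (ygen,'k::field) ser" where "tser i j = (\<lambda>r. tc i j r)"

definition d1 :: "(ygen,'k::field) ser" where "d1 = tser I1 I1"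
definition ee :: "(ygen,'k::field) ser" where "ee = ser_mul (ser_inv d1) (tser I1 I2)"
definition ff :: "(ygen,'k::field) ser" where "ff = ser_mul (tser I2 I1) (ser_inv d1)"
definition d2 :: "(ygen,'k::field) ser" where
  "d2 = ser_add (tser I2 I2) (ser_neg (ser_mul (ser_mul ff d1) ee))"

definition b1 :: "nat \<Rightarrow> (ygen,'k::field) ser" where
  "b1 p = ser_prod_list (map (\<lambda>a. ser_shift a d1) [0..<p])"
definition b2 :: "nat \<Rightarrow> (ygen,'k::field) ser" where
  "b2 p = ser_prod_list (map (\<lambda>a. ser_inv (ser_shift a d2)) [0..<p])"

definition bgens :: "nat \<Rightarrow> (ygen,'k::field) fa set" where
  "bgens p = {b1 p (r * p) | r. 0 < r} \<union> {b2 p (r * p) | r. 0 < r}"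

text \<open>Preimage in the free algebra of I_p = Y Z_p(Y)_+ (a left ideal spanned by the y*b).\<close>
inductive_set Ip_lift :: "nat \<Rightarrow> (ygen,'k::field) fa set" for p where
  ip_ker: "x \<in> yker \<Longrightarrow> x \<in> Ip_lift p"
| ip_gen: "b \<in> bgens p \<Longrightarrow> fa_mul (fa_word u) b \<in> Ip_lift p"
| ip_add: "x \<in> Ip_lift p \<Longrightarrow> y \<in> Ip_lift p \<Longrightarrow> fa_add x y \<in> Ip_lift p"
| ip_smult: "x \<in> Ip_lift p \<Longrightarrow> fa_smult c x \<in> Ip_lift p"

type_synonym ygen2 = "ygen + ygen"

definition inl_hom :: "(ygen,'k::field) fa \<Rightarrow> (ygen2,'k) fa" where
  "inl_hom = fa_hom (\<lambda>g. fa_gen (Inl g))"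
definition inr_hom :: "(ygen,'k::field) fa \<Rightarrow> (ygen2,'k) fa" where
  "inr_hom = fa_hom (\<lambda>g. fa_gen (Inr g))"

text \<open>(1 \<otimes> h)(g \<otimes> 1) = (-1)^{|g||h|} g \<otimes> h.\<close>
definition tens_rels :: "(ygen2,'k::field) fa set" where
  "tens_rels = inl_hom ` yrels \<union> inr_hom ` yrels \<union>
     {fa_sub (fa_mul (fa_gen (Inr h)) (fa_gen (Inl g)))
             (fa_smult (sgn (ypar g * ypar h)) (fa_mul (fa_gen (Inl g)) (fa_gen (Inr h)))) | g h. True}"

text \<open>Preimage in the free algebra on two copies of the generators of I_p \<otimes> Y + Y \<otimes> I_p.\<close>
inductive_set tens_Ip :: "nat \<Rightarrow> (ygen2,'k::field) fa set" for p where
  ti_ker: "x \<in> fa_ideal tens_rels \<Longrightarrow> x \<in> tens_Ip p"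
| ti_left: "x \<in> Ip_lift p \<Longrightarrow> fa_mul (inl_hom x) (inr_hom (fa_word w)) \<in> tens_Ip p"
| ti_right: "x \<in> Ip_lift p \<Longrightarrow> fa_mul (inl_hom (fa_word w)) (inr_hom x) \<in> tens_Ip p"
| ti_add: "x \<in> tens_Ip p \<Longrightarrow> y \<in> tens_Ip p \<Longrightarrow> fa_add x y \<in> tens_Ip p"
| ti_smult: "x \<in> tens_Ip p \<Longrightarrow> fa_smult c x \<in> tens_Ip p"

definition comult_gen :: "ygen \<Rightarrow> (ygen2,'k::field) fa" where
  "comult_gen g = (case g of Tg i j n \<Rightarrow>
     fa_sum (\<lambda>k. fa_sum (\<lambda>a. fa_mul (inl_hom (tc i k a)) (inr_hom (tc k j (Suc n - a)))) {..Suc n}) UNIV)"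
definition comult :: "(ygen,'k::field) fa \<Rightarrow> (ygen2,'k) fa" where
  "comult = fa_hom comult_gen"

definition counit_gen :: "ygen \<Rightarrow> 'k::field" where
  "counit_gen g = (case g of Tg i j n \<Rightarrow> (if i = j \<and> Suc n = 0 then 1 else 0))"
definition counit :: "(ygen,'k::field) fa \<Rightarrow> 'k" where
  "counit = fa_khom counit_gen"

definition tmat :: "(ygen,'k::field) mser" where "tmat = (\<lambda>r i j. tc i j r)"

definition antipode_gen :: "ygen \<Rightarrow> (ygen,'k::field) fa" where
  "antipode_gen g = (case g of Tg i j n \<Rightarrow> mat_inv tmat (Suc n) i j)"

text \<open>Super anti-homomorphism: S(g_1...g_n) = (-1)^{C(m,2)} S(g_n)...S(g_1), m = #odd letters.\<close>
definition word_sign :: "ygen list \<Rightarrow> 'k::field" where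
  "word_sign w = (let m = length (filter (\<lambda>g. odd (ypar g)) w) in sgn (m * (m - 1) div 2))"
definition antipode :: "(ygen,'k::field) fa \<Rightarrow> (ygen,'k) fa" where
  "antipode f = (\<lambda>v. \<Sum>w\<in>{w. f w \<noteq> 0}. f w * word_sign w * fa_prod_list (rev (map antipode_gen w)) v)"

end

theory Submission
  imports Defs "HOL-Computational_Algebra.Formal_Power_Series" "HOL-Library.Product_Plus"
begin

text \<open>
  Work in a ring in which the entries of a \<open>2 \<times> 2\<close> matrix of series \<open>T(u)\<close> satisfy the defining
  relations. The inverse matrix, with both indices swapped,
  satisfies the same relations, and \<open>t'_{2,2} = d_2^{-1}\<close>, so statements on \<open>b_2\<close> are statements on
  \<open>b_1\<close> for this dual family. Specialising \<open>u - v\<close> to integers gives exchange relations such as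
  \<open>t_{1,1}(u-1) t_{1,2}(u) = t_{1,2}(u-1) t_{1,1}(u)\<close> and \<open>t_{1,2}(u-1) t_{1,2}(u) = 0\<close> (as \<open>p \<noteq> 2\<close>).
  Moving \<open>t_{1,2}(v)\<close> through \<open>n\<close> factors \<open>t_{1,1}(u) \<dots> t_{1,1}(u-n+1)\<close> produces error terms with
  coefficient \<open>n\<close>, and expanding the coproduct of these \<open>n\<close> factors gives the group-like term plus
  one error term with coefficient \<open>n\<close>. For \<open>n = p\<close> both vanish: \<open>b_1(u)\<close> is central and group-like.
  It is also invariant under \<open>u \<mapsto> u - 1\<close>, so all its coefficients of positive degree lie in the span
  of the \<open>b_1^{(rp)}\<close>, and hence in the ideal. For the antipode, the two tensor factors act on the
  algebra by left multiplication through \<open>S\<close> and by right multiplication; group-likeness then reads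
  \<open>\<Sum>_m S(b^{(m)}) b^{(n-m)} = 0\<close> for \<open>n > 0\<close>, so \<open>S(b^{(n)})\<close> lies in the ideal.
\<close>

text \<open>The computations are made for a matrix of series over an arbitrary noncommutative ring
  because they are used several times: for \<open>Y\<close>, for the dual family, for the two legs
  of the coproduct and for multiplication operators. In such a ring \<open>u - v\<close> cannot be
  divided out, so the relations are kept multiplied by \<open>(u - v)/(u v)\<close>, a power series
  in \<open>1/u\<close> and \<open>1/v\<close>, and integers are reached by evaluating one variable
  after the other at the central points \<open>1/(u - a)\<close>. The rings carry no grading:
  parities are read off the indices, and for the operators an odd part is added by passing to pairs.
  The antipode is not a homomorphism; as a family of left multiplication operators composed in the
  order of the word it becomes one, so the exchange computations need not be repeated for
  anti-homomorphisms. Elements of the free algebra are arbitrary functions on words, and only those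
  of finite support are well behaved. Hence the quotient is formed on finite supports, and only for
  the tensor square; \<open>Y\<close> is studied inside it as the left factor, which the counit on
  the right factor shows to be embedded.\<close>

unbundle fps_syntax

section \<open>Substitution of shifts in series over a noncommutative ring\<close>

definition central :: "'r::ring_1 \<Rightarrow> bool" where
  "central z \<longleftrightarrow> (\<forall>x. z * x = x * z)"

lemma centralD: "central z \<Longrightarrow> z * x = x * z"
  by (simp add: central_def)

lemma central_fps_X: "central (fps_X :: 'r::ring_1 fps)"
  by (simp add: central_def fps_mult_fps_X_commute)

lemma of_nat_left_commute: "of_nat n * (x * y) = x * (of_nat n * (y :: 'r::ring_1))"
  by (metis mult.assoc mult_of_nat_commute)

lemma central_of_nat: "central (of_nat n :: 'r::ring_1)"
  by (simp add: central_def mult_of_nat_commute)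

lemma central_one: "central (1 :: 'r::ring_1)"
  by (simp add: central_def)

lemma central_diff: "central a \<Longrightarrow> central b \<Longrightarrow> central (a - b :: 'r::ring_1)"
  by (simp add: central_def algebra_simps)

lemma central_mult: "central a \<Longrightarrow> central b \<Longrightarrow> central (a * b :: 'r::ring_1)"
  unfolding central_def by (metis mult.assoc)

text \<open>Iterating the equation makes \<open>D i\<close> divisible by every power of
  \<open>z\<close>. A family over \<open>i\<close> is needed because the recursions change their
  argument: a sequence or series loses its first entry. Most laws of substitution below follow by
  showing that both sides obey the same recursion.\<close>

lemma fps_contraction:
  fixes D :: "'i \<Rightarrow> 'r::ring_1 fps"
  assumes D: "\<And>i. D i = z * D (f i)" and z: "z $ 0 = 0"
  shows "D i = 0"
proof -
  have "\<forall>i. \<forall>k<n. D i $ k = 0" for n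
  proof (induction n)
    case (Suc n)
    have "D i $ k = 0" if "k < Suc n" for i k
    proof -
      have "D i $ k = (\<Sum>j=0..k. z $ j * D (f i) $ (k - j))"
        by (subst D) (rule fps_mult_nth)
      also have "\<dots> = 0"
      proof (rule sum.neutral, rule)
        fix j assume "j \<in> {0..k}"
        show "z $ j * D (f i) $ (k - j) = 0"
        proof (cases j)
          case 0 then show ?thesis by (simp add: z)
        next
          case (Suc j')
          then have "k - j < n" using that \<open>j \<in> {0..k}\<close> by auto
          then show ?thesis using Suc.IH by simp
        qed
      qed
      finally show ?thesis .
    qed
    then show ?case by blast
  qed simp
  then show ?thesis by (intro fps_ext) (metis fps_zero_nth lessI)
qed

text \<open>The sum of all \<open>M s * z ^ s\<close>. If \<open>z\<close> has no constant term, the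
  summands with \<open>s > n\<close> do not reach degree \<open>n\<close>, so the truncation is
  exact.\<close>

definition ev :: "'r::ring_1 fps \<Rightarrow> (nat \<Rightarrow> 'r fps) \<Rightarrow> 'r fps" where
  "ev z M = Abs_fps (\<lambda>n. \<Sum>s\<le>n. (M s * z ^ s) $ n)"

lemma fps_mult_power_nth_eq_0:
  fixes z :: "'r::ring_1 fps"
  assumes z: "z $ 0 = 0" and k: "k < s"
  shows "(A * z ^ s) $ k = 0"
proof -
  have *: "\<forall>j<s. (z ^ s) $ j = 0" for s
  proof (induction s)
    case (Suc s)
    show ?case
    proof (intro allI impI)
      fix j assume j: "j < Suc s"
      have "(z * z ^ s) $ j = (\<Sum>i=0..j. z $ i * (z ^ s) $ (j - i))" by (rule fps_mult_nth)
      also have "\<dots> = 0"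
      proof (rule sum.neutral, rule)
        fix i assume i: "i \<in> {0..j}"
        show "z $ i * (z ^ s) $ (j - i) = 0"
        proof (cases i)
          case 0 then show ?thesis by (simp add: z)
        next
          case (Suc i')
          then show ?thesis using Suc.IH j i by auto
        qed
      qed
      finally show "(z ^ Suc s) $ j = 0" by simp
    qed
  qed simp
  have "\<forall>i\<in>{0..k}. (z ^ s) $ (k - i) = 0" using * k by auto
  then show ?thesis by (simp add: fps_mult_nth)
qed

lemma ev_rec:
  fixes z :: "'r::ring_1 fps"
  assumes z: "z $ 0 = 0" and c: "central z"
  shows "ev z M = M 0 + z * ev z (\<lambda>s. M (Suc s))"
proof (rule fps_ext)
  fix n
  have "(z * ev z (\<lambda>s. M (Suc s))) $ n
      = (\<Sum>i=0..n. \<Sum>s\<le>n - i. z $ i * (M (Suc s) * z ^ s) $ (n - i))"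
    by (simp add: fps_mult_nth[of z] ev_def sum_distrib_left)
  \<comment> \<open>Padding with vanishing terms makes the inner range independent of
    \<open>i\<close>, so that the sums can be swapped.\<close>
  also have "\<dots> = (\<Sum>i=0..n. \<Sum>s\<le>n. z $ i * (M (Suc s) * z ^ s) $ (n - i))"
  proof (rule sum.cong[OF refl], rule sum.mono_neutral_left)
    fix i assume "i \<in> {0..n}"
    show "\<forall>s\<in>{..n} - {..n - i}. z $ i * (M (Suc s) * z ^ s) $ (n - i) = 0"
      by (auto simp: fps_mult_power_nth_eq_0[OF z])
  qed auto
  also have "\<dots> = (\<Sum>s\<le>n. (z * (M (Suc s) * z ^ s)) $ n)"
    by (subst sum.swap) (simp add: fps_mult_nth[of z])
  also have "\<dots> = (\<Sum>s\<le>n. (M (Suc s) * z ^ Suc s) $ n)"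
    by (simp only: power_Suc mult.assoc[symmetric] centralD[OF c, of "M _"])
  finally have "(M 0 + z * ev z (\<lambda>s. M (Suc s))) $ n
      = (M 0 * z ^ 0) $ n + (\<Sum>s\<le>n. (M (Suc s) * z ^ Suc s) $ n)" by simp
  also have "\<dots> = (\<Sum>s\<le>Suc n. (M s * z ^ s) $ n)"
    by (subst sum.atMost_Suc_shift) simp
  also have "\<dots> = ev z M $ n"
    by (simp add: ev_def fps_mult_power_nth_eq_0[OF z] del: power_Suc)
  finally show "ev z M $ n = (M 0 + z * ev z (\<lambda>s. M (Suc s))) $ n" by simp
qed

lemma fps_contraction_eq:
  fixes F G :: "'i \<Rightarrow> 'r::ring_1 fps"
  assumes "\<And>i. F i - G i = z * (F (f i) - G (f i))" and "z $ 0 = 0"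
  shows "F i = G i"
proof -
  have "F i - G i = 0"
    by (rule fps_contraction[where D = "\<lambda>i. F i - G i"]) (rule assms)+
  then show ?thesis by simp
qed

lemma ev_mult_left:
  fixes z :: "'r::ring_1 fps"
  assumes z: "z $ 0 = 0" and c: "central z"
  shows "ev z (\<lambda>s. A * M s) = A * ev z M"
proof (rule fps_contraction_eq[where z = z and f = "\<lambda>M s. M (Suc s)"
      and F = "\<lambda>M. ev z (\<lambda>s. A * M s)" and G = "\<lambda>M. A * ev z M"])
  fix M :: "nat \<Rightarrow> 'r fps"
  have "A * ev z M = A * M 0 + A * (z * ev z (\<lambda>s. M (Suc s)))"
    by (subst ev_rec[OF z c]) (rule distrib_left)
  also have "A * (z * ev z (\<lambda>s. M (Suc s))) = z * (A * ev z (\<lambda>s. M (Suc s)))"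
    by (simp only: mult.assoc[symmetric] centralD[OF c, of A])
  finally show "ev z (\<lambda>s. A * M s) - A * ev z M
      = z * (ev z (\<lambda>s. A * M (Suc s)) - A * ev z (\<lambda>s. M (Suc s)))"
    by (subst ev_rec[OF z c]) (simp add: right_diff_distrib)
qed (rule z)

lemma ev_mult_right:
  fixes z :: "'r::ring_1 fps"
  assumes z: "z $ 0 = 0" and c: "central z"
  shows "ev z (\<lambda>s. M s * A) = ev z M * A"
proof (rule fps_contraction_eq[where z = z and f = "\<lambda>M s. M (Suc s)"
      and F = "\<lambda>M. ev z (\<lambda>s. M s * A)" and G = "\<lambda>M. ev z M * A"])
  fix M :: "nat \<Rightarrow> 'r fps"
  have "ev z M * A = M 0 * A + z * (ev z (\<lambda>s. M (Suc s)) * A)"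
    by (subst ev_rec[OF z c]) (simp add: distrib_right mult.assoc)
  then show "ev z (\<lambda>s. M s * A) - ev z M * A
      = z * (ev z (\<lambda>s. M (Suc s) * A) - ev z (\<lambda>s. M (Suc s)) * A)"
    by (subst ev_rec[OF z c]) (simp add: right_diff_distrib)
qed (rule z)

lemma ev_diff:
  fixes z :: "'r::ring_1 fps"
  shows "ev z (\<lambda>s. M s - N s) = ev z M - ev z N"
  by (rule fps_ext) (simp add: ev_def sum_subtractf left_diff_distrib)

section \<open>The substitution \<open>u\<close> to \<open>u - a\<close> as a ring
  homomorphism\<close>

definition shift_pt :: "nat \<Rightarrow> 'r::ring_1 fps" where
  "shift_pt a = Abs_fps (\<lambda>n. if n = 0 then 0 else of_nat a ^ (n - 1))"

lemma shift_pt_0 [simp]: "shift_pt a $ 0 = 0"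
  by (simp add: shift_pt_def)

lemma shift_pt_eq: "(1 - of_nat a * fps_X) * shift_pt a = (fps_X :: 'r::ring_1 fps)"
proof (rule fps_ext)
  fix n
  show "((1 - of_nat a * fps_X) * shift_pt a) $ n = (fps_X :: 'r fps) $ n"
    by (cases n; cases "n - 1")
      (auto simp: left_diff_distrib mult.assoc shift_pt_def)
qed

lemma central_shift_pt: "central (shift_pt a :: 'r::ring_1 fps)"
  unfolding central_def
proof
  fix x :: "'r fps"
  show "shift_pt a * x = x * shift_pt a"
  proof (rule fps_ext)
    fix n
    have c: "\<And>i y. (shift_pt a :: 'r fps) $ i * y = y * shift_pt a $ i"
      by (simp add: shift_pt_def) (metis mult_of_nat_commute of_nat_power)
    have "(shift_pt a * x) $ n = (\<Sum>i=0..n. x $ (n - i) * shift_pt a $ i)"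
      by (simp add: fps_mult_nth c)
    also have "\<dots> = (\<Sum>i=0..n. x $ i * shift_pt a $ (n - i))"
      by (subst sum.atLeastAtMost_rev) simp
    finally show "(shift_pt a * x) $ n = (x * shift_pt a) $ n"
      by (simp add: fps_mult_nth)
  qed
qed

text \<open>\<open>shift a\<close> is the substitution \<open>u \<mapsto> u - a\<close> in series in \<open>X = 1/u\<close>, and
  \<open>shift_pt a\<close> is \<open>1/(u - a)\<close>.\<close>

definition shift :: "nat \<Rightarrow> 'r::ring_1 fps \<Rightarrow> 'r fps" where
  "shift a A = Abs_fps (\<lambda>n. if n = 0 then A $ 0 else
     \<Sum>r=1..n. of_nat (((n - 1) choose (n - r)) * a ^ (n - r)) * A $ r)"

lemma shift_nth_0 [simp]: "shift a A $ 0 = A $ 0"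
  by (simp add: shift_def)

text \<open>From \<open>A = A $ 0 + X * A'\<close> the substitution should give
  \<open>A $ 0 + X / (1 - a X) * shift a A'\<close>; this is that equation with the denominator
  cleared. In coefficients it is Pascal's rule.\<close>

lemma shift_eq: "(1 - of_nat a * fps_X) * (shift a A - fps_const (A $ 0)) = fps_X * shift a (fps_shift 1 A)"
proof (rule fps_ext)
  fix n
  let ?c = "\<lambda>n r. ((n - 1) choose (n - r)) * a ^ (n - r)"
  have L: "((1 - of_nat a * fps_X) * (shift a A - fps_const (A $ 0))) $ n
     = (shift a A - fps_const (A $ 0)) $ n
       - of_nat a * (if n = 0 then 0 else (shift a A - fps_const (A $ 0)) $ (n - 1))"
    by (simp add: left_diff_distrib mult.assoc)
  show "((1 - of_nat a * fps_X) * (shift a A - fps_const (A $ 0))) $ n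
      = (fps_X * shift a (fps_shift 1 A)) $ n"
  proof (cases n)
    case 0 then show ?thesis by (simp add: L)
  next
    case (Suc m)
    show ?thesis
    proof (cases m)
      case 0 then show ?thesis unfolding L using Suc by (simp add: shift_def)
    next
      case (Suc k)
      have n: "n = Suc (Suc k)" using Suc \<open>n = Suc m\<close> by simp
      \<comment> \<open>The terms \<open>r = 1\<close> and \<open>r = n\<close> are split off: the
        first has no counterpart in \<open>fps_shift 1 A\<close>, and at the second truncated
        subtraction would falsify the recursion.\<close>
      have pascal: "?c n r = a * ?c (Suc k) r + ?c (Suc k) (r - 1)"
        if r: "r \<in> {2..Suc k}" for r
      proof -
        obtain j where j: "n - r = Suc j" using r n by (metis Suc_diff_le atLeastAtMost_iff le_Suc_eq)
        have 1: "Suc k - r = j" "Suc k - (r - 1) = Suc j" using j r n by auto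
        have 2: "Suc (Suc k) - r = Suc j" using j n by simp
        show ?thesis unfolding 1 n 2 by (simp add: algebra_simps)
      qed
      have "{1..n} = insert 1 (insert n {2..Suc k})" using n by auto
      then have "shift a A $ n = (\<Sum>r\<in>insert 1 (insert n {2..Suc k}). of_nat (?c n r) * A $ r)"
        using n by (simp only: shift_def fps_nth_Abs_fps) simp
      also have "\<dots> = of_nat (a ^ Suc k) * A $ 1 + A $ n
          + (\<Sum>r=2..Suc k. of_nat (?c n r) * A $ r)"
        using n by (simp add: add.assoc)
      also have "(\<Sum>r=2..Suc k. of_nat (?c n r) * A $ r)
          = of_nat a * (\<Sum>r=2..Suc k. of_nat (?c (Suc k) r) * A $ r)
            + (\<Sum>r=2..Suc k. of_nat (?c (Suc k) (r - 1)) * A $ r)"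
        unfolding sum_distrib_left sum.distrib[symmetric]
        by (rule sum.cong[OF refl]) (subst pascal, auto simp: algebra_simps)
      finally have 1: "shift a A $ n = of_nat (a ^ Suc k) * A $ 1 + A $ n
          + (of_nat a * (\<Sum>r=2..Suc k. of_nat (?c (Suc k) r) * A $ r)
            + (\<Sum>r=2..Suc k. of_nat (?c (Suc k) (r - 1)) * A $ r))" .
      have "{1..Suc k} = insert 1 {2..Suc k}" by auto
      then have "shift a A $ Suc k = (\<Sum>r\<in>insert 1 {2..Suc k}. of_nat (?c (Suc k) r) * A $ r)"
        by (simp only: shift_def fps_nth_Abs_fps) simp
      then have 2: "shift a A $ Suc k = of_nat (a ^ k) * A $ 1 + (\<Sum>r=2..Suc k. of_nat (?c (Suc k) r) * A $ r)"
        by simp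
      have "shift a (fps_shift 1 A) $ Suc k = (\<Sum>r=1..Suc k. of_nat (?c (Suc k) r) * A $ Suc r)"
        by (simp add: shift_def)
      also have "\<dots> = (\<Sum>r=1..k. of_nat (?c (Suc k) r) * A $ Suc r) + A $ n"
        by (simp add: n)
      also have "(\<Sum>r=1..k. of_nat (?c (Suc k) r) * A $ Suc r) = (\<Sum>r=2..Suc k. of_nat (?c (Suc k) (r - 1)) * A $ r)"
        by (rule sum.reindex_bij_witness[of _ "\<lambda>r. r - 1" Suc]) auto
      finally have 3: "shift a (fps_shift 1 A) $ Suc k
         = (\<Sum>r=2..Suc k. of_nat (?c (Suc k) (r - 1)) * A $ r) + A $ n" .
      show ?thesis unfolding L using n 3 2 1 by (simp add: algebra_simps)
    qed
  qed
qed

text \<open>The factor \<open>1 - a X\<close> can be cancelled, since a series \<open>D\<close> with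
  \<open>D = a X D\<close> vanishes by contraction.\<close>

lemma shift_pt_unique:
  fixes B C :: "'r::ring_1 fps"
  assumes "(1 - of_nat a * fps_X) * B = fps_X * C"
  shows "B = shift_pt a * C"
proof -
  have "(1 - of_nat a * fps_X) * (B - shift_pt a * C) = 0"
    by (simp add: right_diff_distrib assms flip: mult.assoc) (simp add: shift_pt_eq)
  then have "B - shift_pt a * C = of_nat a * fps_X * (B - shift_pt a * C)"
    by (simp add: left_diff_distrib)
  then have "(\<lambda>_::unit. B - shift_pt a * C) () = 0"
    by (intro fps_contraction[where z = "of_nat a * fps_X" and f = "\<lambda>x. x"]) simp_all
  then show ?thesis by simp
qed

lemma shift_rec: "shift a A = fps_const (A $ 0) + shift_pt a * shift a (fps_shift 1 A)"
  using shift_pt_unique[OF shift_eq[of a A]] by (simp add: algebra_simps)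

text \<open>A relation between coefficients \<open>A $ s\<close> can be summed against powers of the
  central point \<open>1/(u - a)\<close>; by this identity it becomes a relation for
  \<open>shift a A\<close>.\<close>

lemma ev_shift: "ev (shift_pt a) (\<lambda>s. fps_const (A $ s)) = shift a A"
proof (rule fps_contraction_eq[where z = "shift_pt a" and f = "fps_shift 1"
      and F = "\<lambda>A. ev (shift_pt a) (\<lambda>s. fps_const (A $ s))" and G = "shift a"])
  fix A :: "'a fps"
  show "ev (shift_pt a) (\<lambda>s. fps_const (A $ s)) - shift a A =
         shift_pt a * (ev (shift_pt a) (\<lambda>s. fps_const (fps_shift 1 A $ s)) - shift a (fps_shift 1 A))"
    by (subst ev_rec[OF shift_pt_0 central_shift_pt], subst shift_rec) (simp add: right_diff_distrib)
qed simp

lemma shift_add: "shift a (A + B) = shift a A + shift a B"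
  by (rule fps_ext) (simp add: shift_def distrib_left sum.distrib)

lemma shift_const [simp]: "shift a (fps_const c) = fps_const c"
  by (rule fps_ext) (auto simp: shift_def)

lemma shift_1 [simp]: "shift a 1 = 1"
  using shift_const[of a 1] by simp

lemma shift_const_mult: "shift a (fps_const c * A) = fps_const c * shift a A"
  by (rule fps_ext) (simp add: shift_def sum_distrib_left of_nat_left_commute del: of_nat_mult)

lemma fps_split: "A = fps_const (A $ 0) + fps_X * fps_shift 1 A" for A :: "'r::ring_1 fps"
  by (rule fps_ext) auto

lemma shift_X_mult: "shift a (fps_X * A) = shift_pt a * shift a A"
proof -
  have "fps_shift 1 (fps_X * A) = A" by (rule fps_ext) simp
  then show ?thesis by (subst shift_rec) simp
qed

text \<open>Contraction in the left factor; commutativity is avoided because the constant term of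
  \<open>A\<close> and the factor \<open>X\<close> both split off on the left.\<close>

lemma shift_mult: "shift a (A * B) = shift a A * shift a B"
proof (rule fps_contraction_eq[where z = "shift_pt a" and f = "fps_shift 1"
      and F = "\<lambda>A. shift a (A * B)" and G = "\<lambda>A. shift a A * shift a B"])
  fix A :: "'a fps"
  have "shift a (A * B) = shift a (fps_const (A $ 0) * B + fps_X * (fps_shift 1 A * B))"
    by (subst fps_split[of A]) (simp add: distrib_right mult.assoc)
  also have "\<dots> = fps_const (A $ 0) * shift a B + shift_pt a * shift a (fps_shift 1 A * B)"
    by (simp add: shift_add shift_const_mult shift_X_mult)
  finally show "shift a (A * B) - shift a A * shift a B
      = shift_pt a * (shift a (fps_shift 1 A * B) - shift a (fps_shift 1 A) * shift a B)"
    by (subst shift_rec[of a A]) (simp add: algebra_simps)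
qed simp

text \<open>Both sides obey the recursion for the point \<open>1/(u - a - b)\<close>. All that has
  to be computed is the image \<open>?w\<close> of \<open>1/(u - b)\<close>, by clearing
  denominators.\<close>

lemma shift_shift: "shift a (shift b A) = shift (a + b) A"
proof (rule fps_contraction_eq[where z = "shift_pt (a + b)" and f = "fps_shift 1"
      and F = "\<lambda>A. shift a (shift b A)" and G = "shift (a + b)"])
  fix A :: "'a fps"
  let ?w = "shift a (shift_pt b :: 'a fps)"
  have X: "shift a fps_X = (shift_pt a :: 'a fps)"
    using shift_X_mult[of a "1 :: 'a fps"] by simp
  have *: "shift a (of_nat b * fps_X) = of_nat b * (shift_pt a :: 'a fps)"
    using shift_const_mult[of a "of_nat b" "fps_X :: 'a fps"] by (simp add: fps_of_nat X)
  have "(1 - of_nat b * shift_pt a) * ?w = shift_pt a"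
  proof -
    have "shift a ((1 - of_nat b * fps_X) * shift_pt b) = (shift_pt a :: 'a fps)"
      by (simp add: shift_pt_eq X)
    moreover have "shift a (1 - of_nat b * fps_X) = 1 - of_nat b * (shift_pt a :: 'a fps)"
      using shift_add[of a "1 - of_nat b * fps_X" "of_nat b * fps_X :: 'a fps"]
      by (simp add: * eq_diff_eq add.commute)
    ultimately show ?thesis by (simp add: shift_mult)
  qed
  then have "(1 - of_nat a * fps_X) * (1 - of_nat b * shift_pt a) * ?w = fps_X"
    by (simp add: mult.assoc shift_pt_eq)
  moreover have "(1 - of_nat a * fps_X) * (1 - of_nat b * shift_pt a) = (1 - of_nat (a + b) * fps_X :: 'a fps)"
  proof -
    have "(1 - of_nat a * fps_X) * (of_nat b * shift_pt a) = of_nat b * (fps_X :: 'a fps)"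
      by (metis centralD[OF central_of_nat] mult.assoc shift_pt_eq)
    then show ?thesis by (simp add: right_diff_distrib distrib_right diff_diff_eq)
  qed
  ultimately have w: "?w = shift_pt (a + b)"
    using shift_pt_unique[of "a + b" ?w 1] by simp
  have "shift a (shift b A) = fps_const (A $ 0) + shift_pt (a + b) * shift a (shift b (fps_shift 1 A))"
    by (subst shift_rec[of b A]) (simp add: shift_add shift_mult w)
  then show "shift a (shift b A) - shift (a + b) A
      = shift_pt (a + b) * (shift a (shift b (fps_shift 1 A)) - shift (a + b) (fps_shift 1 A))"
    by (subst shift_rec[of "a + b" A]) (simp add: right_diff_distrib)
qed simp

text \<open>The coefficients see \<open>a\<close> only through its image in the ring, so in
  characteristic \<open>p\<close> a shift by \<open>p\<close> is no shift.\<close>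

lemma shift_cong_of_nat: "(of_nat a :: 'r::ring_1) = of_nat b \<Longrightarrow> shift a (A :: 'r fps) = shift b A"
  by (rule fps_ext) (simp add: shift_def)

lemma shift_0 [simp]: "shift 0 A = A"
proof (rule fps_contraction_eq[where z = fps_X and f = "fps_shift 1" and F = "shift 0" and G = "\<lambda>A. A"])
  fix A :: "'a fps"
  have "shift_pt 0 = (fps_X :: 'a fps)" using shift_pt_eq[of 0] by simp
  then have "shift 0 A = fps_const (A $ 0) + fps_X * shift 0 (fps_shift 1 A)"
    using shift_rec[of 0 A] by simp
  moreover have "A = fps_const (A $ 0) + fps_X * fps_shift 1 A" by (rule fps_split)
  ultimately have "shift 0 A - A = (fps_const (A $ 0) + fps_X * shift 0 (fps_shift 1 A))
      - (fps_const (A $ 0) + fps_X * fps_shift 1 A)" by (rule arg_cong2[where f = minus])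
  then show "shift 0 A - A = fps_X * (shift 0 (fps_shift 1 A) - fps_shift 1 A)"
    by (simp only: right_diff_distrib add_diff_cancel_left)
qed simp

section \<open>Supercommutation and inverse matrices\<close>

lemma pidx_simps [simp]: "pidx I1 = 0" "pidx I2 = 1"
  by (simp_all add: pidx_def)

lemma UNIV_idx: "UNIV = {I1, I2}"
  by (auto intro: idx.exhaust)

instance idx :: finite
  by standard (simp add: UNIV_idx)

lemma sum_idx: "(\<Sum>k\<in>UNIV. f k) = f I1 + f I2"
  by (simp add: UNIV_idx)

text \<open>Sign exponents of the defining relation: \<open>cross_deg\<close> for interchanging
  \<open>t_{i,j}\<close> with \<open>t_{k,l}\<close>, \<open>triple_deg\<close> for the right-hand
  side. Only residues modulo 2 matter, so sign identities are settled by running through the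
  indices.\<close>

abbreviation cross_deg :: "idx \<Rightarrow> idx \<Rightarrow> idx \<Rightarrow> idx \<Rightarrow> nat" where
  "cross_deg i j k l \<equiv> (pidx i + pidx j) * (pidx k + pidx l)"

abbreviation triple_deg :: "idx \<Rightarrow> idx \<Rightarrow> idx \<Rightarrow> nat" where
  "triple_deg i j k \<equiv> pidx i * pidx j + pidx i * pidx k + pidx j * pidx k"

lemma sign_mult: "((-1) ^ m * x) * ((-1) ^ n * y) = (-1) ^ (m + n) * (x * (y :: 'r::ring_1))"
  by (simp add: minus_one_power_iff)

lemma sign_cong: "even m = even n \<Longrightarrow> (-1) ^ m = ((-1) ^ n :: 'r::ring_1)"
  by (simp add: minus_one_power_iff)

lemma central_sign: "central ((-1) ^ n :: 'r::ring_1)"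
  by (simp add: central_def minus_one_power_iff)

lemma sign_sign: "(-1) ^ m * ((-1) ^ n * x) = (-1) ^ (m + n) * (x :: 'r::ring_1)"
  by (simp add: power_add mult.assoc)

lemma central_left_commute: "central z \<Longrightarrow> x * (z * y) = z * (x * (y :: 'r::ring_1))"
  by (metis centralD mult.assoc)

definition mat_inverses :: "(idx \<Rightarrow> idx \<Rightarrow> 's::ring_1) \<Rightarrow> (idx \<Rightarrow> idx \<Rightarrow> 's) \<Rightarrow> bool" where
  "mat_inverses A B \<longleftrightarrow>
     (\<forall>i j. (\<Sum>k\<in>UNIV. A i k * B k j) = (if i = j then 1 else 0)) \<and>
     (\<forall>i j. (\<Sum>k\<in>UNIV. B i k * A k j) = (if i = j then 1 else 0))"

text \<open>The signs that an element of parity \<open>q\<close> picks up on passing the entries of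
  \<open>A\<close>. They amount to conjugation by a diagonal sign matrix, so inverses are
  preserved.\<close>

definition twist :: "nat \<Rightarrow> (idx \<Rightarrow> idx \<Rightarrow> 's::ring_1) \<Rightarrow> idx \<Rightarrow> idx \<Rightarrow> 's" where
  "twist q A i j = (-1) ^ (q * (pidx i + pidx j)) * A i j"

lemma sign_path:
  "(-1) ^ (q * (pidx i + pidx k) + q * (pidx k + pidx j)) = ((-1) ^ (q * (pidx i + pidx j)) :: 's::ring_1)"
  by (rule sign_cong) (simp add: algebra_simps)

lemma mat_inverses_twist:
  fixes A B :: "idx \<Rightarrow> idx \<Rightarrow> 's::ring_1"
  assumes "mat_inverses A B"
  shows "mat_inverses (twist q A) (twist q B)"
proof -
  have *: "(\<Sum>k\<in>UNIV. twist q C i k * twist q D k j) = (if i = j then 1 else 0)"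
    if "\<And>i j. (\<Sum>k\<in>UNIV. C i k * D k j) = (if i = j then 1 else 0)"
    for C D :: "idx \<Rightarrow> idx \<Rightarrow> 's" and i j
  proof -
    have "(\<Sum>k\<in>UNIV. twist q C i k * twist q D k j)
        = (-1) ^ (q * (pidx i + pidx j)) * (\<Sum>k\<in>UNIV. C i k * D k j)"
      by (simp only: twist_def sign_mult sign_path sum_distrib_left)
    then show ?thesis by (cases "i = j") (simp_all add: that minus_one_power_iff)
  qed
  show ?thesis using assms unfolding mat_inverses_def by (blast intro: *)
qed

lemma delta_sum_left: "(\<Sum>k\<in>UNIV. (if n = k then 1 else 0) * f k) = (f n :: 's::ring_1)"
  for n :: idx
  by (cases n) (simp_all add: sum_idx)

lemma delta_sum_right: "(\<Sum>k\<in>UNIV. f k * (if k = n then 1 else 0)) = (f n :: 's::ring_1)"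
  for n :: idx
  by (cases n) (simp_all add: sum_idx)

text \<open>Multiplying \<open>x b - A x\<close> by \<open>A'\<close> on the left and
  \<open>b'\<close> on the right gives \<open>A' x - x b'\<close>. The central
  \<open>\<alpha>\<close> stands for the factor \<open>u - v\<close>, which is not
  invertible.\<close>

lemma inverse_intertwine:
  fixes A A' b b' :: "idx \<Rightarrow> idx \<Rightarrow> 's::ring_1"
  assumes A: "mat_inverses A A'" and b: "mat_inverses b b'" and c: "central \<alpha>"
    and H: "\<And>k l. \<alpha> * (x * b k l - A k l * x) = G k l"
  shows "\<alpha> * (A' n m * x - x * b' n m) = (\<Sum>k\<in>UNIV. \<Sum>l\<in>UNIV. A' n k * G k l * b' l m)"
proof -
  have "A' n k * G k l * b' l m
      = \<alpha> * (A' n k * x * (b k l * b' l m)) - \<alpha> * (A' n k * A k l * (x * b' l m))" for k l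
    by (simp add: H[symmetric] central_left_commute[OF c] mult.assoc right_diff_distrib left_diff_distrib)
  then have "(\<Sum>k\<in>UNIV. \<Sum>l\<in>UNIV. A' n k * G k l * b' l m)
     = \<alpha> * (\<Sum>k\<in>UNIV. \<Sum>l\<in>UNIV. A' n k * x * (b k l * b' l m))
       - \<alpha> * (\<Sum>k\<in>UNIV. \<Sum>l\<in>UNIV. A' n k * A k l * (x * b' l m))"
    by (simp add: sum_subtractf sum_distrib_left)
  also have "(\<Sum>k\<in>UNIV. \<Sum>l\<in>UNIV. A' n k * x * (b k l * b' l m))
      = (\<Sum>k\<in>UNIV. A' n k * x * (if k = m then 1 else 0))"
    using b by (simp only: sum_distrib_left[symmetric] mat_inverses_def)
  also have "\<dots> = A' n m * x" by (rule delta_sum_right)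
  also have "(\<Sum>k\<in>UNIV. \<Sum>l\<in>UNIV. A' n k * A k l * (x * b' l m))
      = (\<Sum>l\<in>UNIV. (if n = l then 1 else 0) * (x * b' l m))"
    by (subst sum.swap) (use A in \<open>simp only: sum_distrib_right[symmetric] mat_inverses_def\<close>)
  also have "\<dots> = x * b' n m" by (rule delta_sum_left)
  finally show ?thesis by (simp add: right_diff_distrib)
qed

text \<open>Here \<open>x\<close> is one entry of \<open>a\<close> and only \<open>b\<close> is
  inverted; on the right-hand side products of \<open>b\<close> with \<open>b'\<close> collapse to
  Kronecker deltas. The exponent \<open>e\<close> admits relations of either overall sign.\<close>

lemma inverse_rel_mixed:
  fixes a b a' b' :: "idx \<Rightarrow> idx \<Rightarrow> 's::ring_1"
  assumes b: "mat_inverses b b'" and c: "central \<alpha>" "central \<beta>"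
    and H: "\<And>k l. \<alpha> * (a i j * b k l - (-1) ^ cross_deg i j k l * (b k l * a i j))
       = \<beta> * ((-1) ^ (e + pidx i * pidx j + pidx i * pidx k + pidx j * pidx k) * (a k j * b i l - b k j * a i l))"
  shows "\<alpha> * ((-1) ^ cross_deg i j n m * (b' n m * a i j) - a i j * b' n m)
     = \<beta> * ((-1) ^ (e + (pidx i + pidx j) * pidx n + pidx i * pidx j)
        * ((if i = m then (\<Sum>k\<in>UNIV. b' n k * a k j) else 0) - (if n = j then (\<Sum>l\<in>UNIV. a i l * b' l m) else 0)))"
proof -
  define q where "q = pidx i + pidx j"
  let ?s = "(-1) ^ (e + q * pidx n + pidx i * pidx j) :: 's"
  have "\<alpha> * (twist q b' n m * a i j - a i j * b' n m) =
     (\<Sum>k\<in>UNIV. \<Sum>l\<in>UNIV. twist q b' n k * (\<beta> * ((-1) ^ (e + pidx i * pidx j + pidx i * pidx k + pidx j * pidx k) * (a k j * b i l - b k j * a i l))) * b' l m)"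
    by (rule inverse_intertwine[OF mat_inverses_twist[OF b] b c(1)])
      (use H in \<open>simp add: twist_def q_def mult.assoc\<close>)
  also have "\<dots> = (\<Sum>k\<in>UNIV. \<Sum>l\<in>UNIV. \<beta> * (?s * (b' n k * a k j * (b i l * b' l m) - b' n k * b k j * (a i l * b' l m))))"
  proof (intro sum.cong[OF refl])
    fix k l :: idx
    \<comment> \<open>The exponent does not depend on \<open>k\<close> modulo 2, so the sign leaves
      both sums.\<close>
    have s: "(-1) ^ (q * (pidx n + pidx k) + (e + pidx i * pidx j + pidx i * pidx k + pidx j * pidx k)) = ?s"
      by (intro sign_cong, cases i; cases j; cases n; cases k; simp add: q_def)
    show "twist q b' n k * (\<beta> * ((-1) ^ (e + pidx i * pidx j + pidx i * pidx k + pidx j * pidx k) * (a k j * b i l - b k j * a i l))) * b' l m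
      = \<beta> * (?s * (b' n k * a k j * (b i l * b' l m) - b' n k * b k j * (a i l * b' l m)))" (is "?L = _")
    proof -
      have "?L = \<beta> * ((twist q b' n k * ((-1) ^ (e + pidx i * pidx j + pidx i * pidx k + pidx j * pidx k) * (a k j * b i l - b k j * a i l))) * b' l m)"
        by (simp only: central_left_commute[OF c(2)] mult.assoc)
      then show ?thesis
        unfolding twist_def sign_mult s by (simp add: algebra_simps)
    qed
  qed
  also have "\<dots> = \<beta> * (?s * ((\<Sum>k\<in>UNIV. b' n k * a k j * (\<Sum>l\<in>UNIV. b i l * b' l m))
      - (\<Sum>l\<in>UNIV. (\<Sum>k\<in>UNIV. b' n k * b k j) * (a i l * b' l m))))"
    by (simp add: sum_idx algebra_simps)
  also have "(\<Sum>k\<in>UNIV. b' n k * a k j * (\<Sum>l\<in>UNIV. b i l * b' l m))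
     = (if i = m then (\<Sum>k\<in>UNIV. b' n k * a k j) else 0)"
    using b by (simp add: mat_inverses_def)
  also have "(\<Sum>l\<in>UNIV. (\<Sum>k\<in>UNIV. b' n k * b k j) * (a i l * b' l m))
     = (if n = j then (\<Sum>l\<in>UNIV. a i l * b' l m) else 0)"
    using b by (simp add: mat_inverses_def)
  finally show ?thesis by (simp add: twist_def q_def mult.assoc)
qed

text \<open>Second inversion: the mixed relation, now for a fixed entry of \<open>b'\<close> against
  all entries of \<open>a\<close>, is intertwined once more. The factors on the right come out in
  the order of \<open>yang_rel_alt\<close>, which later costs one sign.\<close>

lemma inverse_rel:
  fixes a b a' b' :: "idx \<Rightarrow> idx \<Rightarrow> 's::ring_1"
  assumes a: "mat_inverses a a'" and b: "mat_inverses b b'" and c: "central \<alpha>" "central \<beta>"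
    and H: "\<And>i j k l. \<alpha> * (a i j * b k l - (-1) ^ cross_deg i j k l * (b k l * a i j))
       = \<beta> * ((-1) ^ (e + pidx i * pidx j + pidx i * pidx k + pidx j * pidx k) * (a k j * b i l - b k j * a i l))"
  shows "\<alpha> * (a' i j * b' n m - (-1) ^ cross_deg i j n m * (b' n m * a' i j))
       = \<beta> * ((-1) ^ (e + pidx j * pidx n + pidx j * pidx m + pidx n * pidx m) * (a' i m * b' n j - b' i m * a' n j))"
proof -
  define r where "r = pidx n + pidx m"
  let ?W = "\<lambda>n j. \<Sum>k\<in>UNIV. b' n k * a k j" and ?V = "\<lambda>i m. \<Sum>l\<in>UNIV. a i l * b' l m"
  let ?G = "\<lambda>k l. \<beta> * ((-1) ^ (e + (pidx k + pidx l) * pidx m + pidx k * pidx l)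
        * ((if k = m then ?W n l else 0) - (if n = l then ?V k m else 0)))"
  have G: "\<alpha> * (b' n m * a k l - twist r a k l * b' n m) = ?G k l" for k l
  proof -
    define t :: 's where "t = (-1) ^ cross_deg k l n m"
    have ct: "central t" unfolding t_def by (rule central_sign)
    have tt: "t * (t * x) = x" for x by (simp add: t_def sign_sign minus_one_power_iff)
    have tw: "twist r a k l = t * a k l" by (simp add: twist_def t_def r_def mult.commute)
    let ?D = "(if k = m then ?W n l else 0) - (if n = l then ?V k m else 0)"
    have "\<alpha> * (t * (b' n m * a k l) - a k l * b' n m)
      = \<beta> * ((-1) ^ (e + (pidx k + pidx l) * pidx n + pidx k * pidx l) * ?D)"
      unfolding t_def by (rule inverse_rel_mixed[OF b c H])
    then have "t * (\<alpha> * (t * (b' n m * a k l) - a k l * b' n m))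
      = t * (\<beta> * ((-1) ^ (e + (pidx k + pidx l) * pidx n + pidx k * pidx l) * ?D))" by simp
    also have "t * (\<alpha> * (t * (b' n m * a k l) - a k l * b' n m)) = \<alpha> * (t * (t * (b' n m * a k l) - a k l * b' n m))"
      by (rule central_left_commute[OF ct, symmetric])
    also have "t * (\<beta> * ((-1) ^ (e + (pidx k + pidx l) * pidx n + pidx k * pidx l) * ?D))
      = \<beta> * (t * ((-1) ^ (e + (pidx k + pidx l) * pidx n + pidx k * pidx l) * ?D))"
      by (rule central_left_commute[OF ct, symmetric])
    also have "t * ((-1) ^ (e + (pidx k + pidx l) * pidx n + pidx k * pidx l) * ?D)
       = (-1) ^ (e + (pidx k + pidx l) * pidx m + pidx k * pidx l) * ?D"
      unfolding t_def sign_sign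
      by (rule arg_cong[of _ _ "\<lambda>y. y * ?D"], intro sign_cong, cases k; cases l; cases n; cases m; simp)
    finally show ?thesis by (simp add: right_diff_distrib tt tw mult.assoc)
  qed
  let ?s = "(-1) ^ (e + r * pidx i + pidx n * pidx m) :: 's"
  have "\<alpha> * (twist r a' i j * b' n m - b' n m * a' i j)
     = (\<Sum>k\<in>UNIV. \<Sum>l\<in>UNIV. twist r a' i k * ?G k l * a' l j)"
    by (rule inverse_intertwine[OF mat_inverses_twist[OF a] a c(1) G])
  also have "\<dots> = (\<Sum>k\<in>UNIV. \<Sum>l\<in>UNIV. \<beta> * (?s * ((if k = m then a' i k else 0) * (?W n l * a' l j)
      - (a' i k * ?V k m) * (if n = l then a' l j else 0))))"
  proof (intro sum.cong[OF refl])
    fix k l :: idx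
    let ?D = "(if k = m then ?W n l else 0) - (if n = l then ?V k m else 0)"
    let ?e = "r * (pidx i + pidx k) + (e + (pidx k + pidx l) * pidx m + pidx k * pidx l)"
    \<comment> \<open>The sign varies with \<open>k\<close> and \<open>l\<close>, but the deltas
      leave only \<open>k = m\<close> or \<open>n = l\<close>, and there it equals
      \<open>?s\<close>.\<close>
    have s1: "(-1) ^ ?e = ?s" if "k = m" using that
      by (intro sign_cong, cases i; cases l; cases n; cases m; simp add: r_def)
    have s2: "(-1) ^ ?e = ?s" if "n = l" using that
      by (intro sign_cong, cases i; cases k; cases n; cases m; simp add: r_def)
    have "twist r a' i k * ?G k l * a' l j = \<beta> * ((twist r a' i k * ((-1) ^ (e + (pidx k + pidx l) * pidx m + pidx k * pidx l) * ?D)) * a' l j)"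
      by (simp only: central_left_commute[OF c(2)] mult.assoc)
    also have "\<dots> = \<beta> * ((-1) ^ ?e * (a' i k * ?D) * a' l j)"
      unfolding twist_def sign_mult by simp
    also have "(-1) ^ ?e * (a' i k * ?D) * a' l j
       = ?s * ((if k = m then a' i k else 0) * (?W n l * a' l j) - (a' i k * ?V k m) * (if n = l then a' l j else 0))"
    proof (cases "k = m \<or> n = l")
      case True
      then have s: "(-1) ^ ?e = ?s" using s1 s2 by blast
      show ?thesis unfolding s by (simp add: algebra_simps)
    qed simp
    finally show "twist r a' i k * ?G k l * a' l j = \<beta> * (?s * ((if k = m then a' i k else 0) * (?W n l * a' l j) - (a' i k * ?V k m) * (if n = l then a' l j else 0)))" .
  qed
  also have "\<dots> = \<beta> * (?s * ((\<Sum>k\<in>UNIV. (if k = m then a' i k else 0) * (\<Sum>l\<in>UNIV. ?W n l * a' l j))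
      - (\<Sum>k\<in>UNIV. a' i k * ?V k m) * (\<Sum>l\<in>UNIV. if n = l then a' l j else 0)))"
    by (simp only: sum_distrib_left right_diff_distrib sum_subtractf sum_distrib_right)
      (simp add: sum_idx algebra_simps)
  also have "(\<Sum>l\<in>UNIV. ?W n l * a' l j) = b' n j"
  proof -
    have "(\<Sum>l\<in>UNIV. ?W n l * a' l j) = (\<Sum>k\<in>UNIV. b' n k * (\<Sum>l\<in>UNIV. a k l * a' l j))"
      by (simp add: sum_idx algebra_simps)
    then show ?thesis using a by (simp add: mat_inverses_def delta_sum_right)
  qed
  also have "(\<Sum>k\<in>UNIV. a' i k * ?V k m) = b' i m"
  proof -
    have "(\<Sum>k\<in>UNIV. a' i k * ?V k m) = (\<Sum>l\<in>UNIV. (\<Sum>k\<in>UNIV. a' i k * a k l) * b' l m)"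
      by (simp add: sum_idx algebra_simps)
    then show ?thesis using a by (simp add: mat_inverses_def delta_sum_left)
  qed
  also have "(\<Sum>k\<in>UNIV. (if k = m then a' i k else 0) * b' n j) = a' i m * b' n j"
    by (cases m) (simp_all add: sum_idx)
  also have "(\<Sum>l\<in>UNIV. if n = l then a' l j else 0) = a' n j" by simp
  finally have main: "\<alpha> * (twist r a' i j * b' n m - b' n m * a' i j)
     = \<beta> * (?s * (a' i m * b' n j - b' i m * a' n j))" .
  define t :: 's where "t = (-1) ^ (r * (pidx i + pidx j))"
  have ct: "central t" unfolding t_def by (rule central_sign)
  have tt: "t * (t * x) = x" for x by (simp add: t_def sign_sign minus_one_power_iff)
  have "t * (\<alpha> * (t * (a' i j * b' n m) - b' n m * a' i j)) = t * (\<beta> * (?s * (a' i m * b' n j - b' i m * a' n j)))"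
    using main by (simp add: twist_def t_def mult.assoc)
  also have "t * (\<alpha> * (t * (a' i j * b' n m) - b' n m * a' i j)) = \<alpha> * (t * (t * (a' i j * b' n m) - b' n m * a' i j))"
    by (rule central_left_commute[OF ct, symmetric])
  also have "t * (\<beta> * (?s * (a' i m * b' n j - b' i m * a' n j))) = \<beta> * (t * (?s * (a' i m * b' n j - b' i m * a' n j)))"
    by (rule central_left_commute[OF ct, symmetric])
  also have "t * (?s * (a' i m * b' n j - b' i m * a' n j))
     = (-1) ^ (e + pidx j * pidx n + pidx j * pidx m + pidx n * pidx m) * (a' i m * b' n j - b' i m * a' n j)"
    unfolding t_def sign_sign
    by (rule arg_cong[of _ _ "\<lambda>y. y * _"], intro sign_cong, cases i; cases j; cases n; cases m; simp add: r_def)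
  finally show ?thesis by (simp add: right_diff_distrib tt) (simp add: t_def r_def mult.commute)
qed

section \<open>The defining relations in two variables\<close>

text \<open>The recursion of \<open>mat_inv\<close> over an arbitrary ring, so that evaluation
  homomorphisms carry one to the other. It solves for a right inverse when the constant term is the
  identity matrix.\<close>

function mat_inv_coeff :: "(idx \<Rightarrow> idx \<Rightarrow> 'r::ring_1 fps) \<Rightarrow> nat \<Rightarrow> idx \<Rightarrow> idx \<Rightarrow> 'r" where
  "mat_inv_coeff A n i j = (if n = 0 then (if i = j then 1 else 0)
     else - (\<Sum>m=1..n. \<Sum>k\<in>UNIV. A i k $ m * mat_inv_coeff A (n - m) k j))"
  by auto
termination by (relation "measure (\<lambda>(A,n,i,j). n)") auto

declare mat_inv_coeff.simps [simp del]

definition minv :: "(idx \<Rightarrow> idx \<Rightarrow> 'r::ring_1 fps) \<Rightarrow> idx \<Rightarrow> idx \<Rightarrow> 'r fps" where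
  "minv A i j = Abs_fps (\<lambda>n. mat_inv_coeff A n i j)"

definition unital :: "(idx \<Rightarrow> idx \<Rightarrow> 'r::ring_1 fps) \<Rightarrow> bool" where
  "unital T \<longleftrightarrow> (\<forall>i j. T i j $ 0 = (if i = j then 1 else 0))"

lemma unital_minv: "unital (minv A)"
  by (simp add: unital_def minv_def mat_inv_coeff.simps)

lemma minv_right:
  assumes "unital A"
  shows "(\<Sum>k\<in>UNIV. A i k * minv A k j) = (if i = j then 1 else 0)"
proof (rule fps_ext)
  fix n
  have "(\<Sum>k\<in>UNIV. A i k * minv A k j) $ n
      = (\<Sum>k\<in>UNIV. \<Sum>m=0..n. A i k $ m * mat_inv_coeff A (n - m) k j)"
    by (simp add: fps_sum_nth fps_mult_nth minv_def)
  also have "\<dots> = (\<Sum>m=0..n. \<Sum>k\<in>UNIV. A i k $ m * mat_inv_coeff A (n - m) k j)"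
    by (rule sum.swap)
  also have "\<dots> = (\<Sum>k\<in>UNIV. A i k $ 0 * mat_inv_coeff A n k j)
      + (\<Sum>m=1..n. \<Sum>k\<in>UNIV. A i k $ m * mat_inv_coeff A (n - m) k j)"
    by (simp add: sum.atLeast_Suc_atMost)
  also have "(\<Sum>k\<in>UNIV. A i k $ 0 * mat_inv_coeff A n k j) = mat_inv_coeff A n i j"
    using assms by (simp add: unital_def delta_sum_left)
  also have "mat_inv_coeff A n i j + (\<Sum>m=1..n. \<Sum>k\<in>UNIV. A i k $ m * mat_inv_coeff A (n - m) k j)
     = (if i = j then 1 else 0) $ n"
    by (subst mat_inv_coeff.simps) simp
  finally show "(\<Sum>k\<in>UNIV. A i k * minv A k j) $ n = (if i = j then 1 else 0) $ n" .
qed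

lemma mat_assoc:
  fixes A B C :: "idx \<Rightarrow> idx \<Rightarrow> 's::ring_1"
  shows "(\<Sum>k\<in>UNIV. A i k * (\<Sum>l\<in>UNIV. B k l * C l j)) = (\<Sum>l\<in>UNIV. (\<Sum>k\<in>UNIV. A i k * B k l) * C l j)"
  by (simp add: sum_idx algebra_simps)

lemma left_right_inverse_unique:
  fixes A B C :: "idx \<Rightarrow> idx \<Rightarrow> 's::ring_1"
  assumes "\<And>i j. (\<Sum>k\<in>UNIV. A i k * B k j) = (if i = j then 1 else 0)"
    and "\<And>i j. (\<Sum>k\<in>UNIV. B i k * C k j) = (if i = j then 1 else 0)"
  shows "A i j = C i j"
  using mat_assoc[of A i B C j] by (simp add: assms delta_sum_left delta_sum_right)

text \<open>The recursion yields right inverses only. But \<open>A\<close> is a left inverse and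
  \<open>minv (minv A)\<close> a right inverse of \<open>minv A\<close>, so they coincide and
  \<open>minv A\<close> is two-sided.\<close>

lemma mat_inverses_minv:
  assumes "unital A"
  shows "mat_inverses A (minv A)"
proof -
  have "A i j = minv (minv A) i j" for i j
    by (rule left_right_inverse_unique[OF minv_right minv_right]) (rule assms unital_minv)+
  then show ?thesis
    using minv_right[OF assms] minv_right[OF unital_minv[of A]] by (simp add: mat_inverses_def)
qed

lemma minv_unique:
  assumes "unital A" and "\<And>i j. (\<Sum>k\<in>UNIV. A i k * B k j) = (if i = j then 1 else 0)"
  shows "minv A i j = B i j"
  by (rule left_right_inverse_unique[of "minv A" A B])
    (use mat_inverses_minv[OF assms(1)] assms(2) in \<open>simp_all add: mat_inverses_def\<close>)

section \<open>Coefficient form of the defining relations\<close>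

definition scomm :: "(idx \<Rightarrow> idx \<Rightarrow> 'r::ring_1 fps) \<Rightarrow> idx \<Rightarrow> idx \<Rightarrow> idx \<Rightarrow> idx \<Rightarrow> nat \<Rightarrow> nat \<Rightarrow> 'r" where
  "scomm T i j k l r s = T i j $ r * T k l $ s
     - (-1) ^ cross_deg i j k l * (T k l $ s * T i j $ r)"

text \<open>The coefficients of the relation multiplied by \<open>u - v\<close>; unlike the defining
  relation it has no sums, which telescoping recovers. The parity of \<open>e\<close> is the overall
  sign on the right: even for \<open>T\<close>, odd for its inverse.\<close>

definition yang_rel :: "nat \<Rightarrow> (idx \<Rightarrow> idx \<Rightarrow> 'r::ring_1 fps) \<Rightarrow> bool" where
  "yang_rel e T \<longleftrightarrow> (\<forall>i j k l r s. scomm T i j k l (Suc r) s - scomm T i j k l r (Suc s)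
      = (-1) ^ (e + pidx i * pidx j + pidx i * pidx k + pidx j * pidx k)
        * (T k j $ r * T i l $ s - T k j $ s * T i l $ r))"

lemma yang_relD: "yang_rel e T \<Longrightarrow> scomm T i j k l (Suc r) s - scomm T i j k l r (Suc s)
      = (-1) ^ (e + pidx i * pidx j + pidx i * pidx k + pidx j * pidx k)
        * (T k j $ r * T i l $ s - T k j $ s * T i l $ r)"
  by (simp add: yang_rel_def)

lemma scomm_flip: "scomm T i j k l r s
   = - ((-1) ^ cross_deg i j k l * scomm T k l i j s r)"
  by (cases i; cases j; cases k; cases l; simp add: scomm_def)

lemma scomm_diff_flip: "scomm T i j k l (Suc r) s - scomm T i j k l r (Suc s)
   = (-1) ^ cross_deg i j k l
     * (scomm T k l i j (Suc s) r - scomm T k l i j s (Suc r))"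
  by (subst (1 2) scomm_flip) (simp add: right_diff_distrib)

text \<open>The relation for the interchanged generators, rewritten by \<open>scomm_flip\<close>.
  Its right-hand side has the order of factors that inversion produces.\<close>

lemma yang_rel_alt:
  "yang_rel e T \<longleftrightarrow> (\<forall>i j k l r s. scomm T i j k l (Suc r) s - scomm T i j k l r (Suc s)
      = (-1) ^ (Suc e + pidx j * pidx k + pidx j * pidx l + pidx k * pidx l)
        * (T i l $ r * T k j $ s - T i l $ s * T k j $ r))"
    (is "?L = ?R")
proof
  assume ?L
  show ?R
  proof (intro allI)
    fix i j k l r s
    show "scomm T i j k l (Suc r) s - scomm T i j k l r (Suc s)
      = (-1) ^ (Suc e + pidx j * pidx k + pidx j * pidx l + pidx k * pidx l)
        * (T i l $ r * T k j $ s - T i l $ s * T k j $ r)"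
      by (subst scomm_diff_flip, subst yang_relD[OF \<open>?L\<close>], cases i; cases j; cases k; cases l)
        (simp_all add: algebra_simps minus_one_power_iff)
  qed
next
  assume R: ?R
  show ?L unfolding yang_rel_def
  proof (intro allI)
    fix i j k l r s
    show "scomm T i j k l (Suc r) s - scomm T i j k l r (Suc s)
      = (-1) ^ (e + pidx i * pidx j + pidx i * pidx k + pidx j * pidx k)
        * (T k j $ r * T i l $ s - T k j $ s * T i l $ r)"
      by (subst scomm_diff_flip, subst R[rule_format], cases i; cases j; cases k; cases l)
        (simp_all add: algebra_simps minus_one_power_iff)
  qed
qed

lemma scomm_0_left: "unital T \<Longrightarrow> scomm T i j k l 0 s = 0"
  by (cases i; cases j; simp add: scomm_def unital_def)

lemma scomm_0_right: "unital T \<Longrightarrow> scomm T i j k l r 0 = 0"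
  by (cases k; cases l; simp add: scomm_def unital_def)

text \<open>\<open>emb_u\<close> and \<open>emb_v\<close> turn a series into the same series in the outer, respectively inner,
  of two independent variables; \<open>cf_diff\<close> and \<open>cf_prod\<close> are \<open>(u - v)/(u v)\<close> and \<open>1/(u v)\<close>.\<close>

definition emb_u :: "'r::ring_1 fps \<Rightarrow> 'r fps fps" where
  "emb_u A = Abs_fps (\<lambda>r. fps_const (A $ r))"

definition emb_v :: "'r::ring_1 fps \<Rightarrow> 'r fps fps" where
  "emb_v A = fps_const A"

definition cf_diff :: "'r::ring_1 fps fps" where "cf_diff = fps_const fps_X - fps_X"
definition cf_prod :: "'r::ring_1 fps fps" where "cf_prod = fps_X * fps_const fps_X"

lemma central_fps_const: "central z \<Longrightarrow> central (fps_const z :: 'r::ring_1 fps)"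
  unfolding central_def by (auto intro!: fps_ext)

lemma central_cf: "central (cf_diff :: 'r::ring_1 fps fps)" "central (cf_prod :: 'r::ring_1 fps fps)"
  by (simp_all add: cf_diff_def cf_prod_def central_diff central_mult central_fps_const central_fps_X)

lemma emb_u_nth [simp]: "emb_u A $ n = fps_const (A $ n)"
  by (simp add: emb_u_def)

lemma emb_mult: "emb_u (A * B) = emb_u A * emb_u B" "emb_v (A * B) = emb_v A * emb_v B"
  by (auto intro!: fps_ext simp: emb_u_def emb_v_def fps_mult_nth fps_sum_nth)

lemma emb_add: "emb_u (A + B) = emb_u A + emb_u B" "emb_v (A + B) = emb_v A + emb_v B"
  by (auto intro!: fps_ext simp: emb_u_def emb_v_def)

lemma emb_one_zero: "emb_u 1 = 1" "emb_v 1 = 1" "emb_u 0 = 0" "emb_v 0 = 0"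
  by (auto intro!: fps_ext simp: emb_u_def emb_v_def)

lemma emb_uv_nth: "(emb_u A * emb_v B) $ r $ s = A $ r * B $ s"
  "(emb_v A * emb_u B) $ r $ s = A $ s * B $ r"
  by (simp_all add: emb_v_def)

lemma mat_inverses_emb:
  assumes "mat_inverses A B"
  shows "mat_inverses (\<lambda>i j. emb_u (A i j)) (\<lambda>i j. emb_u (B i j))"
    and "mat_inverses (\<lambda>i j. emb_v (A i j)) (\<lambda>i j. emb_v (B i j))"
  using assms unfolding mat_inverses_def
  by (simp_all add: sum_idx emb_mult[symmetric] emb_add[symmetric] emb_one_zero if_distrib cong: if_cong)

text \<open>Multiplication by \<open>u - v\<close> compares neighbouring coefficients. Since
  \<open>c\<close> vanishes on both edges of the coefficient table, the edge equations are trivial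
  and only the recursion remains.\<close>

lemma cf_diff_eq_iff:
  fixes c f :: "'r::ring_1 fps fps"
  assumes "\<And>r. c $ r $ 0 = 0" "\<And>s. c $ 0 $ s = 0"
  shows "cf_diff * c = cf_prod * f \<longleftrightarrow> (\<forall>r s. c $ Suc r $ s - c $ r $ Suc s = f $ r $ s)"
proof -
  have D: "(cf_diff * c) $ n $ m = (if m = 0 then 0 else c $ n $ (m - 1)) - (if n = 0 then 0 else c $ (n - 1) $ m)" for n m
    by (cases n; cases m; simp add: cf_diff_def left_diff_distrib)
  have P: "(cf_prod * f) $ n $ m = (if n = 0 \<or> m = 0 then 0 else f $ (n - 1) $ (m - 1))" for n m
    by (cases n; cases m; simp add: cf_prod_def mult.assoc)
  have "cf_diff * c = cf_prod * f \<longleftrightarrow> (\<forall>n m. (cf_diff * c) $ n $ m = (cf_prod * f) $ n $ m)"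
    by (metis fps_ext)
  also have "\<dots> \<longleftrightarrow> (\<forall>r s. c $ Suc r $ s - c $ r $ Suc s = f $ r $ s)"
  proof
    assume H: "\<forall>n m. (cf_diff * c) $ n $ m = (cf_prod * f) $ n $ m"
    show "\<forall>r s. c $ Suc r $ s - c $ r $ Suc s = f $ r $ s"
    proof (intro allI)
      fix r s
      show "c $ Suc r $ s - c $ r $ Suc s = f $ r $ s"
        using H[rule_format, of "Suc r" "Suc s"] unfolding D P by simp
    qed
  next
    assume H: "\<forall>r s. c $ Suc r $ s - c $ r $ Suc s = f $ r $ s"
    show "\<forall>n m. (cf_diff * c) $ n $ m = (cf_prod * f) $ n $ m"
    proof (intro allI)
      fix n m
      show "(cf_diff * c) $ n $ m = (cf_prod * f) $ n $ m"
        unfolding D P using H assms by (cases n; cases m) auto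
    qed
  qed
  finally show ?thesis .
qed

lemma sign_mult_nth: "((-1) ^ n * c) $ r $ s = (-1) ^ n * (c $ r $ s)"
  for c :: "'r::ring_1 fps fps"
  by (simp add: minus_one_power_iff)

definition gen_scomm :: "(idx \<Rightarrow> idx \<Rightarrow> 'r::ring_1 fps) \<Rightarrow> idx \<Rightarrow> idx \<Rightarrow> idx \<Rightarrow> idx \<Rightarrow> 'r fps fps" where
  "gen_scomm T i j k l = emb_u (T i j) * emb_v (T k l)
     - (-1) ^ cross_deg i j k l * (emb_v (T k l) * emb_u (T i j))"

lemma gen_scomm_nth: "gen_scomm T i j k l $ r $ s = scomm T i j k l r s"
  by (simp add: gen_scomm_def scomm_def sign_mult_nth emb_uv_nth del: emb_u_nth)

lemma gen_scomm_eq_iff: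
  assumes "unital T"
  shows "cf_diff * gen_scomm T i j k l = cf_prod * f \<longleftrightarrow>
    (\<forall>r s. scomm T i j k l (Suc r) s - scomm T i j k l r (Suc s) = f $ r $ s)"
  using cf_diff_eq_iff[of "gen_scomm T i j k l" f]
  by (simp only: gen_scomm_nth scomm_0_left scomm_0_right assms)

lemma yang_rel_gen:
  assumes "unital T"
  shows "yang_rel e T \<longleftrightarrow> (\<forall>i j k l. cf_diff * gen_scomm T i j k l
    = cf_prod * ((-1) ^ (e + pidx i * pidx j + pidx i * pidx k + pidx j * pidx k)
       * (emb_u (T k j) * emb_v (T i l) - emb_v (T k j) * emb_u (T i l))))"
  by (simp only: gen_scomm_eq_iff[OF assms] sign_mult_nth emb_uv_nth fps_sub_nth yang_rel_def)

lemma yang_rel_minv: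
  assumes T: "unital T" and rel: "yang_rel e T"
  shows "yang_rel (Suc e) (minv T)"
proof -
  let ?M = "minv T"
  note inv = mat_inverses_emb[OF mat_inverses_minv[OF T]]
  note H = iffD1[OF yang_rel_gen[OF T] rel, rule_format, unfolded gen_scomm_def]
  have "cf_diff * gen_scomm ?M i j k l
    = cf_prod * ((-1) ^ (e + pidx j * pidx k + pidx j * pidx l + pidx k * pidx l)
       * (emb_u (?M i l) * emb_v (?M k j) - emb_v (?M i l) * emb_u (?M k j)))" for i j k l
    unfolding gen_scomm_def by (rule inverse_rel[OF inv central_cf H])
  then have "scomm ?M i j k l (Suc r) s - scomm ?M i j k l r (Suc s)
      = (-1) ^ (e + pidx j * pidx k + pidx j * pidx l + pidx k * pidx l)
        * (?M i l $ r * ?M k j $ s - ?M i l $ s * ?M k j $ r)" for i j k l r s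
    by (simp only: gen_scomm_eq_iff[OF unital_minv] sign_mult_nth emb_uv_nth fps_sub_nth)
  then show ?thesis unfolding yang_rel_alt by simp
qed

section \<open>The dual family: the inverse matrix with swapped indices\<close>

definition swap_idx :: "idx \<Rightarrow> idx" where "swap_idx i = (if i = I1 then I2 else I1)"

lemma swap_idx_simps [simp]: "swap_idx I1 = I2" "swap_idx I2 = I1" "swap_idx (swap_idx i) = i"
  "swap_idx i = swap_idx j \<longleftrightarrow> i = j"
  by (auto simp: swap_idx_def intro: idx.exhaust)

text \<open>Parity reversal exchanges \<open>t_{1,1}\<close> and \<open>t'_{2,2} = d_2^{-1}\<close>, hence \<open>b_1\<close> and \<open>b_2\<close>.\<close>

definition dual :: "(idx \<Rightarrow> idx \<Rightarrow> 'r::ring_1 fps) \<Rightarrow> idx \<Rightarrow> idx \<Rightarrow> 'r fps" where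
  "dual T i j = minv T (swap_idx i) (swap_idx j)"

lemma unital_dual: "unital (dual T)"
  using unital_minv[of T] by (simp add: unital_def dual_def)

lemma yang_rel_dual:
  assumes "unital T" "yang_rel e T"
  shows "yang_rel e (dual T)"
proof -
  have s: "scomm (dual T) i j k l r s = scomm (minv T) (swap_idx i) (swap_idx j) (swap_idx k) (swap_idx l) r s"
    for i j k l r s
    by (cases i; cases j; cases k; cases l; simp add: scomm_def dual_def)
  show ?thesis unfolding yang_rel_def s yang_relD[OF yang_rel_minv[OF assms]]
  proof (intro allI)
    fix i j k l r s
    \<comment> \<open>Complementing all three parities changes the exponent by an odd number, which
      cancels the sign acquired by inversion.\<close>
    have "(-1) ^ (Suc e + pidx (swap_idx i) * pidx (swap_idx j) + pidx (swap_idx i) * pidx (swap_idx k)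
          + pidx (swap_idx j) * pidx (swap_idx k))
      = ((-1) ^ (e + pidx i * pidx j + pidx i * pidx k + pidx j * pidx k) :: 'a)"
      by (rule sign_cong, cases i; cases j; cases k; simp)
    then show "(-1) ^ (Suc e + pidx (swap_idx i) * pidx (swap_idx j) + pidx (swap_idx i) * pidx (swap_idx k)
          + pidx (swap_idx j) * pidx (swap_idx k)) *
        (minv T (swap_idx k) (swap_idx j) $ r * minv T (swap_idx i) (swap_idx l) $ s -
         minv T (swap_idx k) (swap_idx j) $ s * minv T (swap_idx i) (swap_idx l) $ r) =
        (-1) ^ (e + pidx i * pidx j + pidx i * pidx k + pidx j * pidx k) *
        (dual T k j $ r * dual T i l $ s - dual T k j $ s * dual T i l $ r)"
      by (simp only: dual_def)
  qed
qed

section \<open>Products of supercommuting families\<close>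

text \<open>Covers the two situations to come: the legs of a tensor product, and left against right
  multiplications.\<close>

definition scommute :: "(idx \<Rightarrow> idx \<Rightarrow> 'r::ring_1 fps) \<Rightarrow> (idx \<Rightarrow> idx \<Rightarrow> 'r fps) \<Rightarrow> bool" where
  "scommute A B \<longleftrightarrow> (\<forall>i j k l r s. B k l $ s * A i j $ r
     = (-1) ^ cross_deg i j k l * (A i j $ r * B k l $ s))"

lemma scommute_sym: "scommute A B \<Longrightarrow> scommute B A"
  unfolding scommute_def
proof (intro allI)
  fix i j k l r s
  assume H: "\<forall>i j k l r s. B k l $ s * A i j $ r
     = (-1) ^ cross_deg i j k l * (A i j $ r * B k l $ s)"
  show "A k l $ s * B i j $ r = (-1) ^ cross_deg i j k l * (B i j $ r * A k l $ s)"
    unfolding H[rule_format, of i j r k l s] sign_sign by (auto simp: minus_one_power_iff)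
qed

text \<open>When \<open>A\<close> and \<open>B\<close> are the two legs, this is the coproduct of
  the generating matrix.\<close>

definition mprod :: "(idx \<Rightarrow> idx \<Rightarrow> 'r::ring_1 fps) \<Rightarrow> (idx \<Rightarrow> idx \<Rightarrow> 'r fps) \<Rightarrow> idx \<Rightarrow> idx \<Rightarrow> 'r fps" where
  "mprod A B i j = (\<Sum>k\<in>UNIV. A i k * B k j)"

lemma unital_mprod: "unital A \<Longrightarrow> unital B \<Longrightarrow> unital (mprod A B)"
  unfolding unital_def by (simp add: mprod_def fps_sum_nth delta_sum_left)

lemma minv_mprod:
  assumes "unital A" "unital B"
  shows "minv (mprod A B) = mprod (minv B) (minv A)"
proof (intro ext minv_unique unital_mprod assms)
  fix i j
  have "(\<Sum>k\<in>UNIV. mprod A B i k * mprod (minv B) (minv A) k j)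
     = (\<Sum>k\<in>UNIV. A i k * (\<Sum>m\<in>UNIV. (\<Sum>l\<in>UNIV. B k l * minv B l m) * minv A m j))"
    by (simp add: mprod_def sum_idx algebra_simps)
  also have "\<dots> = (\<Sum>k\<in>UNIV. A i k * minv A k j)"
    by (simp add: minv_right[OF assms(2)] delta_sum_left)
  finally show "(\<Sum>k\<in>UNIV. mprod A B i k * mprod (minv B) (minv A) k j) = (if i = j then 1 else 0)"
    by (simp add: minv_right[OF assms(1)])
qed

lemma dual_mprod:
  assumes "unital A" "unital B"
  shows "dual (mprod A B) = mprod (dual B) (dual A)"
  by (intro ext) (simp add: dual_def minv_mprod[OF assms] mprod_def sum_idx)

lemma exchange_pairs:
  fixes x y z w :: "'s::ring_1"
  assumes c: "central \<alpha>" "central \<beta>" "central s" "central t"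
    and P: "\<alpha> * (x * y) = s * (\<alpha> * (y * x)) + \<beta> * p"
    and Q: "\<alpha> * (z * w) = t * (\<alpha> * (w * z)) + \<beta> * q"
  shows "\<alpha> * (x * y * (z * w)) = s * (t * (\<alpha> * (y * x * (w * z)))) + \<beta> * (s * (y * x * q) + p * (z * w))"
proof -
  have "\<alpha> * (x * y * (z * w)) = (\<alpha> * (x * y)) * (z * w)" by (simp add: mult.assoc)
  also have "\<dots> = s * (\<alpha> * (y * x * (z * w))) + \<beta> * (p * (z * w))"
    unfolding P by (simp add: distrib_right mult.assoc)
  also have "\<alpha> * (y * x * (z * w)) = y * x * (\<alpha> * (z * w))"
    by (rule central_left_commute[OF c(1), symmetric])
  also have "\<dots> = t * (\<alpha> * (y * x * (w * z))) + \<beta> * (y * x * q)"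
    unfolding Q by (simp only: distrib_left central_left_commute[OF c(1), of "y * x"]
      central_left_commute[OF c(2), of "y * x"] central_left_commute[OF c(4), of "y * x"])
  finally show ?thesis
    by (simp add: distrib_left central_left_commute[OF c(2), of s])
qed

text \<open>Lower-case matrices belong to the variable \<open>u\<close>, upper-case ones to
  \<open>v\<close>. After expansion the relation is applied once in each leg; the two double sums
  share a mixed term, which cancels after renaming the indices of one of them.\<close>

lemma product_rel:
  fixes a b A B :: "idx \<Rightarrow> idx \<Rightarrow> 's::ring_1"
  assumes c: "central \<alpha>" "central \<beta>"
    and HA: "\<And>i j k l. \<alpha> * (a i j * A k l - (-1) ^ cross_deg i j k l * (A k l * a i j))
       = \<beta> * ((-1) ^ triple_deg i j k * (a k j * A i l - A k j * a i l))"
    and HB: "\<And>i j k l. \<alpha> * (b i j * B k l - (-1) ^ cross_deg i j k l * (B k l * b i j))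
       = \<beta> * ((-1) ^ triple_deg i j k * (b k j * B i l - B k j * b i l))"
    and S1: "\<And>i j k l. b k l * A i j = (-1) ^ cross_deg i j k l * (A i j * b k l)"
    and S2: "\<And>i j k l. B k l * a i j = (-1) ^ cross_deg i j k l * (a i j * B k l)"
  defines "d \<equiv> \<lambda>i j. \<Sum>k\<in>UNIV. a i k * b k j" and "D \<equiv> \<lambda>i j. \<Sum>k\<in>UNIV. A i k * B k j"
  shows "\<alpha> * (d i j * D k l - (-1) ^ cross_deg i j k l * (D k l * d i j))
       = \<beta> * ((-1) ^ triple_deg i j k * (d k j * D i l - D k j * d i l))"
proof -
  define \<sigma> :: 's where "\<sigma> = (-1) ^ cross_deg i j k l"
  define s :: 's where "s = (-1) ^ triple_deg i j k"
  define x1 :: "idx \<Rightarrow> idx \<Rightarrow> 's" where "x1 m n = (-1) ^ (cross_deg k n m j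
     + cross_deg i m k n + (triple_deg m j n))" for m n
  define x2 :: "idx \<Rightarrow> idx \<Rightarrow> 's" where "x2 m n = (-1) ^ (cross_deg k n m j
     + (triple_deg i m k))" for m n
  have cs: "central \<sigma>" "central s" by (simp_all add: \<sigma>_def s_def central_sign)
  have main: "\<alpha> * (a i m * b m j * (A k n * B n l) - \<sigma> * (A k n * B n l * (a i m * b m j)))
     = \<beta> * (x2 m n * ((a k m * A i n - A k m * a i n) * (b m j * B n l))
           + x1 m n * (A k n * a i m * (b n j * B m l - B n j * b m l)))" for m n
  proof -
    define s1 :: 's where "s1 = (-1) ^ cross_deg i m k n"
    define s2 :: 's where "s2 = (-1) ^ triple_deg i m k"
    define s3 :: 's where "s3 = (-1) ^ cross_deg m j n l"
    define s4 :: 's where "s4 = (-1) ^ triple_deg m j n"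
    define e1 :: 's where "e1 = (-1) ^ cross_deg k n m j"
    define e2 :: 's where "e2 = (-1) ^ cross_deg i m n l"
    have cc: "central s1" "central s2" "central s3" "central s4" "central e1" "central e2"
      by (simp_all add: s1_def s2_def s3_def s4_def e1_def e2_def central_sign)
    have P: "\<alpha> * (a i m * A k n) = s1 * (\<alpha> * (A k n * a i m)) + \<beta> * (s2 * (a k m * A i n - A k m * a i n))"
      using HA[of i m k n, folded s1_def s2_def]
      by (simp add: right_diff_distrib central_left_commute[OF c(1), of s1] diff_eq_eq add.commute)
    have Q: "\<alpha> * (b m j * B n l) = s3 * (\<alpha> * (B n l * b m j)) + \<beta> * (s4 * (b n j * B m l - B n j * b m l))"
      using HB[of m j n l, folded s3_def s4_def]
      by (simp add: right_diff_distrib central_left_commute[OF c(1), of s3] diff_eq_eq add.commute)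
    note X = exchange_pairs[OF c cc(1,3) P Q]
    have T1: "a i m * b m j * (A k n * B n l) = e1 * (a i m * A k n * (b m j * B n l))"
    proof -
      have "a i m * b m j * (A k n * B n l) = a i m * (b m j * A k n) * B n l" by (simp add: mult.assoc)
      also have "\<dots> = a i m * (e1 * (A k n * b m j)) * B n l" unfolding S1 e1_def ..
      finally show ?thesis by (simp add: mult.assoc central_left_commute[OF cc(5)])
    qed
    have T2: "A k n * B n l * (a i m * b m j) = e2 * (A k n * a i m * (B n l * b m j))"
    proof -
      have "A k n * B n l * (a i m * b m j) = A k n * (B n l * a i m) * b m j" by (simp add: mult.assoc)
      also have "\<dots> = A k n * (e2 * (a i m * B n l)) * b m j" unfolding S2 e2_def ..
      finally show ?thesis by (simp add: mult.assoc central_left_commute[OF cc(6)])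
    qed
    have sg: "e1 * (s1 * (s3 * y)) = \<sigma> * (e2 * y)" for y
      unfolding e1_def s1_def s3_def \<sigma>_def e2_def sign_sign
      by (rule arg_cong[of _ _ "\<lambda>x. x * y"], rule sign_cong, cases i; cases j; cases k; cases l; cases m; cases n; simp)
    have "\<alpha> * (a i m * b m j * (A k n * B n l) - \<sigma> * (A k n * B n l * (a i m * b m j)))
       = e1 * (\<alpha> * (a i m * A k n * (b m j * B n l))) - \<sigma> * (e2 * (\<alpha> * (A k n * a i m * (B n l * b m j))))"
      unfolding T1 T2 by (simp add: right_diff_distrib central_left_commute[OF c(1)])
    also have "\<dots> = e1 * (\<beta> * (s1 * (A k n * a i m * (s4 * (b n j * B m l - B n j * b m l)))
        + s2 * (a k m * A i n - A k m * a i n) * (b m j * B n l)))"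
      unfolding X distrib_left[of e1] sg by simp
    also have "\<dots> = \<beta> * (e1 * (s2 * ((a k m * A i n - A k m * a i n) * (b m j * B n l)))
        + e1 * (s1 * (s4 * (A k n * a i m * (b n j * B m l - B n j * b m l)))))"
      by (simp only: central_left_commute[OF c(2), of e1] central_left_commute[OF cc(4), of "a i m"] central_left_commute[OF cc(4), of "A k n"]
        mult.assoc distrib_left add.commute)
    finally show ?thesis
      by (simp only: e1_def s2_def s1_def s4_def sign_sign x1_def x2_def add.assoc)
  qed
  have L: "d i j * D k l - \<sigma> * (D k l * d i j) = (\<Sum>m\<in>UNIV. \<Sum>n\<in>UNIV.
      (a i m * b m j * (A k n * B n l) - \<sigma> * (A k n * B n l * (a i m * b m j))))"
    by (simp add: d_def D_def sum_idx algebra_simps)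
  \<comment> \<open>With \<open>m\<close> and \<open>n\<close> exchanged the signs of the second sum
    become those of the first, so that the mixed terms
    \<open>A k m * a i n * (b m j * B n l)\<close> cancel.\<close>
  have x12: "x1 n m = x2 m n" for m n
    unfolding x1_def x2_def
    by (rule sign_cong, cases i; cases j; cases k; cases l; cases m; cases n; simp)
  have R: "s * (a k m * b m j * (A i n * B n l) - A k m * B m j * (a i n * b n l))
     = x2 m n * (a k m * A i n * (b m j * B n l) - A k m * a i n * (B m j * b n l))" for m n
  proof -
    define t :: 's where "t = (-1) ^ cross_deg i n m j"
    have ct: "central t" by (simp add: t_def central_sign)
    have "a k m * b m j * (A i n * B n l) = a k m * (b m j * A i n) * B n l" by (simp add: mult.assoc)
    also have "\<dots> = a k m * (t * (A i n * b m j)) * B n l" unfolding S1 t_def ..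
    finally have 1: "a k m * b m j * (A i n * B n l) = t * (a k m * A i n * (b m j * B n l))"
      by (simp add: mult.assoc central_left_commute[OF ct])
    have "A k m * B m j * (a i n * b n l) = A k m * (B m j * a i n) * b n l" by (simp add: mult.assoc)
    also have "\<dots> = A k m * (t * (a i n * B m j)) * b n l" unfolding S2 t_def ..
    finally have 2: "A k m * B m j * (a i n * b n l) = t * (A k m * a i n * (B m j * b n l))"
      by (simp add: mult.assoc central_left_commute[OF ct])
    have 3: "s * (t * y) = x2 m n * y" for y
      unfolding s_def t_def x2_def sign_sign
      by (rule arg_cong[of _ _ "\<lambda>x. x * y"], rule sign_cong, cases i; cases j; cases k; cases l; cases m; cases n; simp)
    show ?thesis unfolding 1 2 by (simp only: right_diff_distrib 3)
  qed
  have R': "s * (d k j * D i l - D k j * d i l) = (\<Sum>m\<in>UNIV. \<Sum>n\<in>UNIV.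
      x2 m n * (a k m * A i n * (b m j * B n l) - A k m * a i n * (B m j * b n l)))"
    unfolding R[symmetric] by (simp add: d_def D_def sum_idx algebra_simps)
  have "\<alpha> * (d i j * D k l - \<sigma> * (D k l * d i j)) = \<beta> * (\<Sum>m\<in>UNIV. \<Sum>n\<in>UNIV.
       x2 m n * ((a k m * A i n - A k m * a i n) * (b m j * B n l))
           + x1 m n * (A k n * a i m * (b n j * B m l - B n j * b m l)))"
    unfolding L by (simp only: sum_distrib_left main)
  also have "(\<Sum>m\<in>UNIV. \<Sum>n\<in>UNIV. x2 m n * ((a k m * A i n - A k m * a i n) * (b m j * B n l))
           + x1 m n * (A k n * a i m * (b n j * B m l - B n j * b m l)))
     = (\<Sum>m\<in>UNIV. \<Sum>n\<in>UNIV. x2 m n * ((a k m * A i n - A k m * a i n) * (b m j * B n l)))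
       + (\<Sum>m\<in>UNIV. \<Sum>n\<in>UNIV. x1 n m * (A k m * a i n * (b m j * B n l - B m j * b n l)))"
    unfolding sum.distrib by (rule arg_cong2[where f = plus, OF refl sum.swap])
  also have "\<dots> = s * (d k j * D i l - D k j * d i l)"
    unfolding R' x12 sum.distrib[symmetric] by (simp add: algebra_simps)
  finally show ?thesis unfolding \<sigma>_def s_def .
qed

lemma emb_sum_idx: "emb_u (\<Sum>k\<in>(UNIV::idx set). f k) = (\<Sum>k\<in>UNIV. emb_u (f k))"
  "emb_v (\<Sum>k\<in>(UNIV::idx set). f k) = (\<Sum>k\<in>UNIV. emb_v (f k))"
  by (simp_all add: sum_idx emb_add)

lemma yang_rel_mprod:
  assumes "unital A" "unital B" "yang_rel 0 A" "yang_rel 0 B" and sc: "scommute A B"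
  shows "yang_rel 0 (mprod A B)"
proof -
  note HA = iffD1[OF yang_rel_gen[OF assms(1)] assms(3), rule_format, unfolded gen_scomm_def add_0]
  note HB = iffD1[OF yang_rel_gen[OF assms(2)] assms(4), rule_format, unfolded gen_scomm_def add_0]
  have S: "emb_u (B k l) * emb_v (A i j) = (-1) ^ cross_deg i j k l * (emb_v (A i j) * emb_u (B k l))"
    "emb_v (B k l) * emb_u (A i j) = (-1) ^ cross_deg i j k l * (emb_u (A i j) * emb_v (B k l))"
    for i j k l
    by (rule fps_ext, rule fps_ext, simp only: sign_mult_nth emb_uv_nth sc[unfolded scommute_def, rule_format])+
  show ?thesis
    unfolding yang_rel_gen[OF unital_mprod[OF assms(1,2)]] gen_scomm_def mprod_def emb_sum_idx emb_mult add_0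
    by (intro allI product_rel[OF central_cf HA HB S])
qed

text \<open>The case \<open>G = 0\<close> of \<open>inverse_intertwine\<close>, with the signs
  absorbed into a twist.\<close>

lemma supercommute_inverse:
  fixes A A' :: "idx \<Rightarrow> idx \<Rightarrow> 's::ring_1"
  assumes "mat_inverses A A'" and "\<And>i j. x * A i j = (-1) ^ (q * (pidx i + pidx j)) * (A i j * x)"
  shows "x * A' i j = (-1) ^ (q * (pidx i + pidx j)) * (A' i j * x)"
proof -
  have "1 * (twist q A' i j * x - x * A' i j) = (\<Sum>k\<in>UNIV. \<Sum>l\<in>UNIV. twist q A' i k * 0 * A' l j)"
    by (rule inverse_intertwine[OF mat_inverses_twist[OF assms(1)] assms(1) central_one])
      (simp add: assms(2) twist_def mult.assoc)
  then show ?thesis by (simp add: twist_def mult.assoc)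
qed

lemma sign_mult_nth1: "((-1) ^ n * A) $ r = (-1) ^ n * (A $ r)" for A :: "'r::ring_1 fps"
  by (simp add: minus_one_power_iff)

lemma const_comm_iff: "fps_const x * A = (-1) ^ n * (A * fps_const x) \<longleftrightarrow> (\<forall>r. x * A $ r = (-1) ^ n * (A $ r * x))"
  for A :: "'r::ring_1 fps"
  by (simp add: fps_eq_iff sign_mult_nth1)

lemma supercommute_minv:
  fixes T :: "idx \<Rightarrow> idx \<Rightarrow> 'r::ring_1 fps"
  assumes "unital T" and "\<And>i j r. x * T i j $ r = (-1) ^ (q * (pidx i + pidx j)) * (T i j $ r * x)"
  shows "x * minv T i j $ r = (-1) ^ (q * (pidx i + pidx j)) * (minv T i j $ r * x)"
proof -
  have "fps_const x * T i j = (-1) ^ (q * (pidx i + pidx j)) * (T i j * fps_const x)" for i j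
    unfolding const_comm_iff by (intro allI assms(2))
  from supercommute_inverse[OF mat_inverses_minv[OF assms(1)] this]
  show ?thesis unfolding const_comm_iff by (rule spec)
qed

lemma scommute_minv_right:
  assumes "unital B" "scommute A B"
  shows "scommute A (minv B)"
proof -
  have "scommute B A" using assms(2) by (rule scommute_sym)
  then have "A i j $ r * minv B k l $ s = (-1) ^ cross_deg i j k l * (minv B k l $ s * A i j $ r)"
    for i j k l r s
    by (intro supercommute_minv assms(1))
      (simp only: \<open>scommute B A\<close>[unfolded scommute_def, rule_format] mult.commute[of "pidx i + pidx j"])
  then have "scommute (minv B) A"
    unfolding scommute_def by (intro allI) (simp only: mult.commute[of "pidx _ + pidx _" "pidx _ + pidx _"])
  then show ?thesis by (rule scommute_sym)
qed

lemma scommute_dual: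
  assumes "unital A" "unital B" "scommute A B"
  shows "scommute (dual B) (dual A)"
proof -
  have "scommute (minv B) (minv A)"
    by (rule scommute_minv_right[OF assms(1) scommute_sym[OF scommute_minv_right[OF assms(2,3)]]])
  then have H: "minv A k l $ s * minv B i j $ r
     = (-1) ^ cross_deg i j k l * (minv B i j $ r * minv A k l $ s)" for i j k l r s
    by (simp add: scommute_def)
  have e: "(-1) ^ ((pidx (swap_idx i) + pidx (swap_idx j)) * (pidx (swap_idx k) + pidx (swap_idx l)))
     = ((-1) ^ cross_deg i j k l :: 'a)" for i j k l
    by (rule sign_cong, cases i; cases j; cases k; cases l; simp)
  show ?thesis
    unfolding scommute_def dual_def by (intro allI) (simp only: H e)
qed

section \<open>Integer shifts of the defining relations\<close>

definition sh :: "(idx \<Rightarrow> idx \<Rightarrow> 'r::ring_1 fps) \<Rightarrow> nat \<Rightarrow> idx \<Rightarrow> idx \<Rightarrow> 'r fps" where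
  "sh T a i j = shift a (T i j)"

lemma fps_X_mult_cancel: "fps_X * A = fps_X * B \<Longrightarrow> A = (B :: 'r::ring_1 fps)"
proof (rule fps_ext)
  fix n
  assume "fps_X * A = fps_X * B"
  then have "(fps_X * A) $ Suc n = (fps_X * B) $ Suc n" by simp
  then show "A $ n = B $ n" by simp
qed

lemma ev_shift_mult_const:
  "ev (shift_pt a) (\<lambda>r. fps_const (A $ r * x)) = shift a A * fps_const x"
  using ev_mult_right[OF shift_pt_0 central_shift_pt, of a "\<lambda>r. fps_const (A $ r)" "fps_const x"]
  by (simp add: ev_shift)

lemma ev_shift_const_mult:
  "ev (shift_pt a) (\<lambda>r. fps_const (x * A $ r)) = fps_const x * shift a A"
  using ev_mult_left[OF shift_pt_0 central_shift_pt, of a "fps_const x" "\<lambda>r. fps_const (A $ r)"]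
  by (simp add: ev_shift)

lemma shift_pt_cancel: "B = shift_pt a * C \<Longrightarrow> (1 - of_nat a * fps_X) * B = fps_X * (C :: 'r::ring_1 fps)"
  by (simp add: shift_pt_eq flip: mult.assoc)

text \<open>One variable is already specialised to \<open>u - a\<close>; the other still enters
  through its coefficient of degree \<open>s\<close>.\<close>

definition half_scomm :: "(idx \<Rightarrow> idx \<Rightarrow> 'r::ring_1 fps) \<Rightarrow> nat \<Rightarrow> idx \<Rightarrow> idx \<Rightarrow> idx \<Rightarrow> idx \<Rightarrow> nat \<Rightarrow> 'r fps" where
  "half_scomm T a i j k l s = sh T a i j * fps_const (T k l $ s)
     - (-1) ^ cross_deg i j k l * (fps_const (T k l $ s) * sh T a i j)"

lemma fps_const_sign: "fps_const ((-1) ^ n) = ((-1) ^ n :: 'r::ring_1 fps)"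
  by (simp add: minus_one_power_iff flip: fps_const_neg)

lemma sub_sign_mult: "fps_const (x - (-1) ^ n * y) = fps_const x - (-1) ^ n * fps_const (y :: 'r::ring_1)"
  by (simp add: minus_one_power_iff)

text \<open>The coefficient relation summed over \<open>r\<close> against powers of
  \<open>1/(u - a)\<close>. Splitting off \<open>r = 0\<close> costs nothing because the constant
  terms of \<open>T\<close> are scalar.\<close>

lemma half_rel:
  assumes T: "unital T" and rel: "yang_rel 0 T"
  shows "half_scomm T a i j k l s = shift_pt a * (half_scomm T a i j k l (Suc s)
     + (-1) ^ triple_deg i j k
       * (sh T a k j * fps_const (T i l $ s) - fps_const (T k j $ s) * sh T a i l))"
proof -
  let ?e = "pidx i * pidx j + pidx i * pidx k + pidx j * pidx k"
  let ?z = "shift_pt a :: 'a fps"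
  note cz = shift_pt_0[of a] central_shift_pt[of a]
  have G: "half_scomm T a i j k l s = ev ?z (\<lambda>r. fps_const (scomm T i j k l r s))" for s
    unfolding half_scomm_def scomm_def sub_sign_mult ev_diff ev_mult_left[OF cz] sh_def
    by (simp only: ev_shift_mult_const ev_shift_const_mult)
  have F: "(-1) ^ ?e * (sh T a k j * fps_const (T i l $ s) - fps_const (T k j $ s) * sh T a i l)
     = ev ?z (\<lambda>r. fps_const ((-1) ^ ?e * (T k j $ r * T i l $ s - T k j $ s * T i l $ r)))"
    unfolding fps_const_mult[symmetric] fps_const_sign ev_mult_left[OF cz] sh_def
    by (simp only: fps_const_mult fps_const_sub[symmetric] ev_diff ev_shift_mult_const ev_shift_const_mult)
  have "half_scomm T a i j k l s = ?z * ev ?z (\<lambda>r. fps_const (scomm T i j k l (Suc r) s))"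
    unfolding G by (subst ev_rec[OF cz]) (simp add: scomm_0_left[OF T])
  also have "(\<lambda>r. fps_const (scomm T i j k l (Suc r) s))
     = (\<lambda>r. fps_const (scomm T i j k l r (Suc s))
         - - fps_const ((-1) ^ ?e * (T k j $ r * T i l $ s - T k j $ s * T i l $ r)))"
    using yang_relD[OF rel, of i j k l _ s] by (simp add: fun_eq_iff diff_eq_eq add.commute)
  also have "ev ?z \<dots> = half_scomm T a i j k l (Suc s)
      - ev ?z (\<lambda>r. (-1) * fps_const ((-1) ^ ?e * (T k j $ r * T i l $ s - T k j $ s * T i l $ r)))"
    unfolding ev_diff G by simp
  finally show ?thesis unfolding ev_mult_left[OF cz] F by simp
qed

lemma half_rel_cleared:
  assumes "unital T" and "yang_rel 0 T"
  shows "(1 - of_nat a * fps_X) * half_scomm T a i j k l s = fps_X * (half_scomm T a i j k l (Suc s)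
     + (-1) ^ triple_deg i j k
       * (sh T a k j * fps_const (T i l $ s) - fps_const (T k j $ s) * sh T a i l))"
  by (rule shift_pt_cancel[OF half_rel[OF assms]])

text \<open>At \<open>u - a\<close> and \<open>u - b\<close> the difference of the variables becomes
  \<open>b - a\<close>. Evaluating the second variable as well gives two equations with cleared
  denominators, whose difference is \<open>X\<close> times the claim.\<close>

lemma shift_rel:
  assumes T: "unital T" and rel: "yang_rel 0 T"
  shows "of_nat b * (sh T a i j * sh T b k l
       - (-1) ^ cross_deg i j k l * (sh T b k l * sh T a i j))
    = of_nat a * (sh T a i j * sh T b k l
       - (-1) ^ cross_deg i j k l * (sh T b k l * sh T a i j))
      + (-1) ^ triple_deg i j k
       * (sh T a k j * sh T b i l - sh T b k j * sh T a i l)"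
    (is "of_nat b * ?C = of_nat a * ?C + ?F")
proof -
  let ?y = "shift_pt a :: 'a fps" and ?z = "shift_pt b :: 'a fps"
  note cz = shift_pt_0[of b] central_shift_pt[of b]
  let ?G = "half_scomm T a i j k l"
  have G: "ev ?z ?G = ?C"
    unfolding half_scomm_def ev_diff ev_mult_left[OF cz] ev_mult_right[OF cz] sh_def ev_shift ..
  have F: "ev ?z (\<lambda>s. (-1) ^ triple_deg i j k
       * (sh T a k j * fps_const (T i l $ s) - fps_const (T k j $ s) * sh T a i l)) = ?F"
    unfolding ev_diff ev_mult_left[OF cz] ev_mult_right[OF cz] sh_def ev_shift ..
  define E where "E = ev ?z (\<lambda>s. ?G (Suc s))"
  have "?G 0 = 0"
    using T by (cases k; cases l; simp add: half_scomm_def unital_def)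
  then have CE: "?C = ?z * E"
    unfolding G[symmetric] E_def by (subst ev_rec[OF cz]) simp
  have "?C = ev ?z (\<lambda>s. ?y * (?G (Suc s) + (-1) ^ triple_deg i j k
       * (sh T a k j * fps_const (T i l $ s) - fps_const (T k j $ s) * sh T a i l)))"
    unfolding G[symmetric] by (rule arg_cong[of _ _ "ev ?z"], rule ext, rule half_rel[OF T rel])
  also have "\<dots> = ?y * (E + ?F)"
    unfolding ev_mult_left[OF cz] E_def F[symmetric]
    using ev_diff[of ?z "\<lambda>s. ?G (Suc s)" "\<lambda>s. (-1) * ((-1) ^ triple_deg i j k
       * (sh T a k j * fps_const (T i l $ s) - fps_const (T k j $ s) * sh T a i l))"]
    unfolding ev_mult_left[OF cz] by simp
  finally have "(1 - of_nat a * fps_X) * ?C = fps_X * (E + ?F)" by (rule shift_pt_cancel)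
  moreover have "(1 - of_nat b * fps_X) * ?C = fps_X * E" using CE by (rule shift_pt_cancel)
  moreover have "fps_X * (of_nat b * C) = fps_X * (of_nat a * C + F)"
    if "(1 - of_nat a * fps_X) * C = fps_X * (E + F)" "(1 - of_nat b * fps_X) * C = fps_X * E"
    for C F :: "'a fps"
    using that
    by (simp add: left_diff_distrib distrib_left mult.assoc of_nat_left_commute[of _ fps_X, symmetric])
       (simp add: algebra_simps, metis add.assoc add_left_cancel)
  ultimately have "fps_X * (of_nat b * ?C) = fps_X * (of_nat a * ?C + ?F)" by blast
  then show ?thesis by (rule fps_X_mult_cancel)
qed

lemma shift_scommute:
  fixes A B :: "'r::ring_1 fps"
  assumes "\<And>r s. B $ s * A $ r = (-1) ^ n * (A $ r * B $ s)"
  shows "shift b B * shift a A = (-1) ^ n * (shift a A * shift b B)"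
proof -
  have sg: "shift c ((-1) ^ n) = ((-1) ^ n :: 'r fps)" for c
    by (metis fps_const_sign shift_const)
  have "fps_const x * shift a A = (-1) ^ n * (shift a A * fps_const x)"
    if "\<And>r. x * A $ r = (-1) ^ n * (A $ r * x)" for x
  proof -
    have "fps_const x * A = (-1) ^ n * (A * fps_const x)" unfolding const_comm_iff using that by blast
    then have "shift a (fps_const x * A) = shift a ((-1) ^ n * (A * fps_const x))" by simp
    then show ?thesis by (simp add: shift_mult sg)
  qed
  then have "fps_const (B $ s) * shift a A = (-1) ^ n * (shift a A * fps_const (B $ s))" for s
    using assms by blast
  then have *: "ev (shift_pt b) (\<lambda>s. fps_const (B $ s) * shift a A)
      = ev (shift_pt b) (\<lambda>s. (-1) ^ n * (shift a A * fps_const (B $ s)))" by simp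
  note cz = shift_pt_0[of b] central_shift_pt[of b]
  show ?thesis
    using * unfolding ev_mult_left[OF cz] ev_mult_right[OF cz] ev_shift .
qed

section \<open>Products of shifted \<open>t_{1,1}\<close> and integer exchange relations\<close>

fun bprod :: "(idx \<Rightarrow> idx \<Rightarrow> 'r::ring_1 fps) \<Rightarrow> nat \<Rightarrow> 'r fps" where
  "bprod T 0 = 1"
| "bprod T (Suc n) = sh T n I1 I1 * bprod T n"

text \<open>The factors at shifts 1 to \<open>n\<close>: in the error terms for
  \<open>bprod T (Suc n)\<close> an off-diagonal entry takes the place of the factor at shift
  0.\<close>

fun bprod_tail :: "(idx \<Rightarrow> idx \<Rightarrow> 'r::ring_1 fps) \<Rightarrow> nat \<Rightarrow> 'r fps" where
  "bprod_tail T 0 = 1"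
| "bprod_tail T (Suc n) = sh T (Suc n) I1 I1 * bprod_tail T n"

text \<open>For these indices the right-hand side of the relation is itself a commutator of lower
  degree, so induction on \<open>r\<close> starts from the scalar constant term.\<close>

lemma t11_coeff_comm:
  assumes "unital T" "yang_rel 0 T"
  shows "T I1 I1 $ r * T I1 I1 $ s = T I1 I1 $ s * T I1 I1 $ r"
proof -
  have "scomm T I1 I1 I1 I1 r s = 0"
  proof (induction r arbitrary: s)
    case (Suc r)
    then show ?case using yang_relD[OF assms(2), of I1 I1 I1 I1 r s] Suc[of s] Suc[of "Suc s"]
      by (simp add: scomm_def)
  qed (simp add: scomm_0_left[OF assms(1)])
  then show ?thesis by (simp add: scomm_def)
qed

lemma sh_comm:
  assumes "unital T" "yang_rel 0 T"
  shows "sh T a I1 I1 * sh T b I1 I1 = sh T b I1 I1 * sh T a I1 I1"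
  using shift_scommute[of "T I1 I1" "T I1 I1" 0 a b] t11_coeff_comm[OF assms] by (simp add: sh_def)

lemma mult_comm_induct: "x * y = y * x \<Longrightarrow> x * z = z * x \<Longrightarrow> x * (y * z) = y * z * (x :: 'r::ring_1)"
  by (metis mult.assoc)

lemma bprod_commI: "(\<And>a. x * sh T a I1 I1 = sh T a I1 I1 * x) \<Longrightarrow> x * bprod T n = bprod T n * x"
  by (induction n) (simp_all add: mult_comm_induct del: mult.assoc)

lemma bprod_tail_commI: "(\<And>a. x * sh T a I1 I1 = sh T a I1 I1 * x) \<Longrightarrow> x * bprod_tail T n = bprod_tail T n * x"
  by (induction n) (simp_all add: mult_comm_induct del: mult.assoc)

lemma bprod_Suc_tail:
  assumes "unital T" "yang_rel 0 T"
  shows "bprod T (Suc n) = sh T 0 I1 I1 * bprod_tail T n"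
proof (induction n)
  case (Suc n)
  have "bprod T (Suc (Suc n)) = sh T (Suc n) I1 I1 * (sh T 0 I1 I1 * bprod_tail T n)"
    using Suc by simp
  then show ?case by (simp add: sh_comm[OF assms, of "Suc n" 0] flip: mult.assoc)
qed simp

text \<open>The shifts differ by one, so the commutator has coefficient 1 and its first product
  cancels against the same product on the right-hand side.\<close>

lemma rel_11_12_near:
  assumes "unital T" "yang_rel 0 T"
  shows "sh T (Suc a) I1 I1 * sh T a I1 I2 = sh T (Suc a) I1 I2 * sh T a I1 I1"
  using shift_rel[OF assms, of "Suc a" a I1 I1 I1 I2] by (simp add: algebra_simps)

lemma rel_11_12_far:
  assumes "unital T" "yang_rel 0 T"
  shows "sh T a I1 I1 * sh T (a + n) I1 I2 + of_nat n * (sh T a I1 I2 * sh T (a + n) I1 I1)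
     = of_nat (Suc n) * (sh T (a + n) I1 I1 * sh T a I1 I2)"
  using shift_rel[OF assms, of a "a + n" I1 I1 I1 I2] by (simp add: algebra_simps)

lemma rel_11_21_far:
  assumes "unital T" "yang_rel 0 T"
  shows "sh T (a + n) I2 I1 * sh T a I1 I1 + of_nat n * (sh T (a + n) I1 I1 * sh T a I2 I1)
     = of_nat (Suc n) * (sh T a I2 I1 * sh T (a + n) I1 I1)"
  using shift_rel[OF assms, of a "a + n" I1 I1 I2 I1] by (simp add: algebra_simps)

text \<open>Two odd entries give an anticommutator; with coefficient 1 the relation leaves twice the
  product.\<close>

lemma rel_12_12_near:
  assumes "unital T" "yang_rel 0 T" and two: "\<And>x :: 'r::ring_1. 2 * x = 0 \<Longrightarrow> x = 0"
  shows "sh T (Suc a) I1 I2 * sh T a I1 I2 = (0 :: 'r fps)"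
proof -
  have "2 * (sh T (Suc a) I1 I2 * sh T a I1 I2) = (0 :: 'r fps)"
    using shift_rel[OF assms(1,2), of "Suc a" a I1 I2 I1 I2] by (simp add: algebra_simps mult_2)
  then have "2 * (sh T (Suc a) I1 I2 * sh T a I1 I2) $ n = (0 :: 'r)" for n
    by (metis fps_mult_of_nat_nth(1) fps_zero_nth of_nat_numeral)
  then show ?thesis by (intro fps_ext) (simp add: two)
qed

section \<open>Centrality and group-likeness of the product series\<close>

lemma half_rel_11_12:
  assumes "unital T" "yang_rel 0 T"
  shows "(1 - of_nat a * fps_X) * (sh T a I1 I1 * fps_const (T I1 I2 $ s) - fps_const (T I1 I2 $ s) * sh T a I1 I1)
    = fps_X * (sh T a I1 I1 * fps_const (T I1 I2 $ Suc s) - fps_const (T I1 I2 $ Suc s) * sh T a I1 I1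
      + (sh T a I1 I1 * fps_const (T I1 I2 $ s) - fps_const (T I1 I1 $ s) * sh T a I1 I2))"
  using half_rel_cleared[OF assms, of a I1 I1 I1 I2 s] by (simp add: half_scomm_def)

lemma half_rel_11_21:
  assumes "unital T" "yang_rel 0 T"
  shows "(1 - of_nat a * fps_X) * (sh T a I1 I1 * fps_const (T I2 I1 $ s) - fps_const (T I2 I1 $ s) * sh T a I1 I1)
    = fps_X * (sh T a I1 I1 * fps_const (T I2 I1 $ Suc s) - fps_const (T I2 I1 $ Suc s) * sh T a I1 I1
      + (sh T a I2 I1 * fps_const (T I1 I1 $ s) - fps_const (T I2 I1 $ s) * sh T a I1 I1))"
  using half_rel_cleared[OF assms, of a I1 I1 I2 I1 s] by (simp add: half_scomm_def)

lemma const_t11_comm: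
  assumes "unital T" "yang_rel 0 T"
  shows "fps_const (T I1 I1 $ s) * sh T a I1 I1 = sh T a I1 I1 * fps_const (T I1 I1 $ s)"
  using shift_scommute[of "fps_const (T I1 I1 $ s)" "T I1 I1" 0 0 a] t11_coeff_comm[OF assms]
  by (simp add: sh_def)

text \<open>For \<open>N\<close> factors with product \<open>P(u)\<close>, and \<open>W(u)\<close>
  the part without shift 0, this reads \<open>(u - v) t_{1,2}(v) P(u) = (u - v - N) P(u) t_{1,2}(v)
  + N t_{1,1}(v) W(u) t_{1,2}(u)\<close>, divided by \<open>u\<close>. Multiplication by
  \<open>v\<close> appears as the step from \<open>s\<close> to \<open>Suc s\<close>.\<close>

lemma bprod_t12:
  assumes "unital T" "yang_rel 0 T"
  defines "N \<equiv> \<lambda>s. fps_const (T I1 I2 $ s)"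
  shows "N s * bprod T (Suc n) - fps_X * (N (Suc s) * bprod T (Suc n))
    = bprod T (Suc n) * N s - of_nat (Suc n) * fps_X * (bprod T (Suc n) * N s)
      - fps_X * (bprod T (Suc n) * N (Suc s))
      + of_nat (Suc n) * fps_X * (fps_const (T I1 I1 $ s) * (bprod_tail T n * sh T 0 I1 I2))"
proof (induction n)
  case 0
  show ?case using half_rel_11_12[OF assms(1,2), of 0 s] by (simp add: N_def algebra_simps)
next
  case (Suc n)
  define P where "P = bprod T (Suc n)"
  define W where "W = bprod_tail T n"
  define d where "d = sh T (Suc n) I1 I1"
  define K where "K = fps_const (T I1 I1 $ s)"
  define z where "z = (of_nat (Suc n) * fps_X :: 'a fps)"
  define X where "X = (fps_X :: 'a fps)"
  let ?h = "sh T 0 I1 I2" and ?k = "sh T (Suc n) I1 I2" and ?g = "sh T 0 I1 I1"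
  note c = sh_comm[OF assms(1,2)]
  have cen: "central z" "central X"
    unfolding z_def X_def by (intro central_mult central_of_nat central_fps_X)+
  have Pd: "d * P = P * d" unfolding P_def d_def by (rule bprod_commI) (rule c)
  have Wd: "d * W = W * d" unfolding W_def d_def by (rule bprod_tail_commI) (rule c)
  \<comment> \<open>The factor at shift 0 is moved to the end, where it will stand next to the
    off-diagonal entry \<open>?k\<close>.\<close>
  have PW: "P = W * ?g"
    unfolding P_def W_def bprod_Suc_tail[OF assms(1,2)] by (rule bprod_tail_commI) (rule c)
  have KP: "K * P = P * K" unfolding K_def P_def by (rule bprod_commI) (rule const_t11_comm[OF assms(1,2)])
  have IH: "N s * P - X * (N (Suc s) * P) = P * N s - z * (P * N s) - X * (P * N (Suc s)) + z * (K * (W * ?h))"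
    using Suc unfolding P_def W_def K_def z_def X_def .
  have M: "(1 - z) * (d * N s - N s * d) = X * (d * N (Suc s) - N (Suc s) * d + (d * N s - K * ?k))"
    using half_rel_11_12[OF assms(1,2), of "Suc n" s] unfolding N_def K_def z_def X_def d_def .
  \<comment> \<open>Merges the old error term and the one caused by the new factor into
    \<open>Suc (Suc n)\<close> copies of a single term.\<close>
  have far: "?g * ?k + of_nat (Suc n) * (?h * d) = of_nat (Suc (Suc n)) * (d * ?h)"
    using rel_11_12_far[OF assms(1,2), of 0 "Suc n"] by (simp add: d_def)
  have "N s * (d * P) - X * (N (Suc s) * (d * P)) = (N s * P - X * (N (Suc s) * P)) * d"
    unfolding Pd by (simp add: left_diff_distrib mult.assoc)
  also have "\<dots> = P * (N s * d - z * (N s * d) - X * (N (Suc s) * d)) + z * (K * (W * (?h * d)))"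
    unfolding IH
    by (simp add: left_diff_distrib right_diff_distrib distrib_right mult.assoc
        central_left_commute[OF cen(1), of P] central_left_commute[OF cen(2), of P])
  also have "N s * d - z * (N s * d) - X * (N (Suc s) * d)
     = d * N s - (z + X) * (d * N s) - X * (d * N (Suc s)) + X * (K * ?k)"
    using M by (simp add: algebra_simps)
  also have "P * (d * N s - (z + X) * (d * N s) - X * (d * N (Suc s)) + X * (K * ?k))
     = d * P * N s - (z + X) * (d * P * N s) - X * (d * P * N (Suc s)) + X * (P * K * ?k)"
    unfolding Pd
    by (simp add: left_diff_distrib right_diff_distrib distrib_right distrib_left mult.assoc
        central_left_commute[OF cen(1), of P] central_left_commute[OF cen(2), of P])
  also have "X * (P * K * ?k) = X * (K * (W * (?g * ?k)))"
    by (simp only: KP[symmetric]) (simp only: PW mult.assoc)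
  finally have 1: "N s * (d * P) - X * (N (Suc s) * (d * P))
    = d * P * N s - (z + X) * (d * P * N s) - X * (d * P * N (Suc s))
      + (X * (K * (W * (?g * ?k))) + z * (K * (W * (?h * d))))" by (simp add: add.assoc)
  have "X * (K * (W * (?g * ?k))) + z * (K * (W * (?h * d)))
      = X * (K * (W * (?g * ?k + of_nat (Suc n) * (?h * d))))"
    unfolding z_def X_def[symmetric]
    by (simp only: distrib_left of_nat_left_commute[symmetric] mult.assoc)
  also have "\<dots> = (z + X) * (K * (d * W * ?h))"
    unfolding far Wd z_def X_def[symmetric]
    by (simp only: of_nat_left_commute[symmetric] mult.assoc) (simp add: algebra_simps)
  finally have 2: "X * (K * (W * (?g * ?k))) + z * (K * (W * (?h * d))) = (z + X) * (K * (d * W * ?h))" .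
  have zX: "z + X = of_nat (Suc (Suc n)) * fps_X" by (simp add: z_def X_def algebra_simps)
  show ?case
    using 1 unfolding 2 unfolding zX unfolding P_def d_def W_def K_def X_def
    by (simp only: bprod.simps(2)[of T "Suc n"] bprod_tail.simps(2)[of T n])
qed

text \<open>Mirror image of \<open>bprod_t12\<close>: \<open>t_{2,1}(v)\<close> moves from right to
  left, and the error term has its off-diagonal entry in front.\<close>

lemma bprod_t21:
  assumes "unital T" "yang_rel 0 T"
  defines "M \<equiv> \<lambda>s. fps_const (T I2 I1 $ s)"
  shows "bprod T (Suc n) * M s - fps_X * (bprod T (Suc n) * M (Suc s))
    = M s * bprod T (Suc n) - of_nat (Suc n) * fps_X * (M s * bprod T (Suc n))
      - fps_X * (M (Suc s) * bprod T (Suc n))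
      + of_nat (Suc n) * fps_X * (sh T 0 I2 I1 * bprod_tail T n * fps_const (T I1 I1 $ s))"
proof (induction n)
  case 0
  show ?case using half_rel_11_21[OF assms(1,2), of 0 s] by (simp add: M_def algebra_simps)
next
  case (Suc n)
  define P where "P = bprod T (Suc n)"
  define W where "W = bprod_tail T n"
  define d where "d = sh T (Suc n) I1 I1"
  define K where "K = fps_const (T I1 I1 $ s)"
  define z where "z = (of_nat (Suc n) * fps_X :: 'a fps)"
  define X where "X = (fps_X :: 'a fps)"
  let ?h = "sh T 0 I2 I1" and ?k = "sh T (Suc n) I2 I1" and ?g = "sh T 0 I1 I1"
  note c = sh_comm[OF assms(1,2)]
  have cen: "central z" "central X"
    unfolding z_def X_def by (intro central_mult central_of_nat central_fps_X)+
  have PW: "P = ?g * W" unfolding P_def W_def by (rule bprod_Suc_tail[OF assms(1,2)])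
  have KP: "K * P = P * K" unfolding K_def P_def by (rule bprod_commI) (rule const_t11_comm[OF assms(1,2)])
  have IH: "P * M s - X * (P * M (Suc s)) = M s * P - z * (M s * P) - X * (M (Suc s) * P) + z * (?h * W * K)"
    using Suc unfolding P_def W_def K_def z_def X_def .
  have R: "(1 - z) * (d * M s - M s * d) = X * (d * M (Suc s) - M (Suc s) * d + (?k * K - M s * d))"
    using half_rel_11_21[OF assms(1,2), of "Suc n" s] unfolding M_def K_def z_def X_def d_def .
  have far: "?k * ?g + of_nat (Suc n) * (d * ?h) = of_nat (Suc (Suc n)) * (?h * d)"
    using rel_11_21_far[OF assms(1,2), of 0 "Suc n"] by (simp add: d_def)
  have "d * P * M s - X * (d * P * M (Suc s)) = d * (P * M s - X * (P * M (Suc s)))"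
    by (simp add: right_diff_distrib mult.assoc central_left_commute[OF cen(2), of d])
  also have "\<dots> = (d * M s - z * (d * M s) - X * (d * M (Suc s))) * P + z * (d * ?h * W * K)"
    unfolding IH
    by (simp add: left_diff_distrib right_diff_distrib distrib_left mult.assoc
        central_left_commute[OF cen(1), of d] central_left_commute[OF cen(2), of d])
  also have "d * M s - z * (d * M s) - X * (d * M (Suc s))
     = M s * d - (z + X) * (M s * d) - X * (M (Suc s) * d) + X * (?k * K)"
    using R by (simp add: algebra_simps)
  also have "(M s * d - (z + X) * (M s * d) - X * (M (Suc s) * d) + X * (?k * K)) * P
     = M s * (d * P) - (z + X) * (M s * (d * P)) - X * (M (Suc s) * (d * P)) + X * (?k * (K * P))"
    by (simp add: left_diff_distrib distrib_right mult.assoc)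
  also have "X * (?k * (K * P)) = X * (?k * ?g * W * K)"
    by (simp only: KP) (simp only: PW mult.assoc)
  finally have 1: "d * P * M s - X * (d * P * M (Suc s))
    = M s * (d * P) - (z + X) * (M s * (d * P)) - X * (M (Suc s) * (d * P))
      + (X * (?k * ?g * W * K) + z * (d * ?h * W * K))" by (simp add: add.assoc)
  have "X * (?k * ?g * W * K) + z * (d * ?h * W * K) = X * ((?k * ?g + of_nat (Suc n) * (d * ?h)) * W * K)"
    unfolding z_def X_def[symmetric]
    by (simp only: distrib_left distrib_right of_nat_left_commute[symmetric] mult.assoc)
  also have "\<dots> = (z + X) * (?h * (d * W) * K)"
    unfolding far z_def X_def[symmetric]
    by (simp only: of_nat_left_commute[symmetric] mult.assoc) (simp add: algebra_simps)
  finally have 2: "X * (?k * ?g * W * K) + z * (d * ?h * W * K) = (z + X) * (?h * (d * W) * K)" .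
  have zX: "z + X = of_nat (Suc (Suc n)) * fps_X" by (simp add: z_def X_def algebra_simps)
  show ?case
    using 1 unfolding 2 unfolding zX unfolding P_def d_def W_def K_def X_def
    by (simp only: bprod.simps(2)[of T "Suc n"] bprod_tail.simps(2)[of T n])
qed

lemma coeff_commI: "fps_const x * P = P * fps_const x \<Longrightarrow> x * P $ n = P $ n * (x :: 'r::ring_1)"
  by (metis fps_mult_left_const_nth fps_mult_right_const_nth)

text \<open>Since \<open>X\<close> can be cancelled, the vanishing climbs from degree 0. For
  commutators with an off-diagonal entry the start is its zero constant term.\<close>

lemma X_chain_zero:
  fixes C :: "nat \<Rightarrow> 'r::ring_1 fps"
  assumes "C 0 = 0" "\<And>s. C s = fps_X * C (Suc s)"
  shows "C s = 0"
proof (induction s)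
  case (Suc s)
  then have "fps_X * C (Suc s) = fps_X * 0" using assms(2)[of s] by simp
  then show ?case by (rule fps_X_mult_cancel)
qed (rule assms(1))

text \<open>With \<open>p\<close> factors the terms carrying the coefficient \<open>p\<close> vanish
  and the exchange formulas become recursions for commutators with \<open>t_{1,2}\<close> and
  \<open>t_{2,1}\<close>. The entry \<open>t_{2,2}\<close> is generated by the other three.\<close>

lemma bprod_central:
  fixes T :: "idx \<Rightarrow> idx \<Rightarrow> 'r::ring_1 fps"
  assumes T: "unital T" "yang_rel 0 T" and p: "of_nat p = (0 :: 'r)" "p > 0"
  shows "T i j $ r * bprod T p $ n = bprod T p $ n * T i j $ r"
proof -
  obtain q where q: "p = Suc q" using p(2) by (cases p) auto
  have p0: "of_nat (Suc q) = (0 :: 'r fps)"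
    using p(1) unfolding q by (metis fps_const_0_eq_0 fps_of_nat)
  let ?P = "bprod T p"
  have 11: "T I1 I1 $ r * ?P $ n = ?P $ n * T I1 I1 $ r" for r n
    by (rule coeff_commI, rule bprod_commI, rule const_t11_comm[OF T])
  have 12: "T I1 I2 $ r * ?P $ n = ?P $ n * T I1 I2 $ r" for r n
  proof (rule coeff_commI)
    have "(\<lambda>s. fps_const (T I1 I2 $ s) * ?P - ?P * fps_const (T I1 I2 $ s)) r = 0"
    proof (rule X_chain_zero)
      show "fps_const (T I1 I2 $ s) * ?P - ?P * fps_const (T I1 I2 $ s)
        = fps_X * (fps_const (T I1 I2 $ Suc s) * ?P - ?P * fps_const (T I1 I2 $ Suc s))" for s
        using bprod_t12[OF T, of s q] unfolding p0 q
        by (simp add: right_diff_distrib algebra_simps del: bprod.simps of_nat_Suc)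
    qed (use T(1) in \<open>simp add: unital_def\<close>)
    then show "fps_const (T I1 I2 $ r) * ?P = ?P * fps_const (T I1 I2 $ r)" by simp
  qed
  have 21: "T I2 I1 $ r * ?P $ n = ?P $ n * T I2 I1 $ r" for r n
  proof (rule coeff_commI)
    have "(\<lambda>s. fps_const (T I2 I1 $ s) * ?P - ?P * fps_const (T I2 I1 $ s)) r = 0"
    proof (rule X_chain_zero)
      show "fps_const (T I2 I1 $ s) * ?P - ?P * fps_const (T I2 I1 $ s)
        = fps_X * (fps_const (T I2 I1 $ Suc s) * ?P - ?P * fps_const (T I2 I1 $ Suc s))" for s
        using bprod_t21[OF T, of q s] unfolding p0 q
        by (simp add: right_diff_distrib algebra_simps del: bprod.simps of_nat_Suc)
    qed (use T(1) in \<open>simp add: unital_def\<close>)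
    then show "fps_const (T I2 I1 $ r) * ?P = ?P * fps_const (T I2 I1 $ r)" by simp
  qed
  have 22: "T I2 I2 $ r * ?P $ n = ?P $ n * T I2 I2 $ r"
  proof -
    let ?y = "?P $ n"
    \<comment> \<open>At degree 1 in the second slot the relation collapses to one difference, which
      can be solved for \<open>t_{2,2}\<close>.\<close>
    have "scomm T I1 I2 I2 I1 r 1 = T I2 I2 $ r - T I1 I1 $ r"
      using yang_relD[OF T(2), of I1 I2 I2 I1 r 0] T(1)
      by (simp add: scomm_0_right unital_def) (metis minus_diff_eq minus_minus)
    then have e: "T I2 I2 $ r = T I1 I2 $ r * T I2 I1 $ 1 + T I2 I1 $ 1 * T I1 I2 $ r + T I1 I1 $ r"
      by (simp add: scomm_def algebra_simps)
    have "T I1 I2 $ r * T I2 I1 $ 1 * ?y = ?y * (T I1 I2 $ r * T I2 I1 $ 1)"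
      "T I2 I1 $ 1 * T I1 I2 $ r * ?y = ?y * (T I2 I1 $ 1 * T I1 I2 $ r)"
      by (metis 12 21 mult.assoc)+
    then show ?thesis unfolding e by (simp add: distrib_left distrib_right 11)
  qed
  show ?thesis using 11 12 21 22 by (cases i; cases j) simp_all
qed

lemma minv_minv: "unital T \<Longrightarrow> minv (minv T) i j = T i j"
  by (rule left_right_inverse_unique[symmetric, OF minv_right minv_right]) (simp_all add: unital_minv)

text \<open>Centrality for \<open>dual T\<close> gives commutation with the entries of
  \<open>minv T\<close>; inverting once more returns to \<open>T\<close>.\<close>

lemma dual_bprod_central:
  fixes T :: "idx \<Rightarrow> idx \<Rightarrow> 'r::ring_1 fps"
  assumes T: "unital T" "yang_rel 0 T" and p: "of_nat p = (0 :: 'r)" "p > 0"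
  shows "T i j $ r * bprod (dual T) p $ n = bprod (dual T) p $ n * T i j $ r"
proof -
  let ?y = "bprod (dual T) p $ n"
  have "dual T i j $ r * ?y = ?y * dual T i j $ r" for i j r
    by (rule bprod_central[OF unital_dual yang_rel_dual[OF T] p])
  from this[of "swap_idx _" "swap_idx _"]
  have "?y * minv T i j $ r = (-1) ^ (0 * (pidx i + pidx j)) * (minv T i j $ r * ?y)" for i j r
    by (simp add: dual_def)
  from supercommute_minv[OF unital_minv this]
  show ?thesis by (simp add: minv_minv[OF T(1)])
qed

section \<open>Invariance under \<open>u\<close> to \<open>u - 1\<close> and its consequence for
  coefficients\<close>

lemma shift_1_bprod: "shift 1 (bprod T n) = bprod_tail T n"
  by (induction n) (simp_all add: shift_mult sh_def shift_shift)

text \<open>Shifting trades the factor at shift 0 for one at shift \<open>p\<close>, and these are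
  equal in characteristic \<open>p\<close>.\<close>

lemma bprod_shift_invariant:
  fixes T :: "idx \<Rightarrow> idx \<Rightarrow> 'r::ring_1 fps"
  assumes T: "unital T" "yang_rel 0 T" and p: "of_nat p = (0 :: 'r)" "p > 0"
  shows "shift 1 (bprod T p) = bprod T p"
proof -
  obtain q where q: "p = Suc q" using p(2) by (cases p) auto
  have "sh T p I1 I1 = sh T 0 I1 I1"
    unfolding sh_def by (rule shift_cong_of_nat) (simp add: p(1))
  then have "bprod_tail T p = bprod T p"
    by (simp add: q bprod_Suc_tail[OF T] del: bprod.simps)
  then show ?thesis by (simp only: shift_1_bprod)
qed

text \<open>Compare coefficients of degree \<open>m + 1\<close>: the top ones cancel, and
  \<open>m\<close> times the coefficient of degree \<open>m\<close> is a combination of lower ones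
  of positive degree. If \<open>p\<close> does not divide \<open>m\<close>, then \<open>m\<close> is
  invertible modulo \<open>p\<close>; the remaining degrees are given.\<close>

lemma shift_invariant_coeff_mem:
  fixes A :: "'r::ring_1 fps"
  assumes inv: "shift 1 A = A" and p: "prime p" "of_nat p = (0 :: 'r)"
    and I: "0 \<in> I" "\<And>x y. x \<in> I \<Longrightarrow> y \<in> I \<Longrightarrow> x + y \<in> I" "\<And>x. x \<in> I \<Longrightarrow> - x \<in> I"
    and base: "\<And>r. r > 0 \<Longrightarrow> A $ (r * p) \<in> I"
    and n: "n > 0"
  shows "A $ n \<in> I"
  using n
proof (induction n rule: less_induct)
  case (less m)
  have mult: "of_nat k * x \<in> I" if "x \<in> I" for k x
    using that by (induction k) (simp_all add: I distrib_right)
  have sum: "(\<Sum>r\<in>S. f r) \<in> I" if "finite S" "\<And>r. r \<in> S \<Longrightarrow> f r \<in> I" for S and f :: "nat \<Rightarrow> 'r"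
    using that by (induction S) (simp_all add: I)
  show ?case
  proof (cases "p dvd m")
    case True
    then obtain r where "m = r * p" by (metis dvd_div_mult_self)
    then show ?thesis using base[of r] less.prems by simp
  next
    case False
    have S: "{1..Suc m} = insert (Suc m) (insert m {1..<m})" using less.prems by auto
    have "A $ Suc m = shift 1 A $ Suc m" by (simp only: inv)
    also have "\<dots> = A $ Suc m + (of_nat m * A $ m + (\<Sum>r\<in>{1..<m}. of_nat (m choose (Suc m - r)) * A $ r))"
      unfolding shift_def fps_nth_Abs_fps S by (simp add: less.prems)
    finally have "of_nat m * A $ m = - (\<Sum>r\<in>{1..<m}. of_nat (m choose (Suc m - r)) * A $ r)"
      by (simp add: eq_neg_iff_add_eq_0)
    then have mA: "of_nat m * A $ m \<in> I"
      using less.IH by (auto intro!: I sum mult)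
    \<comment> \<open>Here \<open>x\<close> is an inverse of \<open>m\<close> modulo
      \<open>p\<close>.\<close>
    obtain x y where "m * x = p * y + gcd m p" using bezout_nat[of m p] less.prems by auto
    moreover have "gcd m p = 1"
      using False p(1) by (metis coprime_commute coprime_iff_gcd_eq_1 prime_imp_coprime)
    ultimately have "of_nat x * (of_nat m * A $ m) = (of_nat p * of_nat y + 1) * A $ m"
      by (metis mult.assoc mult.commute of_nat_1 of_nat_add of_nat_mult)
    then have "A $ m = of_nat x * (of_nat m * A $ m)" by (simp add: p(2))
    then show ?thesis using mult[OF mA] by metis
  qed
qed

lemma torsion_free_2:
  assumes "of_nat p = (0 :: 'r::ring_1)" "odd p" "2 * x = (0 :: 'r)"
  shows "x = 0"
proof -
  obtain q where "p = 2 * q + 1" using assms(2) by (rule oddE)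
  then have "of_nat p * x = of_nat q * (2 * x) + x"
    by (simp add: distrib_right mult.assoc[symmetric] mult_of_nat_commute)
  then show ?thesis using assms by simp
qed

section \<open>Group-likeness\<close>

lemma sh_mprod_11: "sh (mprod A B) a I1 I1 = sh A a I1 I1 * sh B a I1 I1 + sh A a I1 I2 * sh B a I2 I1"
  by (simp add: sh_def mprod_def sum_idx shift_add shift_mult)

lemma sh_scommute:
  assumes "scommute A B"
  shows "sh B b k l * sh A a i j = (-1) ^ cross_deg i j k l * (sh A a i j * sh B b k l)"
  unfolding sh_def by (rule shift_scommute) (use assms in \<open>simp add: scommute_def\<close>)

text \<open>Each factor is a diagonal term plus an off-diagonal one. Two off-diagonal terms produce
  a vanishing product of neighbouring \<open>t_{1,2}\<close>; the contributions with a single one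
  are all brought to the same shape, whence the coefficient.\<close>

lemma bprod_mprod_Suc:
  fixes A B :: "idx \<Rightarrow> idx \<Rightarrow> 'r::ring_1 fps"
  assumes A: "unital A" "yang_rel 0 A" and B: "unital B" "yang_rel 0 B" and sc: "scommute A B"
    and two: "\<And>x :: 'r. 2 * x = 0 \<Longrightarrow> x = 0"
  shows "bprod (mprod A B) (Suc n) = bprod A (Suc n) * bprod B (Suc n)
    + of_nat (Suc n) * (sh A n I1 I2 * bprod A n * (sh B 0 I2 I1 * bprod_tail B n))"
proof (induction n)
  case 0
  show ?case by (simp add: sh_mprod_11)
next
  case (Suc n)
  define a where "a = sh A (Suc n) I1 I1"
  define b where "b = sh B (Suc n) I1 I1"
  define x where "x = sh A (Suc n) I1 I2"
  define y where "y = sh B (Suc n) I2 I1"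
  define x' where "x' = sh A n I1 I2"
  define Q where "Q = bprod A n"
  define P where "P = bprod A (Suc n)"
  define R where "R = bprod B (Suc n)"
  define W where "W = bprod_tail B n"
  define g where "g = sh B 0 I1 I1"
  define h where "h = sh B 0 I2 I1"
  define c where "c = (of_nat (Suc n) :: 'r fps)"
  have cc: "central c" unfolding c_def by (rule central_of_nat)
  have bA: "b * sh A k i j = sh A k i j * b" for k i j
    using sh_scommute[OF sc, of "Suc n" I1 I1 k i j] by (simp add: b_def)
  have bP: "b * P = P * b" unfolding P_def by (rule bprod_commI) (rule bA)
  have bQ: "b * Q = Q * b" unfolding Q_def by (rule bprod_commI) (rule bA)
  have yP: "y * P = P * y" unfolding P_def y_def
    by (rule bprod_commI) (use sh_scommute[OF sc, of "Suc n" I2 I1 _ I1 I1] in simp)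
  have yx: "y * x' = - (x' * y)"
    using sh_scommute[OF sc, of "Suc n" I2 I1 n I1 I2] by (simp add: x'_def y_def)
  have xx: "x * x' = 0" unfolding x_def x'_def by (rule rel_12_12_near[OF A two])
  \<comment> \<open>In the first leg the off-diagonal entry moves to the newest factor, as the
    common shape requires.\<close>
  have ax: "a * (x' * Q) = x * P"
    using rel_11_12_near[OF A, of n] unfolding a_def x'_def x_def P_def Q_def
    by (simp flip: mult.assoc)
  have Rg: "R = g * W" unfolding R_def g_def W_def by (rule bprod_Suc_tail[OF B])
  \<comment> \<open>In the second leg it moves to shift 0; this is where the coefficient grows by
    one.\<close>
  have far: "y * g + c * (b * h) = (c + 1) * (h * b)"
    using rel_11_21_far[OF B, of 0 "Suc n"] by (simp add: c_def y_def g_def b_def h_def add.commute)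
  have "bprod (mprod A B) (Suc (Suc n)) = (a * b + x * y) * (P * R + c * (x' * Q * (h * W)))"
    unfolding bprod.simps(2)[of "mprod A B" "Suc n"] Suc sh_mprod_11
    by (simp only: a_def b_def x_def y_def P_def R_def c_def x'_def Q_def h_def W_def)
  also have "\<dots> = a * (b * P) * R + c * (a * (b * x') * Q * (h * W))
      + x * (y * P) * R + c * (x * (y * x') * Q * (h * W))"
    by (simp add: distrib_left distrib_right central_left_commute[OF cc] mult.assoc)
  also have "\<dots> = a * P * (b * R) + c * (a * (x' * (b * Q)) * (h * W)) + x * P * (y * R)"
    unfolding bP yP yx using bA[of n I1 I2] xx
    by (simp add: x'_def[symmetric] mult.assoc) (simp flip: mult.assoc)
  also have "a * (x' * (b * Q)) * (h * W) = x * P * (b * (h * W))"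
    unfolding bQ ax[symmetric] by (simp add: mult.assoc)
  also have "a * P * (b * R) + c * (x * P * (b * (h * W))) + x * P * (y * R)
      = a * P * (b * R) + x * P * ((y * g + c * (b * h)) * W)"
    unfolding Rg by (simp add: distrib_left distrib_right central_left_commute[OF cc] mult.assoc)
  also have "\<dots> = a * P * (b * R) + (c + 1) * (x * P * (h * (b * W)))"
    unfolding far by (simp add: distrib_left distrib_right central_left_commute[OF cc] mult.assoc)
  also have "\<dots> = bprod A (Suc (Suc n)) * bprod B (Suc (Suc n))
    + of_nat (Suc (Suc n)) * (sh A (Suc n) I1 I2 * bprod A (Suc n) * (sh B 0 I2 I1 * bprod_tail B (Suc n)))"
    unfolding bprod.simps(2)[of A "Suc n"] bprod.simps(2)[of B "Suc n"] bprod_tail.simps(2)[of B n]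
    unfolding a_def b_def x_def P_def R_def c_def h_def W_def by (simp only: of_nat_Suc add.commute)
  finally show ?case .
qed

lemma bprod_mprod:
  fixes A B :: "idx \<Rightarrow> idx \<Rightarrow> 'r::ring_1 fps"
  assumes "unital A" "yang_rel 0 A" "unital B" "yang_rel 0 B" "scommute A B"
    and p: "of_nat p = (0 :: 'r)" "odd p"
  shows "bprod (mprod A B) p = bprod A p * bprod B p"
proof -
  obtain q where q: "p = Suc q" using p(2) by (cases p) auto
  have p0: "of_nat (Suc q) = (0 :: 'r fps)"
    using p(1) unfolding q by (metis fps_const_0_eq_0 fps_of_nat)
  have "bprod (mprod A B) (Suc q) = bprod A (Suc q) * bprod B (Suc q)
    + of_nat (Suc q) * (sh A q I1 I2 * bprod A q * (sh B 0 I2 I1 * bprod_tail B q))"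
    by (rule bprod_mprod_Suc[OF assms(1-5)]) (rule torsion_free_2[OF p])
  then show ?thesis unfolding p0 q by simp
qed

section \<open>Homomorphisms out of the free algebra\<close>

text \<open>A sum over an infinite set is 0 by convention, so \<open>fa_hom\<close>,
  \<open>comult\<close> and \<open>antipode\<close>, which sum over the support, are shown to be
  linear on finite supports only.\<close>

definition fs :: "('g,'k::field) fa \<Rightarrow> bool" where
  "fs f \<longleftrightarrow> finite {w. f w \<noteq> 0}"

lemmas fa_defs = fa_zero_def fa_one_def fa_word_def fa_add_def fa_smult_def fa_neg_def fa_sub_def

text \<open>Both sides sum over the ways of cutting a word into three pieces.\<close>

lemma fa_mul_assoc:
  fixes f g h :: "('g,'k::field) fa"
  shows "fa_mul (fa_mul f g) h = fa_mul f (fa_mul g h)"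
proof
  fix w :: "'g list"
  let ?n = "length w"
  let ?\<phi> = "\<lambda>a b c :: nat. f (take a w) * g (take b (drop a w)) * h (drop (a + b) w)"
  have "fa_mul (fa_mul f g) h w = (\<Sum>i=0..?n. \<Sum>j=0..i. ?\<phi> j (i - j) (?n - i))"
    unfolding fa_mul_def atLeast0AtMost[symmetric] sum_distrib_right
    by (rule sum.cong[OF refl], rule sum.cong) (auto simp: drop_take min_def)
  also have "\<dots> = (\<Sum>i=0..?n. \<Sum>j=0..?n - i. ?\<phi> i j (?n - i - j))"
    by (rule fps_mult_assoc_lemma)
  also have "\<dots> = fa_mul f (fa_mul g h) w"
    unfolding fa_mul_def atLeast0AtMost[symmetric] sum_distrib_left
    by (rule sum.cong[OF refl], rule sum.cong) (auto simp: mult.assoc add.commute)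
  finally show "fa_mul (fa_mul f g) h w = fa_mul f (fa_mul g h) w" .
qed

lemma fa_mul_add_left: "fa_mul (fa_add f g) h = fa_add (fa_mul f h) (fa_mul g h)"
  by (simp add: fa_mul_def fa_add_def fun_eq_iff distrib_right sum.distrib)

lemma fa_mul_add_right: "fa_mul h (fa_add f g) = fa_add (fa_mul h f) (fa_mul h g)"
  by (simp add: fa_mul_def fa_add_def fun_eq_iff distrib_left sum.distrib)

lemma fa_mul_smult_left: "fa_mul (fa_smult c f) h = fa_smult c (fa_mul f h)"
  by (simp add: fa_mul_def fa_smult_def fun_eq_iff sum_distrib_left mult.assoc)

lemma fa_mul_smult_right: "fa_mul h (fa_smult c f) = fa_smult c (fa_mul h f)"
  by (simp add: fa_mul_def fa_smult_def fun_eq_iff sum_distrib_left mult_ac)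

lemma fa_mul_zero [simp]: "fa_mul fa_zero f = fa_zero" "fa_mul f fa_zero = fa_zero"
  by (simp_all add: fa_mul_def fa_zero_def fun_eq_iff)

lemma fa_mul_word_word: "fa_mul (fa_word u) (fa_word v) = fa_word (u @ v)"
proof
  fix w
  have "fa_mul (fa_word u) (fa_word v) w
     = (\<Sum>i\<le>length w. if i = length u \<and> w = u @ v then 1 else 0)"
    unfolding fa_mul_def fa_word_def by (rule sum.cong[OF refl]) (auto simp: min_def)
  also have "\<dots> = fa_word (u @ v) w"
    by (cases "w = u @ v") (simp_all add: fa_word_def)
  finally show "fa_mul (fa_word u) (fa_word v) w = fa_word (u @ v) w" .
qed

lemma fa_one_word: "fa_one = fa_word []"
  by (simp add: fa_one_def fa_word_def)

lemma fa_mul_one [simp]: "fa_mul fa_one f = f" "fa_mul f fa_one = f"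
proof -
  show "fa_mul fa_one f = f"
  proof
    fix w
    have "fa_mul fa_one f w = (\<Sum>i\<le>length w. if i = 0 then f w else 0)"
      unfolding fa_mul_def fa_one_def by (rule sum.cong[OF refl]) auto
    then show "fa_mul fa_one f w = f w" by simp
  qed
  show "fa_mul f fa_one = f"
  proof
    fix w
    have "fa_mul f fa_one w = (\<Sum>i\<le>length w. if i = length w then f w else 0)"
      unfolding fa_mul_def fa_one_def by (rule sum.cong[OF refl]) auto
    then show "fa_mul f fa_one w = f w" by simp
  qed
qed

lemma fs_zero [simp]: "fs fa_zero" by (simp add: fs_def fa_zero_def)
lemma fs_word [simp]: "fs (fa_word w)" by (simp add: fs_def fa_word_def)
lemma fs_gen [simp]: "fs (fa_gen x)" by (simp add: fa_gen_def)
lemma fs_one [simp]: "fs fa_one" by (simp add: fa_one_word)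

lemma fs_add [simp]: "fs f \<Longrightarrow> fs g \<Longrightarrow> fs (fa_add f g)"
  unfolding fs_def fa_add_def
  by (rule finite_subset[of _ "{w. f w \<noteq> 0} \<union> {w. g w \<noteq> 0}"]) auto

lemma fs_smult [simp]: "fs f \<Longrightarrow> fs (fa_smult c f)"
  unfolding fs_def fa_smult_def by (rule finite_subset[of _ "{w. f w \<noteq> 0}"]) auto

lemma fa_neg_smult: "fa_neg f = fa_smult (-1) f"
  by (simp add: fa_neg_def fa_smult_def)

lemma fs_neg [simp]: "fs f \<Longrightarrow> fs (fa_neg f)"
  by (simp add: fa_neg_smult)

lemma fs_sub [simp]: "fs f \<Longrightarrow> fs g \<Longrightarrow> fs (fa_sub f g)"
  by (simp add: fa_sub_def)

lemma fs_induct [consumes 1, case_names zero add]: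
  assumes "fs f" and zero: "P fa_zero"
    and add: "\<And>c w f. fs f \<Longrightarrow> P f \<Longrightarrow> P (fa_add (fa_smult c (fa_word w)) f)"
  shows "P f"
proof -
  have "finite A \<Longrightarrow> \<forall>f. {w. f w \<noteq> 0} \<subseteq> A \<longrightarrow> P f" for A
  proof (induction A rule: finite_induct)
    case empty
    have "f = fa_zero" if "{w. f w \<noteq> 0} \<subseteq> {}" for f :: "('a, 'b) fa"
      using that by (auto simp: fa_zero_def)
    then show ?case using zero by blast
  next
    case (insert w A)
    show ?case
    proof (intro allI impI)
      fix f :: "('a, 'b) fa"
      assume f: "{w. f w \<noteq> 0} \<subseteq> insert w A"
      let ?g = "f(w := 0)"
      have g: "{w. ?g w \<noteq> 0} \<subseteq> A" using f by auto
      then have "P ?g" using insert.IH by blast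
      moreover have "fs ?g" unfolding fs_def by (rule finite_subset[OF g insert.hyps(1)])
      moreover have "f = fa_add (fa_smult (f w) (fa_word w)) ?g"
        by (auto simp: fa_defs fun_eq_iff)
      ultimately show "P f" using add by metis
    qed
  qed
  then show ?thesis using assms(1) unfolding fs_def by blast
qed

lemma fs_mul [simp]: "fs f \<Longrightarrow> fs g \<Longrightarrow> fs (fa_mul f g)"
proof (induction f rule: fs_induct)
  case (add c w f)
  from add.prems have "fs (fa_mul (fa_word w) g)"
    by (induction g rule: fs_induct)
      (simp_all add: fa_mul_add_right fa_mul_smult_right fa_mul_word_word)
  then show ?case using add by (simp add: fa_mul_add_left fa_mul_smult_left)
qed simp

lemma fa_sum_insert: "finite A \<Longrightarrow> a \<notin> A \<Longrightarrow> fa_sum F (insert a A) = fa_add (F a) (fa_sum F A)"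
  by (simp add: fa_sum_def fa_add_def)

lemma fa_sum_empty [simp]: "fa_sum F {} = fa_zero"
  by (simp add: fa_sum_def fa_zero_def)

lemma fs_sum [simp]: "finite A \<Longrightarrow> (\<And>a. a \<in> A \<Longrightarrow> fs (F a)) \<Longrightarrow> fs (fa_sum F A)"
  by (induction A rule: finite_induct) (simp_all add: fa_sum_insert)

lemma fs_prod_list: "(\<And>x. x \<in> set xs \<Longrightarrow> fs x) \<Longrightarrow> fs (fa_prod_list xs)"
  by (induction xs) (simp_all add: fa_prod_list_def)

lemma fa_prod_list_append: "fa_prod_list (xs @ ys) = fa_mul (fa_prod_list xs) (fa_prod_list ys)"
  by (induction xs) (simp_all add: fa_prod_list_def fa_mul_assoc)

text \<open>A homomorphism from the field into the centre makes the target an algebra. Kept as a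
  parameter, it allows one evaluation map with values in the field, in the tensor square and in an
  endomorphism ring.\<close>

locale scalars =
  fixes \<eta> :: "'k::field \<Rightarrow> 'r::ring_1"
  assumes eta_add: "\<eta> (a + b) = \<eta> a + \<eta> b"
    and eta_mult: "\<eta> (a * b) = \<eta> a * \<eta> b"
    and eta_one: "\<eta> 1 = 1"
    and eta_central: "\<eta> a * x = x * \<eta> a"
begin

lemma eta_zero: "\<eta> 0 = 0"
  using eta_add[of 0 0] by simp

lemma eta_neg: "\<eta> (- a) = - \<eta> a"
  using eta_add[of a "- a"] by (simp add: eta_zero eq_neg_iff_add_eq_0 add.commute)

lemma eta_of_nat: "\<eta> (of_nat n) = of_nat n"
  by (induction n) (simp_all add: eta_zero eta_add eta_one)

lemma eta_left_commute: "x * (\<eta> a * y) = \<eta> a * (x * y)"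
  by (metis eta_central mult.assoc)

definition lin :: "('g list \<Rightarrow> 'r) \<Rightarrow> ('g,'k) fa \<Rightarrow> 'r" where
  "lin G f = (\<Sum>w\<in>{w. f w \<noteq> 0}. \<eta> (f w) * G w)"

lemma lin_superset:
  assumes "finite A" "{w. f w \<noteq> 0} \<subseteq> A"
  shows "lin G f = (\<Sum>w\<in>A. \<eta> (f w) * G w)"
  unfolding lin_def using assms by (intro sum.mono_neutral_left) (auto simp: eta_zero)

lemma lin_zero: "lin G fa_zero = 0"
  by (simp add: lin_def fa_zero_def)

lemma lin_add: "fs f \<Longrightarrow> fs g \<Longrightarrow> lin G (fa_add f g) = lin G f + lin G g"
proof -
  assume fg: "fs f" "fs g"
  let ?A = "{w. f w \<noteq> 0} \<union> {w. g w \<noteq> 0}"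
  have A: "finite ?A" using fg by (simp add: fs_def)
  have "lin G (fa_add f g) = (\<Sum>w\<in>?A. \<eta> (fa_add f g w) * G w)"
    by (rule lin_superset[OF A]) (auto simp: fa_add_def)
  also have "\<dots> = (\<Sum>w\<in>?A. \<eta> (f w) * G w) + (\<Sum>w\<in>?A. \<eta> (g w) * G w)"
    by (simp add: fa_add_def eta_add distrib_right sum.distrib)
  also have "\<dots> = lin G f + lin G g"
    by (simp add: lin_superset[OF A])
  finally show ?thesis .
qed

lemma lin_smult: "fs f \<Longrightarrow> lin G (fa_smult c f) = \<eta> c * lin G f"
proof -
  assume f: "fs f"
  have "lin G (fa_smult c f) = (\<Sum>w\<in>{w. f w \<noteq> 0}. \<eta> (fa_smult c f w) * G w)"
    by (rule lin_superset) (use f in \<open>auto simp: fs_def fa_smult_def\<close>)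
  then show ?thesis by (simp add: lin_def fa_smult_def eta_mult sum_distrib_left mult.assoc)
qed

lemma lin_word:
  fixes w :: "'h list"
  shows "lin G (fa_word w) = G w"
proof -
  have "{v. (fa_word w :: ('h, 'k) fa) v \<noteq> 0} = {w}" by (auto simp: fa_word_def)
  then show ?thesis unfolding lin_def by (simp add: fa_word_def eta_one)
qed

lemma lin_neg: "fs f \<Longrightarrow> lin G (fa_neg f) = - lin G f"
  by (simp add: fa_neg_smult lin_smult eta_neg eta_one)

lemma lin_sub: "fs f \<Longrightarrow> fs g \<Longrightarrow> lin G (fa_sub f g) = lin G f - lin G g"
  by (simp add: fa_sub_def lin_add lin_neg)

lemma lin_sum: "finite A \<Longrightarrow> (\<And>a. a \<in> A \<Longrightarrow> fs (F a)) \<Longrightarrow> lin G (fa_sum F A) = (\<Sum>a\<in>A. lin G (F a))"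
  by (induction A rule: finite_induct) (simp_all add: lin_zero fa_sum_insert lin_add)

definition hm :: "('g \<Rightarrow> 'r) \<Rightarrow> ('g,'k) fa \<Rightarrow> 'r" where
  "hm \<phi> = lin (\<lambda>w. prod_list (map \<phi> w))"

lemma hm_zero: "hm \<phi> fa_zero = 0"
  and hm_add: "fs f \<Longrightarrow> fs g \<Longrightarrow> hm \<phi> (fa_add f g) = hm \<phi> f + hm \<phi> g"
  and hm_smult: "fs f \<Longrightarrow> hm \<phi> (fa_smult c f) = \<eta> c * hm \<phi> f"
  and hm_word: "hm \<phi> (fa_word w) = prod_list (map \<phi> w)"
  and hm_neg: "fs f \<Longrightarrow> hm \<phi> (fa_neg f) = - hm \<phi> f"
  and hm_sub: "fs f \<Longrightarrow> fs g \<Longrightarrow> hm \<phi> (fa_sub f g) = hm \<phi> f - hm \<phi> g"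
  and hm_sum: "finite A \<Longrightarrow> (\<And>a. a \<in> A \<Longrightarrow> fs (F a)) \<Longrightarrow> hm \<phi> (fa_sum F A) = (\<Sum>a\<in>A. hm \<phi> (F a))"
  unfolding hm_def by (simp_all add: lin_zero lin_add lin_smult lin_word lin_neg lin_sub lin_sum)

lemma hm_one: "hm \<phi> fa_one = 1"
  by (simp add: fa_one_word hm_word)

lemma hm_gen: "hm \<phi> (fa_gen x) = \<phi> x"
  by (simp add: fa_gen_def hm_word)

lemma hm_mul: "fs f \<Longrightarrow> fs g \<Longrightarrow> hm \<phi> (fa_mul f g) = hm \<phi> f * hm \<phi> g"
proof (induction f rule: fs_induct)
  case (add c w f)
  from add.prems have "hm \<phi> (fa_mul (fa_word w) g) = hm \<phi> (fa_word w) * hm \<phi> g"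
    by (induction g rule: fs_induct)
      (simp_all add: fa_mul_add_right fa_mul_smult_right fa_mul_word_word hm_zero hm_add
        hm_smult hm_word distrib_left eta_left_commute)
  then show ?case using add
    by (simp add: fa_mul_add_left fa_mul_smult_left hm_add hm_smult distrib_right mult.assoc)
qed (simp add: hm_zero)

lemma hm_prod_list: "(\<And>x. x \<in> set xs \<Longrightarrow> fs x) \<Longrightarrow> hm \<phi> (fa_prod_list xs) = prod_list (map (hm \<phi>) xs)"
  by (induction xs) (simp_all add: fa_prod_list_def hm_one hm_mul fs_prod_list[unfolded fa_prod_list_def])

lemma hm_ideal:
  assumes R: "\<And>r. r \<in> R \<Longrightarrow> fs r \<and> hm \<phi> r = 0" and x: "x \<in> fa_ideal R"
  shows "fs x \<and> hm \<phi> x = 0"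
  using x by induction (auto simp: hm_zero hm_mul hm_add hm_smult R)

definition hs :: "('g \<Rightarrow> 'r) \<Rightarrow> ('g,'k) ser \<Rightarrow> 'r fps" where
  "hs \<phi> A = Abs_fps (\<lambda>n. hm \<phi> (A n))"

end

interpretation base: scalars "\<lambda>x. x :: 'k::field"
  by unfold_locales (simp_all add: algebra_simps)

lemma fa_hom_lin: "fa_hom \<phi> f = (\<lambda>v. base.lin (\<lambda>w. fa_prod_list (map \<phi> w) v) f)"
  by (simp add: fa_hom_def base.lin_def)

lemma fa_hom_zero: "fa_hom \<phi> fa_zero = fa_zero"
  and fa_hom_add: "fs f \<Longrightarrow> fs g \<Longrightarrow> fa_hom \<phi> (fa_add f g) = fa_add (fa_hom \<phi> f) (fa_hom \<phi> g)"
  and fa_hom_smult: "fs f \<Longrightarrow> fa_hom \<phi> (fa_smult c f) = fa_smult c (fa_hom \<phi> f)"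
  and fa_hom_word: "fa_hom \<phi> (fa_word w) = fa_prod_list (map \<phi> w)"
  unfolding fa_hom_lin
  by (simp_all add: base.lin_zero base.lin_add base.lin_smult base.lin_word)
    (simp_all add: fa_add_def fa_smult_def fa_zero_def)

lemma fs_hom: "fs f \<Longrightarrow> (\<And>g. fs (\<phi> g)) \<Longrightarrow> fs (fa_hom \<phi> f)"
proof (induction f rule: fs_induct)
  case (add c w f)
  have "fs (fa_prod_list (map \<phi> w))" by (rule fs_prod_list) (use add in auto)
  then show ?case using add by (simp add: fa_hom_add fa_hom_smult fa_hom_word)
qed (simp add: fa_hom_zero)

lemma (in scalars) hm_fa_hom:
  assumes "fs f" and \<phi>: "\<And>g. fs (\<phi> g)"
  shows "hm \<psi> (fa_hom \<phi> f) = hm (\<lambda>g. hm \<psi> (\<phi> g)) f"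
  using assms(1)
proof (induction f rule: fs_induct)
  case (add c w f)
  have 1: "fs (fa_prod_list (map \<phi> w))" by (rule fs_prod_list) (use \<phi> in auto)
  have "hm \<psi> (fa_prod_list (map \<phi> w)) = prod_list (map (hm \<psi>) (map \<phi> w))"
    by (rule hm_prod_list) (use \<phi> in auto)
  then show ?case using add 1
    by (simp add: fa_hom_add fa_hom_smult fa_hom_word hm_add hm_smult hm_word fs_hom[OF _ \<phi>] comp_def)
qed (simp add: fa_hom_zero hm_zero)

section \<open>Finite support of the series built from the generators\<close>

lemma fs_tc [simp]: "fs (tc i j r)"
  by (simp add: tc_def)

definition sfs :: "('g,'k::field) ser \<Rightarrow> bool" where
  "sfs A \<longleftrightarrow> (\<forall>n. fs (A n))"

lemma sfs_one [simp]: "sfs ser_one" by (simp add: sfs_def ser_one_def)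
lemma sfs_tser [simp]: "sfs (tser i j)" by (simp add: sfs_def tser_def)
lemma sfs_add [simp]: "sfs A \<Longrightarrow> sfs B \<Longrightarrow> sfs (ser_add A B)" by (simp add: sfs_def ser_add_def)
lemma sfs_neg [simp]: "sfs A \<Longrightarrow> sfs (ser_neg A)" by (simp add: sfs_def ser_neg_def)
lemma sfs_mul [simp]: "sfs A \<Longrightarrow> sfs B \<Longrightarrow> sfs (ser_mul A B)" by (simp add: sfs_def ser_mul_def)
lemma sfs_shift [simp]: "sfs A \<Longrightarrow> sfs (ser_shift a A)" by (simp add: sfs_def ser_shift_def)

declare ser_inv.simps [simp del] mat_inv.simps [simp del]

lemma sfs_inv [simp]: "sfs A \<Longrightarrow> sfs (ser_inv A)"
  unfolding sfs_def
proof (intro allI)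
  fix n assume A: "\<forall>n. fs (A n)"
  show "fs (ser_inv A n)"
  proof (induction n rule: less_induct)
    case (less n)
    then show ?case using A by (subst ser_inv.simps) (auto intro!: fs_neg fs_sum fs_mul)
  qed
qed

lemma sfs_prod_list [simp]: "(\<And>A. A \<in> set xs \<Longrightarrow> sfs A) \<Longrightarrow> sfs (ser_prod_list xs)"
  by (induction xs) (simp_all add: ser_prod_list_def)

lemma fs_tmat [simp]: "fs (tmat m i j)"
  by (simp add: tmat_def)

lemma fs_mat_inv [simp]: "fs (mat_inv tmat n i j)"
proof (induction n arbitrary: i j rule: less_induct)
  case (less n)
  then show ?case by (subst mat_inv.simps) (auto intro!: fs_neg fs_sum fs_mul)
qed

lemma sfs_d: "sfs d1" "sfs d2"
  by (simp_all add: d1_def d2_def ee_def ff_def)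

lemma sfs_b: "sfs (b1 p)" "sfs (b2 p)"
  unfolding b1_def b2_def by (rule sfs_prod_list, auto simp: sfs_d)+

context scalars
begin

lemma hs_one: "hs \<phi> ser_one = 1"
  by (rule fps_ext) (simp add: hs_def ser_one_def hm_one hm_zero)

lemma hs_mul: "sfs A \<Longrightarrow> sfs B \<Longrightarrow> hs \<phi> (ser_mul A B) = hs \<phi> A * hs \<phi> B"
  by (rule fps_ext) (simp add: hs_def ser_mul_def sfs_def hm_sum hm_mul fps_mult_nth atLeast0AtMost)

lemma hs_add: "sfs A \<Longrightarrow> sfs B \<Longrightarrow> hs \<phi> (ser_add A B) = hs \<phi> A + hs \<phi> B"
  by (rule fps_ext) (simp add: hs_def ser_add_def sfs_def hm_add)

lemma hs_neg: "sfs A \<Longrightarrow> hs \<phi> (ser_neg A) = - hs \<phi> A"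
  by (rule fps_ext) (simp add: hs_def ser_neg_def sfs_def hm_neg)

lemma hs_shift: "sfs A \<Longrightarrow> hs \<phi> (ser_shift a A) = shift a (hs \<phi> A)"
proof (rule fps_ext)
  fix n assume A: "sfs A"
  have e: "\<eta> (of_nat c * of_nat a ^ k) = of_nat (c * a ^ k)" for c k
    using eta_of_nat[of "c * a ^ k"] by simp
  show "hs \<phi> (ser_shift a A) $ n = shift a (hs \<phi> A) $ n"
    using A by (simp add: hs_def ser_shift_def shift_def sfs_def hm_sum hm_smult e del: of_nat_mult)
qed

lemma hs_prod_list: "(\<And>A. A \<in> set xs \<Longrightarrow> sfs A) \<Longrightarrow> hs \<phi> (ser_prod_list xs) = prod_list (map (hs \<phi>) xs)"
  by (induction xs) (simp_all add: ser_prod_list_def hs_one hs_mul sfs_prod_list[unfolded ser_prod_list_def])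

lemma hs_inv:
  assumes A: "sfs A" and 1: "hs \<phi> A $ 0 = 1"
  shows "hs \<phi> A * hs \<phi> (ser_inv A) = 1"
proof (rule fps_ext)
  fix n
  have fsA: "fs (A m)" "fs (ser_inv A m)" for m using A sfs_inv[OF A] by (simp_all add: sfs_def)
  have "(hs \<phi> A * hs \<phi> (ser_inv A)) $ n = hm \<phi> (ser_inv A n) + (\<Sum>m=1..n. hm \<phi> (A m) * hm \<phi> (ser_inv A (n - m)))"
    using 1 by (simp add: fps_mult_nth hs_def sum.atLeast_Suc_atMost)
  also have "\<dots> = (1 :: 'r fps) $ n"
    by (subst ser_inv.simps) (simp add: hm_one hm_neg hm_sum hm_mul fsA)
  finally show "(hs \<phi> A * hs \<phi> (ser_inv A)) $ n = (1 :: 'r fps) $ n" .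
qed

definition tm :: "(ygen \<Rightarrow> 'r) \<Rightarrow> idx \<Rightarrow> idx \<Rightarrow> 'r fps" where
  "tm \<phi> i j = hs \<phi> (tser i j)"

lemma hm_tc: "hm \<phi> (tc i j r) = tm \<phi> i j $ r"
  by (simp add: tm_def hs_def tser_def)

lemma tm_nth: "tm \<phi> i j $ r = (if r = 0 then (if i = j then 1 else 0) else \<phi> (Tg i j (r - 1)))"
  by (simp add: hm_tc[symmetric] tc_def hm_one hm_zero hm_gen)

lemma unital_tm: "unital (tm \<phi>)"
  by (simp add: unital_def tm_nth)

lemma hm_mat_inv: "hm \<phi> (mat_inv tmat n i j) = minv (tm \<phi>) i j $ n"
proof (induction n arbitrary: i j rule: less_induct)
  case (less n)
  have tmat: "hm \<phi> (tmat m i j) = tm \<phi> i j $ m" for m i j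
    by (simp add: tmat_def hm_tc)
  have "hm \<phi> (mat_inv tmat (n - m) k j) = mat_inv_coeff (tm \<phi>) (n - m) k j" if "m \<in> {1..n}" for m k
    using less.IH[of "n - m" k j] that by (simp add: minv_def)
  then have "(\<Sum>m=1..n. \<Sum>k\<in>UNIV. tm \<phi> i k $ m * hm \<phi> (mat_inv tmat (n - m) k j))
     = (\<Sum>m=1..n. \<Sum>k\<in>UNIV. tm \<phi> i k $ m * mat_inv_coeff (tm \<phi>) (n - m) k j)" by simp
  then show ?case
    by (subst mat_inv.simps)
      (simp add: minv_def mat_inv_coeff.simps[of _ n] hm_one hm_zero hm_neg hm_sum hm_mul tmat)
qed

text \<open>The Schur complement \<open>d_2\<close> is inverse to the lower right entry of the
  inverse matrix: eliminate \<open>t'_{2,1}\<close> from the second row of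
  \<open>T' T = 1\<close>.\<close>

lemma hs_d2_dual: "dual (tm \<phi>) I1 I1 * hs \<phi> d2 = 1"
proof -
  let ?T = "tm \<phi>" and ?D = "hs \<phi> (ser_inv d1)"
  have D: "?T I1 I1 * ?D = 1"
    using hs_inv[OF sfs_d(1), of \<phi>] unital_tm[of \<phi>] by (simp add: tm_def d1_def unital_def)
  have "hs \<phi> d2 = ?T I2 I2 - ?T I2 I1 * ?D * ?T I1 I1 * (?D * ?T I1 I2)"
    by (simp add: d2_def ee_def ff_def hs_add hs_neg hs_mul sfs_d tm_def) (simp add: d1_def)
  also have "?T I2 I1 * ?D * ?T I1 I1 * (?D * ?T I1 I2) = ?T I2 I1 * ?D * (?T I1 I1 * ?D) * ?T I1 I2"
    by (simp only: mult.assoc)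
  finally have d2: "hs \<phi> d2 = ?T I2 I2 - ?T I2 I1 * ?D * ?T I1 I2" by (simp add: D)
  let ?M = "minv ?T"
  have inv: "?M i I1 * ?T I1 j + ?M i I2 * ?T I2 j = (if i = j then 1 else 0)" for i j
    using mat_inverses_minv[OF unital_tm[of \<phi>]] by (simp add: mat_inverses_def sum_idx)
  have "?M I2 I1 * ?T I1 I1 = - (?M I2 I2 * ?T I2 I1)"
    using inv[of I2 I1] by (simp add: eq_neg_iff_add_eq_0)
  then have "?M I2 I1 * (?T I1 I1 * ?D) = - (?M I2 I2 * ?T I2 I1) * ?D"
    by (simp only: mult.assoc[symmetric])
  then have "?M I2 I1 = - (?M I2 I2 * ?T I2 I1) * ?D" by (simp add: D)
  then have "?M I2 I2 * ?T I2 I2 - ?M I2 I2 * ?T I2 I1 * ?D * ?T I1 I2 = 1"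
    using inv[of I2 I2] by (simp add: add.commute)
  then show ?thesis by (simp add: dual_def d2 right_diff_distrib mult.assoc)
qed

text \<open>The list has the factors in the opposite order to \<open>bprod\<close>; they
  commute.\<close>

lemma prod_list_bprod:
  assumes "unital T" "yang_rel 0 T"
  shows "prod_list (map (\<lambda>a. shift a (T I1 I1)) [0..<n]) = bprod T n"
proof (induction n)
  case (Suc n)
  have "bprod T n * sh T n I1 I1 = sh T n I1 I1 * bprod T n"
    by (rule bprod_commI[symmetric]) (rule sh_comm[OF assms])
  then show ?case using Suc by (simp add: sh_def)
qed simp

lemma hs_b1:
  assumes "yang_rel 0 (tm \<phi>)"
  shows "hs \<phi> (b1 p) = bprod (tm \<phi>) p"
proof -
  have "hs \<phi> (b1 p) = prod_list (map (hs \<phi>) (map (\<lambda>a. ser_shift a d1) [0..<p]))"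
    unfolding b1_def by (rule hs_prod_list) (auto simp: sfs_d)
  also have "map (hs \<phi>) (map (\<lambda>a. ser_shift a d1) [0..<p]) = map (\<lambda>a. shift a (tm \<phi> I1 I1)) [0..<p]"
    unfolding map_map by (rule map_cong[OF refl]) (simp add: hs_shift d1_def tm_def)
  also have "prod_list \<dots> = bprod (tm \<phi>) p"
    by (rule prod_list_bprod[OF unital_tm assms])
  finally show ?thesis .
qed

lemma hs_b2:
  assumes "yang_rel 0 (tm \<phi>)"
  shows "hs \<phi> (b2 p) = bprod (dual (tm \<phi>)) p"
proof -
  have "hs \<phi> (ser_inv (ser_shift a d2)) = shift a (dual (tm \<phi>) I1 I1)" for a
  proof -
    let ?A = "shift a (hs \<phi> d2)" and ?L = "shift a (dual (tm \<phi>) I1 I1)"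
    have L: "?L * ?A = 1" by (simp add: hs_d2_dual flip: shift_mult)
    have "?A $ 0 = 1"
      using arg_cong[OF hs_d2_dual[of \<phi>], of "\<lambda>A. A $ 0"] unital_dual[of "tm \<phi>"]
      by (simp add: unital_def)
    then have "?A * hs \<phi> (ser_inv (ser_shift a d2)) = 1"
      using hs_inv[of "ser_shift a d2" \<phi>] by (simp add: sfs_d hs_shift)
    then have "?L * (?A * hs \<phi> (ser_inv (ser_shift a d2))) = ?L" by simp
    then show ?thesis by (simp only: mult.assoc[symmetric] L mult_1_left)
  qed
  then have e: "map (hs \<phi>) (map (\<lambda>a. ser_inv (ser_shift a d2)) [0..<p])
      = map (\<lambda>a. shift a (dual (tm \<phi>) I1 I1)) [0..<p]"
    unfolding map_map by (intro map_cong[OF refl]) simp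
  have "hs \<phi> (b2 p) = prod_list (map (hs \<phi>) (map (\<lambda>a. ser_inv (ser_shift a d2)) [0..<p]))"
    unfolding b2_def by (rule hs_prod_list) (auto simp: sfs_d)
  also have "\<dots> = bprod (dual (tm \<phi>)) p"
    unfolding e by (rule prod_list_bprod[OF unital_dual yang_rel_dual[OF unital_tm assms]])
  finally show ?thesis .
qed

end

text \<open>Telescoping in \<open>r\<close> down to degree 0; the companion below telescopes in
  \<open>s\<close>. The shorter of the two sums is the defining relation.\<close>

lemma scomm_sum_left:
  fixes T :: "idx \<Rightarrow> idx \<Rightarrow> 'r::ring_1 fps"
  assumes "unital T" "yang_rel 0 T"
  shows "scomm T i j k l r s = (-1) ^ triple_deg i j k
     * (\<Sum>t<r. T k j $ t * T i l $ (r + s - 1 - t) - T k j $ (r + s - 1 - t) * T i l $ t)"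
proof (induction r arbitrary: s)
  case (Suc r)
  show ?case using yang_relD[OF assms(2), of i j k l r s] Suc[of "Suc s"]
    by (simp add: distrib_left diff_eq_eq add.commute)
qed (simp add: scomm_0_left[OF assms(1)])

lemma scomm_sum_right:
  fixes T :: "idx \<Rightarrow> idx \<Rightarrow> 'r::ring_1 fps"
  assumes "unital T" "yang_rel 0 T"
  shows "scomm T i j k l r s = (-1) ^ triple_deg i j k
     * (\<Sum>t<s. T k j $ t * T i l $ (r + s - 1 - t) - T k j $ (r + s - 1 - t) * T i l $ t)"
proof (induction s arbitrary: r)
  case (Suc s)
  show ?case using yang_relD[OF assms(2), of i j k l r s] Suc[of "Suc r"]
    by (simp add: algebra_simps)
qed (simp add: scomm_0_right[OF assms(1)])

lemma yang_relI:
  fixes T :: "idx \<Rightarrow> idx \<Rightarrow> 'r::ring_1 fps"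
  assumes T: "unital T"
    and H: "\<And>i j k l r s. 0 < r \<Longrightarrow> 0 < s \<Longrightarrow> scomm T i j k l r s
     = (-1) ^ triple_deg i j k
     * (\<Sum>t<min r s. T k j $ t * T i l $ (r + s - 1 - t) - T k j $ (r + s - 1 - t) * T i l $ t)"
  shows "yang_rel 0 T"
  unfolding yang_rel_def
proof (intro allI)
  fix i j k l r s
  let ?e = "(-1) ^ triple_deg i j k :: 'r"
  let ?F = "\<lambda>n t. T k j $ t * T i l $ (n - t) - T k j $ (n - t) * T i l $ t"
  have C: "scomm T i j k l r s = ?e * (\<Sum>t<min r s. ?F (r + s - 1) t)" for r s
    using H[of r s i j k l] by (cases "r = 0"; cases "s = 0") (auto simp: scomm_0_left[OF T] scomm_0_right[OF T])
  have 1: "scomm T i j k l (Suc r) s = ?e * (\<Sum>t<min (Suc r) s. ?F (r + s) t)"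
    "scomm T i j k l r (Suc s) = ?e * (\<Sum>t<min r (Suc s). ?F (r + s) t)"
    using C[of "Suc r" s] C[of r "Suc s"] by simp_all
  \<comment> \<open>The two ranges differ by at most one term, whose sign depends on which of them
    is longer.\<close>
  consider "r < s" | "r = s" | "s < r" by linarith
  then have "(\<Sum>t<min (Suc r) s. ?F (r + s) t) - (\<Sum>t<min r (Suc s). ?F (r + s) t)
     = T k j $ r * T i l $ s - T k j $ s * T i l $ r"
  proof cases
    case 1
    then have "min (Suc r) s = Suc r" "min r (Suc s) = r" by auto
    then show ?thesis by simp
  next
    case 2
    then show ?thesis by (simp add: min_def)
  next
    case 3
    then have "min (Suc r) s = s" "min r (Suc s) = Suc s" by auto
    then show ?thesis by simp
  qed
  then show "scomm T i j k l (Suc r) s - scomm T i j k l r (Suc s)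
      = (-1) ^ (0 + pidx i * pidx j + pidx i * pidx k + pidx j * pidx k)
        * (T k j $ r * T i l $ s - T k j $ s * T i l $ r)"
    unfolding 1 right_diff_distrib[symmetric] add_0 by (rule arg_cong)
qed

context scalars
begin

lemma eta_sgn: "\<eta> (Defs.sgn n) = (-1) ^ n"
  by (induction n) (simp_all add: Defs.sgn_def eta_one eta_neg eta_mult)

lemma fs_yrel: "fs (yrel i j k l r s)"
  by (simp add: yrel_def)

lemma hm_yrel: "hm \<phi> (yrel i j k l r s) = scomm (tm \<phi>) i j k l r s
   - (-1) ^ triple_deg i j k
     * (\<Sum>t<min r s. tm \<phi> k j $ t * tm \<phi> i l $ (r + s - 1 - t) - tm \<phi> k j $ (r + s - 1 - t) * tm \<phi> i l $ t)"
  by (simp add: yrel_def hm_sub hm_smult hm_mul hm_sum hm_tc eta_sgn scomm_def)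

text \<open>Universal property of \<open>Y\<close>: homomorphisms into a ring correspond to matrices
  of series with \<open>yang_rel 0\<close>.\<close>

lemma hm_yrels_iff: "(\<forall>r\<in>yrels. hm \<phi> r = 0) \<longleftrightarrow> yang_rel 0 (tm \<phi>)"
proof
  assume H: "\<forall>r\<in>yrels. hm \<phi> r = 0"
  show "yang_rel 0 (tm \<phi>)"
  proof (rule yang_relI[OF unital_tm])
    fix i j k l and r s :: nat
    assume "0 < r" "0 < s"
    then have "(yrel i j k l r s :: (ygen,'k) fa) \<in> yrels" unfolding yrels_def by blast
    then show "scomm (tm \<phi>) i j k l r s = (-1) ^ triple_deg i j k
     * (\<Sum>t<min r s. tm \<phi> k j $ t * tm \<phi> i l $ (r + s - 1 - t) - tm \<phi> k j $ (r + s - 1 - t) * tm \<phi> i l $ t)"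
      using H hm_yrel[of \<phi> i j k l r s] by simp
  qed
next
  assume Y: "yang_rel 0 (tm \<phi>)"
  have "hm \<phi> (yrel i j k l r s) = 0" for i j k l r s
    using scomm_sum_left[OF unital_tm Y, of i j k l r s] scomm_sum_right[OF unital_tm Y, of i j k l r s]
    by (cases "r \<le> s") (simp_all add: hm_yrel min_def)
  then show "\<forall>r\<in>yrels. hm \<phi> r = 0" unfolding yrels_def by auto
qed

end

section \<open>The tensor square as a quotient ring\<close>

lemma fa_ideal_fs:
  assumes "\<And>r. r \<in> R \<Longrightarrow> fs r" and "x \<in> fa_ideal R"
  shows "fs x"
  using assms(2) by induction (simp_all add: assms(1))

lemma fa_ideal_word_left: "x \<in> fa_ideal R \<Longrightarrow> fa_mul (fa_word u) x \<in> fa_ideal R"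
proof (induction rule: fa_ideal.induct)
  case (fi_gen r v w)
  then show ?case
    using fa_ideal.fi_gen[OF fi_gen, of "u @ v" w] by (simp add: fa_mul_assoc flip: fa_mul_word_word)
qed (simp_all add: fa_mul_add_right fa_mul_smult_right fa_ideal.intros)

lemma fa_ideal_word_right: "x \<in> fa_ideal R \<Longrightarrow> fa_mul x (fa_word u) \<in> fa_ideal R"
proof (induction rule: fa_ideal.induct)
  case (fi_gen r v w)
  then show ?case
    using fa_ideal.fi_gen[OF fi_gen, of v "w @ u"] by (simp add: fa_mul_assoc flip: fa_mul_word_word)
qed (simp_all add: fa_mul_add_left fa_mul_smult_left fa_ideal.intros)

lemma fa_ideal_mul_left: "fs f \<Longrightarrow> x \<in> fa_ideal R \<Longrightarrow> fa_mul f x \<in> fa_ideal R"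
  by (induction f rule: fs_induct)
    (simp_all add: fa_mul_add_left fa_mul_smult_left fa_ideal.intros fa_ideal_word_left)

lemma fa_ideal_mul_right: "fs f \<Longrightarrow> x \<in> fa_ideal R \<Longrightarrow> fa_mul x f \<in> fa_ideal R"
  by (induction f rule: fs_induct)
    (simp_all add: fa_mul_add_right fa_mul_smult_right fa_ideal.intros fa_ideal_word_right)

lemma fs_inl: "fs x \<Longrightarrow> fs (inl_hom x)" and fs_inr: "fs x \<Longrightarrow> fs (inr_hom x)"
  by (simp_all add: inl_hom_def inr_hom_def fs_hom)

lemma fs_yrels: "r \<in> yrels \<Longrightarrow> fs (r :: (ygen,'k::field) fa)"
  by (auto simp: yrels_def base.fs_yrel)

lemma fs_tens_rels: "r \<in> tens_rels \<Longrightarrow> fs (r :: (ygen2,'k::field) fa)"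
  by (auto simp: tens_rels_def fs_inl fs_inr fs_yrels)

lemma fs_tens_ideal: "x \<in> fa_ideal tens_rels \<Longrightarrow> fs (x :: (ygen2,'k::field) fa)"
  using fa_ideal_fs fs_tens_rels by blast

definition tens_eq :: "(ygen2,'k::field) fa \<Rightarrow> (ygen2,'k) fa \<Rightarrow> bool" where
  "tens_eq f g \<longleftrightarrow> fs f \<and> fs g \<and> fa_sub f g \<in> fa_ideal tens_rels"

lemma tens_eq_refl: "fs f \<Longrightarrow> tens_eq f f"
  using fa_ideal.fi_zero[of tens_rels] by (simp add: tens_eq_def fa_defs)

lemma fa_sub_flip: "fa_sub g f = fa_smult (-1) (fa_sub f g)"
  by (simp add: fa_defs fun_eq_iff)

lemma fa_sub_trans: "fa_sub f h = fa_add (fa_sub f g) (fa_sub g h)"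
  by (simp add: fa_defs fun_eq_iff)

lemma fa_sub_add: "fa_sub (fa_add f f') (fa_add g g') = fa_add (fa_sub f g) (fa_sub f' g')"
  by (simp add: fa_defs fun_eq_iff)

lemma fa_sub_mul: "fa_sub (fa_mul f f') (fa_mul g g') = fa_add (fa_mul f (fa_sub f' g')) (fa_mul (fa_sub f g) g')"
  by (simp add: fa_sub_def fa_neg_smult fa_mul_add_left fa_mul_add_right fa_mul_smult_left fa_mul_smult_right)
    (simp add: fa_defs fun_eq_iff)

lemma fa_sub_neg: "fa_sub (fa_neg f) (fa_neg g) = fa_smult (-1) (fa_sub f g)"
  by (simp add: fa_defs fun_eq_iff)

\<comment> \<open>The relation is reflexive on finite supports only, hence a partial quotient.
  \<open>Y\<close> gets no type of its own; it is represented by its image in the left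
  factor.\<close>
quotient_type (overloaded) 'k tens = "(ygen2,'k::field) fa" / partial: tens_eq
proof (rule part_equivpI)
  show "\<exists>x. tens_eq x x" using tens_eq_refl[OF fs_zero] by blast
  show "symp tens_eq"
    unfolding symp_def tens_eq_def by (metis fa_sub_flip fa_ideal.fi_smult)
  show "transp tens_eq"
    unfolding transp_def tens_eq_def by (metis fa_sub_trans fa_ideal.fi_add)
qed

lemma fa_ring_simps:
  "fa_add f g = fa_add g f" "fa_add (fa_add f g) h = fa_add f (fa_add g h)"
  "fa_add fa_zero f = f" "fa_add (fa_neg f) f = fa_zero"
  by (simp_all add: fa_defs fun_eq_iff)

lemma base_counit_yrels:
  assumes "r \<in> yrels"
  shows "base.hm (\<lambda>g. 0) (r :: (ygen,'k::field) fa) = 0"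
proof -
  have "yang_rel 0 (base.tm (\<lambda>g. 0 :: 'k))"
    by (simp add: yang_rel_def scomm_def base.tm_nth)
  then show ?thesis using base.hm_yrels_iff assms by blast
qed

lemma base_counit_tens_rels:
  assumes "r \<in> tens_rels"
  shows "base.hm (\<lambda>g. 0) (r :: (ygen2,'k::field) fa) = 0"
  using assms unfolding tens_rels_def
  by (auto simp: inl_hom_def inr_hom_def base.hm_fa_hom fs_yrels base.hm_gen base_counit_yrels
      base.hm_sub base.hm_mul base.hm_smult)

text \<open>The counit separates 1 from 0, as the class \<open>ring_1\<close> demands.\<close>

lemma one_not_tens_eq_zero: "\<not> tens_eq fa_zero (fa_one :: (ygen2,'k::field) fa)"
proof
  assume "tens_eq fa_zero (fa_one :: (ygen2,'k) fa)"
  then have "base.hm (\<lambda>g. 0) (fa_sub fa_zero (fa_one :: (ygen2,'k) fa)) = 0"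
    using base.hm_ideal[of tens_rels "\<lambda>g. 0"] fs_tens_rels base_counit_tens_rels
    by (metis tens_eq_def)
  then show False by (simp add: base.hm_sub base.hm_zero base.hm_one)
qed

instantiation tens :: (field) ring_1
begin

lift_definition zero_tens :: "'a tens" is fa_zero by (rule tens_eq_refl) simp
lift_definition one_tens :: "'a tens" is fa_one by (rule tens_eq_refl) simp
lift_definition plus_tens :: "'a tens \<Rightarrow> 'a tens \<Rightarrow> 'a tens" is fa_add
  unfolding tens_eq_def fa_sub_add by (simp add: fa_ideal.fi_add)
lift_definition uminus_tens :: "'a tens \<Rightarrow> 'a tens" is fa_neg
  unfolding tens_eq_def fa_sub_neg by (simp add: fa_ideal.fi_smult)
lift_definition times_tens :: "'a tens \<Rightarrow> 'a tens \<Rightarrow> 'a tens" is fa_mul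
  unfolding tens_eq_def fa_sub_mul by (simp add: fa_ideal.fi_add fa_ideal_mul_left fa_ideal_mul_right)
definition minus_tens :: "'a tens \<Rightarrow> 'a tens \<Rightarrow> 'a tens" where "minus_tens a b = a + - b"

instance
proof
  fix a b c :: "'a tens"
  have fs: "fs f" if "tens_eq f f" for f :: "(ygen2,'a) fa" using that by (simp add: tens_eq_def)
  show "a + b + c = a + (b + c)" by transfer (simp add: fa_ring_simps(2) tens_eq_refl fs)
  show "a + b = b + a" by transfer (metis fa_ring_simps(1) tens_eq_refl fs fs_add)
  show "0 + a = a" by transfer (simp add: fa_ring_simps(3))
  show "- a + a = 0" by transfer (simp add: fa_ring_simps(4) tens_eq_refl)
  show "a - b = a + - b" by (rule minus_tens_def)
  show "a * b * c = a * (b * c)" by transfer (simp add: fa_mul_assoc tens_eq_refl fs)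
  show "1 * a = a" by transfer simp
  show "a * 1 = a" by transfer simp
  show "(a + b) * c = a * c + b * c" by transfer (simp add: fa_mul_add_left tens_eq_refl fs)
  show "a * (b + c) = a * b + a * c" by transfer (simp add: fa_mul_add_right tens_eq_refl fs)
  show "(0 :: 'a tens) \<noteq> 1" by transfer (rule one_not_tens_eq_zero)
qed

end

definition tcls :: "(ygen2,'k::field) fa \<Rightarrow> 'k tens" where "tcls = abs_tens"

lemma tcls_eq_iff: "fs f \<Longrightarrow> fs g \<Longrightarrow> tcls f = tcls g \<longleftrightarrow> fa_sub f g \<in> fa_ideal tens_rels"
  unfolding tcls_def using Quotient_rel[OF Quotient_tens, of f g]
  by (simp add: tens_eq_refl) (simp add: tens_eq_def)

lemma tcls_zero: "tcls fa_zero = 0" by (simp add: tcls_def zero_tens_def)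
lemma tcls_one: "tcls fa_one = 1" by (simp add: tcls_def one_tens_def)
lemma tcls_add: "fs f \<Longrightarrow> fs g \<Longrightarrow> tcls (fa_add f g) = tcls f + tcls g"
  by (simp add: tcls_def plus_tens.abs_eq tens_eq_refl)
lemma tcls_mul: "fs f \<Longrightarrow> fs g \<Longrightarrow> tcls (fa_mul f g) = tcls f * tcls g"
  by (simp add: tcls_def times_tens.abs_eq tens_eq_refl)

definition tsc :: "'k::field \<Rightarrow> 'k tens" where "tsc c = tcls (fa_smult c fa_one)"

lemma tcls_smult: "fs f \<Longrightarrow> tcls (fa_smult c f) = tsc c * tcls f"
  by (simp add: tsc_def fa_mul_smult_left flip: tcls_mul)

lemma tcls_surj: "\<exists>f. fs f \<and> tcls f = x"
  using Quotient_abs_rep[OF Quotient_tens] Quotient_rep_reflp[OF Quotient_tens]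
  unfolding tcls_def tens_eq_def by metis

interpretation tq: scalars tsc
proof
  fix a b :: 'a and x :: "'a tens"
  have "fa_smult (a + b) fa_one = fa_add (fa_smult a fa_one) (fa_smult b (fa_one :: (ygen2,'a) fa))"
    by (simp add: fa_defs fun_eq_iff distrib_right)
  then show "tsc (a + b) = tsc a + tsc b" by (simp add: tsc_def tcls_add)
  have "fa_smult (a * b) fa_one = fa_mul (fa_smult a fa_one) (fa_smult b (fa_one :: (ygen2,'a) fa))"
    by (simp add: fa_mul_smult_left) (simp add: fa_defs fun_eq_iff)
  then show "tsc (a * b) = tsc a * tsc b" by (simp add: tsc_def tcls_mul)
  have "fa_smult 1 fa_one = (fa_one :: (ygen2,'a) fa)" by (simp add: fa_defs)
  then show "tsc 1 = (1 :: 'a tens)" by (simp add: tsc_def tcls_one)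
  obtain f where f: "fs f" "tcls f = x" using tcls_surj by blast
  show "tsc a * x = x * tsc a"
    unfolding f(2)[symmetric] using f(1)
    by (simp add: tsc_def fa_mul_smult_left fa_mul_smult_right flip: tcls_mul)
qed

definition tg :: "ygen2 \<Rightarrow> 'k::field tens" where "tg g = tcls (fa_gen g)"

lemma tcls_hm: "fs f \<Longrightarrow> tq.hm tg f = tcls f"
proof (induction f rule: fs_induct)
  case (add c w f)
  have "prod_list (map tg w) = tcls (fa_word w :: (ygen2,'a) fa)"
  proof (induction w)
    case Nil
    then show ?case by (simp add: tcls_one flip: fa_one_word)
  next
    case (Cons g w)
    have "fa_word (g # w) = fa_mul (fa_gen g) (fa_word w :: (ygen2,'a) fa)"
      by (simp add: fa_gen_def fa_mul_word_word)
    then show ?case using Cons by (simp add: tg_def tcls_mul)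
  qed
  then show ?case using add by (simp add: tq.hm_add tq.hm_smult tq.hm_word tcls_add tcls_smult)
qed (simp add: tq.hm_zero tcls_zero)

lemma tens_kernel: "fs f \<Longrightarrow> tq.hm tg f = 0 \<longleftrightarrow> f \<in> fa_ideal tens_rels"
proof -
  have "fa_sub f fa_zero = f" by (simp add: fa_defs)
  then show "fs f \<Longrightarrow> tq.hm tg f = 0 \<longleftrightarrow> f \<in> fa_ideal tens_rels"
    using tcls_eq_iff[of f fa_zero] by (simp add: tcls_hm tcls_zero)
qed

section \<open>The two embeddings of \<open>Y\<close> into its tensor square\<close>

definition hl :: "(ygen,'k::field) fa \<Rightarrow> 'k tens" where "hl = tq.hm (\<lambda>g. tg (Inl g))"
definition hr :: "(ygen,'k::field) fa \<Rightarrow> 'k tens" where "hr = tq.hm (\<lambda>g. tg (Inr g))"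

lemma hl_inl: "fs f \<Longrightarrow> tq.hm tg (inl_hom f) = hl f"
  and hr_inr: "fs f \<Longrightarrow> tq.hm tg (inr_hom f) = hr f"
  by (simp_all add: inl_hom_def inr_hom_def hl_def hr_def tq.hm_fa_hom tq.hm_gen)

lemma fa_hom_mul:
  assumes \<phi>: "\<And>g. fs (\<phi> g)" and "fs f" "fs h"
  shows "fa_hom \<phi> (fa_mul f h) = fa_mul (fa_hom \<phi> f) (fa_hom \<phi> h)"
  using assms(2,3)
proof (induction f rule: fs_induct)
  case (add c w f)
  have w: "fs (fa_prod_list (map \<phi> w))" for w by (rule fs_prod_list) (use \<phi> in auto)
  from add.prems have "fa_hom \<phi> (fa_mul (fa_word w) h) = fa_mul (fa_hom \<phi> (fa_word w)) (fa_hom \<phi> h)"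
    by (induction h rule: fs_induct)
      (simp_all add: fa_mul_add_right fa_mul_smult_right fa_mul_word_word fa_hom_add fa_hom_smult
        fa_hom_word fa_hom_zero fa_prod_list_append)
  then show ?case using add
    by (simp add: fa_mul_add_left fa_mul_smult_left fa_hom_add fa_hom_smult)
qed (simp add: fa_hom_zero)

lemma fa_hom_fa_hom:
  assumes \<phi>: "\<And>g. fs (\<phi> g)" and \<psi>: "\<And>g. fs (\<psi> g)" and "fs f"
  shows "fa_hom \<psi> (fa_hom \<phi> f) = fa_hom (\<lambda>g. fa_hom \<psi> (\<phi> g)) f"
  using assms(3)
proof (induction f rule: fs_induct)
  case (add c w f)
  have w: "fs (fa_prod_list (map \<phi> w))" for w by (rule fs_prod_list) (use \<phi> in auto)
  have "fa_hom \<psi> (fa_prod_list (map \<phi> w)) = fa_prod_list (map (\<lambda>g. fa_hom \<psi> (\<phi> g)) w)"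
  proof (induction w)
    case Nil
    show ?case by (simp add: fa_prod_list_def fa_one_word fa_hom_word)
  next
    case (Cons g w)
    then show ?case using fa_hom_mul[OF \<psi> \<phi>[of g] w[of w]] by (simp add: fa_prod_list_def)
  qed
  then show ?case using add w
    by (simp add: fa_hom_add fa_hom_smult fa_hom_word fs_hom[OF _ \<phi>])
qed (simp add: fa_hom_zero)

lemma fa_hom_gen_id:
  fixes f :: "('g,'k::field) fa"
  shows "fs f \<Longrightarrow> fa_hom fa_gen f = f"
proof (induction f rule: fs_induct)
  case (add c w f)
  have "fa_prod_list (map fa_gen w) = (fa_word w :: ('g,'k) fa)"
    by (induction w) (simp_all add: fa_prod_list_def fa_one_word fa_gen_def fa_mul_word_word)
  then show ?case using add by (simp add: fa_hom_add fa_hom_smult fa_hom_word)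
qed (simp add: fa_hom_zero)

lemma fa_hom_gen: "fa_hom \<phi> (fa_gen g) = \<phi> g"
  by (simp add: fa_gen_def fa_hom_word fa_prod_list_def)

lemma fa_hom_zero_gens:
  fixes f :: "('g,'k::field) fa"
  shows "fs f \<Longrightarrow> fa_hom (\<lambda>g. fa_zero) f = fa_smult (base.hm (\<lambda>g. 0) f) (fa_one :: ('h,'k) fa)"
proof (induction f rule: fs_induct)
  case (add c w f)
  have "fa_prod_list (map (\<lambda>g. fa_zero) w) = (fa_smult (prod_list (map (\<lambda>g. 0) w)) fa_one :: ('h,'k) fa)"
    by (cases w) (simp_all add: fa_prod_list_def, simp_all add: fa_defs)
  then show ?case using add
    by (simp add: fa_hom_add fa_hom_smult fa_hom_word base.hm_add base.hm_smult base.hm_word)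
      (simp add: fa_add_def fa_smult_def fun_eq_iff distrib_right)
qed (simp add: fa_hom_zero base.hm_zero, simp add: fa_defs)

text \<open>The map \<open>id \<otimes> \<epsilon>\<close>, a retraction of the tensor square onto
  its left factor.\<close>

definition fold_right :: "ygen2 \<Rightarrow> (ygen,'k::field) fa" where
  "fold_right g = (case g of Inl x \<Rightarrow> fa_gen x | Inr x \<Rightarrow> fa_zero)"

lemma fold_right_simps: "fold_right (Inl x) = fa_gen x" "fold_right (Inr x) = fa_zero"
  by (simp_all add: fold_right_def)

lemma fs_fold_right: "fs (fold_right g)"
  by (simp add: fold_right_def split: sum.split)

lemma fold_right_inl: "fs f \<Longrightarrow> fa_hom fold_right (inl_hom f) = f"
  unfolding inl_hom_def
  by (subst fa_hom_fa_hom) (simp_all add: fs_fold_right fa_hom_gen fold_right_simps fa_hom_gen_id)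

lemma fold_right_inr: "fs f \<Longrightarrow> fa_hom fold_right (inr_hom f) = fa_smult (base.hm (\<lambda>g. 0) f) fa_one"
  unfolding inr_hom_def
  by (subst fa_hom_fa_hom) (simp_all add: fs_fold_right fa_hom_gen fold_right_simps fa_hom_zero_gens)

lemma fold_right_ideal:
  assumes "x \<in> fa_ideal tens_rels"
  shows "fa_hom fold_right x \<in> yker"
  using assms
proof induction
  case fi_zero
  then show ?case by (simp add: fa_hom_zero yker_def fa_ideal.fi_zero)
next
  case (fi_gen r u v)
  have "fa_hom fold_right r \<in> yker"
    using fi_gen unfolding tens_rels_def
  proof (elim UnE imageE CollectE exE conjE)
    fix x :: "(ygen,'a) fa" assume x: "r = inl_hom x" "x \<in> yrels"
    have "x \<in> yker" unfolding yker_def using fa_ideal.fi_gen[OF x(2), of "[]" "[]"]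
      by (simp flip: fa_one_word)
    then show ?thesis using x by (simp add: fold_right_inl fs_yrels)
  next
    fix x :: "(ygen,'a) fa" assume x: "r = inr_hom x" "x \<in> yrels"
    then have "fa_hom fold_right r = fa_zero"
      by (simp add: fold_right_inr fs_yrels base_counit_yrels) (simp add: fa_defs)
    then show ?thesis by (simp add: yker_def fa_ideal.fi_zero)
  next
    fix g h assume r: "r = fa_sub (fa_mul (fa_gen (Inr h)) (fa_gen (Inl g)))
             (fa_smult (Defs.sgn (ypar g * ypar h)) (fa_mul (fa_gen (Inl g)) (fa_gen (Inr h))))"
    have "fa_hom fold_right r = fa_zero"
      unfolding r fa_sub_def fa_neg_smult
      by (simp add: fa_hom_add fa_hom_smult fa_hom_mul fs_fold_right fa_hom_gen fold_right_simps) (simp add: fa_defs)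
    then show ?thesis by (simp add: yker_def fa_ideal.fi_zero)
  qed
  then show ?case using fs_tens_rels[OF fi_gen]
    by (simp add: fa_hom_mul fs_fold_right fs_hom yker_def fa_ideal_mul_left fa_ideal_mul_right)
next
  case (fi_add x y)
  then show ?case
    by (simp add: fs_tens_ideal fa_hom_add yker_def fa_ideal.fi_add)
next
  case (fi_smult x c)
  then show ?case
    by (simp add: fs_tens_ideal fa_hom_smult yker_def fa_ideal.fi_smult)
qed

lemma hl_yrels: "r \<in> yrels \<Longrightarrow> hl r = 0" and hr_yrels: "r \<in> yrels \<Longrightarrow> hr r = 0"
proof -
  have *: "x \<in> tens_rels \<Longrightarrow> tq.hm tg x = 0" for x :: "(ygen2,'a) fa"
    using fa_ideal.fi_gen[of x tens_rels "[]" "[]"] tens_kernel[of x] fs_tens_rels[of x]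
    by (simp flip: fa_one_word)
  show "r \<in> yrels \<Longrightarrow> hl r = 0" and "r \<in> yrels \<Longrightarrow> hr r = 0" for r :: "(ygen,'a) fa"
    using *[of "inl_hom r"] *[of "inr_hom r"]
    by (simp_all add: tens_rels_def hl_inl hr_inr fs_yrels)
qed

text \<open>Injectivity of \<open>x\<close> to \<open>x \<otimes> 1\<close>, by the retraction.
  Questions about \<open>yker\<close> can thus be decided by equations in the tensor square.\<close>

lemma hl_kernel: "fs f \<Longrightarrow> hl f = 0 \<longleftrightarrow> f \<in> yker"
proof
  assume f: "fs f" "hl f = 0"
  then have "inl_hom f \<in> fa_ideal tens_rels"
    by (simp add: fs_inl hl_inl flip: tens_kernel)
  from fold_right_ideal[OF this] show "f \<in> yker" by (simp add: fold_right_inl f)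
next
  assume "f \<in> yker"
  then show "hl f = 0" unfolding yker_def hl_def
    using tq.hm_ideal[of yrels] fs_yrels hl_yrels[unfolded hl_def] by blast
qed

definition tL :: "idx \<Rightarrow> idx \<Rightarrow> 'k::field tens fps" where "tL = tq.tm (\<lambda>g. tg (Inl g))"
definition tR :: "idx \<Rightarrow> idx \<Rightarrow> 'k::field tens fps" where "tR = tq.tm (\<lambda>g. tg (Inr g))"

lemma unital_tLR: "unital tL" "unital tR"
  by (simp_all add: tL_def tR_def tq.unital_tm)

lemma yang_tLR: "yang_rel 0 tL" "yang_rel 0 tR"
  unfolding tL_def tR_def tq.hm_yrels_iff[symmetric]
  using hl_yrels[unfolded hl_def] hr_yrels[unfolded hr_def] by blast+

lemma tg_commute: "tg (Inr h) * tg (Inl g) = (-1) ^ (ypar g * ypar h) * (tg (Inl g) * tg (Inr h))"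
proof -
  let ?r = "fa_sub (fa_mul (fa_gen (Inr h)) (fa_gen (Inl g)))
             (fa_smult (Defs.sgn (ypar g * ypar h)) (fa_mul (fa_gen (Inl g)) (fa_gen (Inr h)))) :: (ygen2,'a) fa"
  have "?r \<in> tens_rels" unfolding tens_rels_def by blast
  then have "tq.hm tg ?r = 0"
    using fa_ideal.fi_gen[of ?r tens_rels "[]" "[]"] tens_kernel[of ?r]
    by (simp flip: fa_one_word)
  then show ?thesis
    by (simp add: tq.hm_sub tq.hm_mul tq.hm_smult tq.hm_gen tq.eta_sgn)
qed

lemma scommute_tLR: "scommute tL tR"
  unfolding scommute_def tL_def tR_def tq.tm_nth
  by (auto simp: tg_commute ypar_def minus_one_power_iff)

section \<open>The convolution identity for the antipode\<close>

definition pscale :: "'r::ring_1 \<Rightarrow> 'r \<times> 'r \<Rightarrow> 'r \<times> 'r" where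
  "pscale c z = (c * fst z, c * snd z)"

lemma pscale_simps: "pscale c (x + y) = pscale c x + pscale c y" "pscale c 0 = 0" "pscale c (- x) = - pscale c x"
  by (simp_all add: pscale_def distrib_left prod_eq_iff)

text \<open>Multiplication is composition in diagrammatic order, so that right multiplications multiply
  like ring elements. Compatibility with central scalars makes multiples of the identity central.\<close>

typedef (overloaded) 'r endo =
  "{f :: 'r::ring_1 \<times> 'r \<Rightarrow> 'r \<times> 'r. (\<forall>x y. f (x + y) = f x + f y) \<and>
     (\<forall>c z. central c \<longrightarrow> f (pscale c z) = pscale c (f z))}"
  by (rule exI[of _ "\<lambda>z. 0"]) (simp add: pscale_simps)

setup_lifting type_definition_endo

lemma app_add: "Rep_endo f (x + y) = Rep_endo f x + Rep_endo f y"
  and app_pscale: "central c \<Longrightarrow> Rep_endo f (pscale c z) = pscale c (Rep_endo f z)"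
  using Rep_endo[of f] by (simp_all del: split_paired_All)

lemma app_zero: "Rep_endo f 0 = 0"
proof -
  have "Rep_endo f 0 + 0 = Rep_endo f 0 + Rep_endo f 0"
    using app_add[of f 0 0] by (simp only: add_0_right)
  then show ?thesis by (metis add_left_cancel)
qed

lemma endo_eqI: "(\<And>z. Rep_endo f z = Rep_endo g z) \<Longrightarrow> f = g"
  by (rule iffD1[OF Rep_endo_inject], rule ext)

instantiation endo :: (ring_1) ring_1
begin

lift_definition zero_endo :: "'a endo" is "\<lambda>z. 0" by (simp add: pscale_simps)
lift_definition one_endo :: "'a endo" is "\<lambda>z. z" by simp
lift_definition plus_endo :: "'a endo \<Rightarrow> 'a endo \<Rightarrow> 'a endo" is "\<lambda>f g z. f z + g z"
  by (simp add: pscale_simps add_ac)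
lift_definition uminus_endo :: "'a endo \<Rightarrow> 'a endo" is "\<lambda>f z. - f z"
  by (simp add: pscale_simps)
lift_definition times_endo :: "'a endo \<Rightarrow> 'a endo \<Rightarrow> 'a endo" is "\<lambda>f g z. g (f z)"
  by (simp del: split_paired_All)
definition minus_endo :: "'a endo \<Rightarrow> 'a endo \<Rightarrow> 'a endo" where "minus_endo f g = f + - g"

instance
proof
  note rep = zero_endo.rep_eq one_endo.rep_eq plus_endo.rep_eq uminus_endo.rep_eq times_endo.rep_eq
  fix f g h :: "'a endo"
  show "f - g = f + - g" by (rule minus_endo_def)
  show "(0 :: 'a endo) \<noteq> 1"
  proof
    assume "(0 :: 'a endo) = 1"
    from arg_cong[OF this, of "\<lambda>f. fst (Rep_endo f (1, 1))"] show False by (simp add: rep)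
  qed
  show "f + g + h = f + (g + h)" by (rule endo_eqI) (simp add: rep add.assoc)
  show "f + g = g + f" by (rule endo_eqI) (simp add: rep add.commute)
  show "0 + f = f" by (rule endo_eqI) (simp add: rep)
  show "- f + f = 0" by (rule endo_eqI) (simp add: rep)
  show "f * g * h = f * (g * h)" by (rule endo_eqI) (simp add: rep)
  show "1 * f = f" by (rule endo_eqI) (simp add: rep)
  show "f * 1 = f" by (rule endo_eqI) (simp only: rep)
  show "f * (g + h) = f * g + f * h" by (rule endo_eqI) (simp only: rep)
  show "(f + g) * h = f * h + g * h" by (rule endo_eqI) (simp only: rep app_add)
qed

end

lemma app_simps:
  "Rep_endo 0 z = 0" "Rep_endo 1 z = z" "Rep_endo (f + g) z = Rep_endo f z + Rep_endo g z"
  "Rep_endo (- f) z = - Rep_endo f z" "Rep_endo (f * g) z = Rep_endo g (Rep_endo f z)"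
  "Rep_endo (f - g) z = Rep_endo f z - Rep_endo g z"
  unfolding minus_endo_def zero_endo.rep_eq one_endo.rep_eq plus_endo.rep_eq uminus_endo.rep_eq times_endo.rep_eq
  by simp_all

lemma app_sum: "Rep_endo (\<Sum>a\<in>A. f a) z = (\<Sum>a\<in>A. Rep_endo (f a) z)"
  by (induction A rule: infinite_finite_induct) (simp_all add: app_simps)

text \<open>The components of a pair play the even and the odd part. As the ring has no grading, the
  parity \<open>d\<close> of the multiplier is supplied by hand, and an odd one exchanges the
  components.\<close>

lift_definition rmul :: "nat \<Rightarrow> 'r::ring_1 \<Rightarrow> 'r endo" is
  "\<lambda>d t z. if even d then (fst z * t, snd z * t) else (snd z * t, fst z * t)"
  by (auto simp: pscale_def distrib_right mult.assoc)

text \<open>The minus sign is that of an odd \<open>s\<close> passing an odd argument. It makes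
  composition of these operators reproduce the rule
  \<open>S(x y) = (-1)^{|x||y|} S(y) S(x)\<close>.\<close>

lift_definition lmul :: "nat \<Rightarrow> 'r::ring_1 \<Rightarrow> 'r endo" is
  "\<lambda>d s z. if even d then (s * fst z, s * snd z) else (- (s * snd z), s * fst z)"
  by (auto simp: pscale_def distrib_left intro: central_left_commute)

lemma rmul_mult: "rmul d x * rmul e y = rmul (d + e) (x * y)"
  by transfer (auto simp: mult.assoc)

lemma lmul_mult: "lmul d s * lmul e s' = (-1) ^ (d * e) * lmul (d + e) (s' * s)"
  by (rule endo_eqI) (auto simp: minus_one_power_iff app_simps lmul.rep_eq mult.assoc)

lemma rmul_lmul: "rmul e y * lmul d s = (-1) ^ (d * e) * (lmul d s * rmul e y)"
  by (rule endo_eqI) (auto simp: minus_one_power_iff app_simps lmul.rep_eq rmul.rep_eq mult.assoc)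

lemma rmul_add: "rmul d (x + y) = rmul d x + rmul d y" and lmul_add: "lmul d (x + y) = lmul d x + lmul d y"
  by (transfer, auto simp: distrib_left distrib_right)+

lemma rmul_neg: "rmul d (- x) = - rmul d x" and lmul_neg: "lmul d (- x) = - lmul d x"
  by (transfer, auto)+

lemma rmul_diff: "rmul d (x - y) = rmul d x - rmul d y" and lmul_diff: "lmul d (x - y) = lmul d x - lmul d y"
  using rmul_add[of d x "- y"] lmul_add[of d x "- y"] by (simp_all add: rmul_neg lmul_neg)

lemma rmul_zero: "rmul d 0 = 0" and lmul_zero: "lmul d 0 = 0"
  by (transfer, auto simp: zero_prod_def)+

lemma rmul_one: "even d \<Longrightarrow> rmul d 1 = 1" and lmul_one: "even d \<Longrightarrow> lmul d 1 = 1"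
  by (transfer, auto)+

lemma rmul_cong: "even d = even e \<Longrightarrow> rmul d x = rmul e x"
  by (transfer, auto)

lemma rmul_sign: "rmul d ((-1) ^ n * x) = (-1) ^ n * rmul d x"
  and lmul_sign: "lmul d ((-1) ^ n * x) = (-1) ^ n * lmul d x"
  by (simp_all add: minus_one_power_iff rmul_neg lmul_neg)

lemma rmul_sum: "rmul d (\<Sum>a\<in>A. f a) = (\<Sum>a\<in>A. rmul d (f a))"
  by (induction A rule: infinite_finite_induct) (simp_all add: rmul_zero rmul_add)

lemma rmul_of_nat: "rmul 0 (of_nat n) = of_nat n"
  by (induction n) (simp_all add: rmul_zero rmul_add rmul_one)

section \<open>The tensor factors acting by right and by left multiplication\<close>

definition rfam :: "(idx \<Rightarrow> idx \<Rightarrow> 'r::ring_1 fps) \<Rightarrow> idx \<Rightarrow> idx \<Rightarrow> 'r endo fps" where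
  "rfam T i j = Abs_fps (\<lambda>r. rmul (pidx i + pidx j) (T i j $ r))"

definition lfam :: "(idx \<Rightarrow> idx \<Rightarrow> 'r::ring_1 fps) \<Rightarrow> idx \<Rightarrow> idx \<Rightarrow> 'r endo fps" where
  "lfam T i j = Abs_fps (\<lambda>r. lmul (pidx i + pidx j) (minv T i j $ r))"

lemma unital_rfam: "unital T \<Longrightarrow> unital (rfam T)"
  by (simp add: unital_def rfam_def rmul_zero rmul_one)

lemma unital_lfam: "unital (lfam T)"
  using unital_minv[of T] by (simp add: unital_def lfam_def lmul_zero lmul_one)

lemma yang_rfam:
  assumes "yang_rel 0 T"
  shows "yang_rel 0 (rfam T)"
  unfolding yang_rel_def
proof (intro allI)
  fix i j k l r s
  let ?d = "pidx i + pidx j + (pidx k + pidx l)"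
  have c: "scomm (rfam T) i j k l r s = rmul ?d (scomm T i j k l r s)" for r s
    by (simp add: scomm_def rfam_def rmul_mult rmul_diff rmul_sign add.commute)
  have e: "pidx k + pidx j + (pidx i + pidx l) = ?d" by simp
  show "scomm (rfam T) i j k l (Suc r) s - scomm (rfam T) i j k l r (Suc s)
      = (-1) ^ (0 + pidx i * pidx j + pidx i * pidx k + pidx j * pidx k)
        * (rfam T k j $ r * rfam T i l $ s - rfam T k j $ s * rfam T i l $ r)"
    unfolding c rmul_diff[symmetric] yang_relD[OF assms] rmul_sign
    unfolding rfam_def fps_nth_Abs_fps rmul_mult e by (simp add: rmul_diff)
qed

text \<open>Left multiplications compose in reverse order and \<open>minv T\<close> satisfies the
  relation with the opposite sign; together with the signs of \<open>lmul_mult\<close> the two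
  effects restore the original relation.\<close>

lemma yang_lfam:
  assumes "unital T" "yang_rel 0 T"
  shows "yang_rel 0 (lfam T)"
  unfolding yang_rel_def
proof (intro allI)
  fix i j k l r s
  let ?d = "pidx i + pidx j + (pidx k + pidx l)" and ?M = "minv T"
  let ?g = "cross_deg i j k l" and ?h = "cross_deg k j i l"
  let ?s = "pidx j * pidx k + pidx j * pidx l + pidx k * pidx l"
    and ?t = "pidx i * pidx j + pidx i * pidx k + pidx j * pidx k"
  have c: "scomm (lfam T) i j k l r s = - lmul ?d (scomm ?M i j k l r s)" for r s
  proof -
    have "scomm (lfam T) i j k l r s = (-1) ^ ?g * lmul ?d (?M k l $ s * ?M i j $ r)
      - (-1) ^ ?g * ((-1) ^ cross_deg k l i j * lmul ?d (?M i j $ r * ?M k l $ s))"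
      by (simp add: scomm_def lfam_def lmul_mult add.commute)
    also have "(-1) ^ ?g * ((-1) ^ cross_deg k l i j * lmul ?d (?M i j $ r * ?M k l $ s))
      = lmul ?d (?M i j $ r * ?M k l $ s)"
      unfolding sign_sign by (auto simp: minus_one_power_iff)
    finally show ?thesis by (simp add: scomm_def lmul_diff lmul_sign)
  qed
  have M: "scomm ?M i j k l (Suc r) s - scomm ?M i j k l r (Suc s)
     = (-1) ^ ?s * (?M i l $ r * ?M k j $ s - ?M i l $ s * ?M k j $ r)"
    using yang_rel_minv[OF assms] unfolding yang_rel_alt by simp
  have e: "pidx k + pidx j + (pidx i + pidx l) = ?d" by simp
  have F: "lfam T k j $ r * lfam T i l $ s - lfam T k j $ s * lfam T i l $ r
     = (-1) ^ ?h * (lmul ?d (?M i l $ s * ?M k j $ r) - lmul ?d (?M i l $ r * ?M k j $ s))"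
    unfolding lfam_def fps_nth_Abs_fps lmul_mult e by (simp add: right_diff_distrib)
  have s: "(-1) ^ (?t + ?h) = ((-1) ^ ?s :: 'a endo)"
    by (rule sign_cong, cases i; cases j; cases k; cases l; simp)
  show "scomm (lfam T) i j k l (Suc r) s - scomm (lfam T) i j k l r (Suc s)
      = (-1) ^ (0 + pidx i * pidx j + pidx i * pidx k + pidx j * pidx k)
        * (lfam T k j $ r * lfam T i l $ s - lfam T k j $ s * lfam T i l $ r)"
    unfolding F add_0 sign_sign s unfolding c
  proof -
    have "- lmul ?d (scomm ?M i j k l (Suc r) s) - - lmul ?d (scomm ?M i j k l r (Suc s))
      = - lmul ?d (scomm ?M i j k l (Suc r) s - scomm ?M i j k l r (Suc s))"
      by (simp add: lmul_diff)
    also have "\<dots> = (-1) ^ ?s * (lmul ?d (?M i l $ s * ?M k j $ r) - lmul ?d (?M i l $ r * ?M k j $ s))"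
      unfolding M lmul_sign lmul_diff by (simp add: right_diff_distrib)
    finally show "- lmul ?d (scomm ?M i j k l (Suc r) s) - - lmul ?d (scomm ?M i j k l r (Suc s))
      = (-1) ^ ?s * (lmul ?d (?M i l $ s * ?M k j $ r) - lmul ?d (?M i l $ r * ?M k j $ s))" .
  qed
qed

lemma scommute_lfam_rfam: "scommute (lfam T) (rfam T)"
  by (simp add: scommute_def lfam_def rfam_def rmul_lmul)

lemma minv_rfam: "unital T \<Longrightarrow> minv (rfam T) i j = rfam (minv T) i j"
proof (rule minv_unique[OF unital_rfam], assumption, rule fps_ext)
  fix i j n
  assume T: "unital T"
  have "rmul (pidx i + pidx k) x * rmul (pidx k + pidx j) y = rmul (pidx i + pidx j) (x * y)" for k x and y :: 'a
    unfolding rmul_mult by (rule rmul_cong) (simp add: algebra_simps)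
  then have "(\<Sum>k\<in>UNIV. rfam T i k * rfam (minv T) k j) $ n
     = rmul (pidx i + pidx j) ((\<Sum>k\<in>UNIV. T i k * minv T k j) $ n)"
    by (simp add: fps_sum_nth fps_mult_nth rfam_def rmul_sum)
  also have "\<dots> = (if i = j then 1 else 0) $ n"
    unfolding minv_right[OF T]
    by (cases i; cases j; cases n) (simp_all add: rmul_zero rmul_one rmul_cong[of 2 0])
  finally show "(\<Sum>k\<in>UNIV. rfam T i k * rfam (minv T) k j) $ n = (if i = j then 1 else 0) $ n" .
qed

lemma dual_rfam_11:
  assumes "unital T"
  shows "dual (rfam T) I1 I1 $ r = rmul 0 (dual T I1 I1 $ r)"
  by (simp add: dual_def minv_rfam[OF assms] rfam_def rmul_cong[of "Suc (Suc 0)" 0])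

definition rser :: "'r::ring_1 fps \<Rightarrow> 'r endo fps" where
  "rser A = Abs_fps (\<lambda>n. rmul 0 (A $ n))"

lemma rser_mult: "rser (A * B) = rser A * rser B"
  by (rule fps_ext) (simp add: rser_def fps_mult_nth rmul_sum rmul_mult)

lemma rser_shift: "rser (shift a A) = shift a (rser A)"
proof (rule fps_ext)
  fix n
  have "rmul 0 (of_nat c * x) = of_nat c * rmul 0 x" for c and x :: 'a
    using rmul_mult[of 0 "of_nat c" 0 x] by (simp add: rmul_of_nat)
  then show "rser (shift a A) $ n = shift a (rser A) $ n"
    by (simp add: rser_def shift_def rmul_sum del: of_nat_mult)
qed

lemma rser_one: "rser 1 = 1"
  by (rule fps_ext) (simp add: rser_def rmul_one rmul_zero)

lemma bprod_rser:
  assumes "\<And>r. S I1 I1 $ r = rmul 0 (T I1 I1 $ r)"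
  shows "bprod S n = rser (bprod T n)"
proof (induction n)
  case (Suc n)
  have "S I1 I1 = rser (T I1 I1)" by (rule fps_ext) (simp add: rser_def assms)
  then show ?case using Suc by (simp add: sh_def rser_mult rser_shift)
qed (simp add: rser_one)

abbreviation unit_vec :: "'r::ring_1 \<times> 'r" where "unit_vec \<equiv> (1, 0)"

text \<open>The operator form of \<open>m (S \<otimes> 1) \<Delta> = \<epsilon>\<close> for a series
  of counit 1: acting on the unit, it returns the unit.\<close>

definition kills :: "'r::ring_1 endo fps \<Rightarrow> bool" where
  "kills S \<longleftrightarrow> S $ 0 = 1 \<and> (\<forall>n>0. Rep_endo (S $ n) unit_vec = 0)"

text \<open>The left factor meets the unit first: a coefficient of positive degree kills it, and the
  constant coefficient hands it on to the right factor.\<close>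

lemma kills_mult: "kills S \<Longrightarrow> kills S' \<Longrightarrow> kills (S * S')"
  unfolding kills_def
proof (intro conjI allI impI)
  assume H: "S $ 0 = 1 \<and> (\<forall>n>0. Rep_endo (S $ n) unit_vec = 0)"
    "S' $ 0 = 1 \<and> (\<forall>n>0. Rep_endo (S' $ n) unit_vec = 0)"
  then show "(S * S') $ 0 = 1" by simp
  fix n :: nat
  assume n: "n > 0"
  have "Rep_endo (S $ i * S' $ (n - i)) unit_vec = 0" for i
    using H n by (cases "i = 0") (auto simp: app_simps app_zero)
  then show "Rep_endo ((S * S') $ n) unit_vec = 0"
    by (simp add: fps_mult_nth app_sum)
qed

lemma app_of_nat_mult: "Rep_endo f z = 0 \<Longrightarrow> Rep_endo (of_nat n * f) z = 0"
  by (induction n) (simp_all add: app_simps distrib_right)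

lemma kills_shift: "kills S \<Longrightarrow> kills (shift a S)"
  by (auto simp: kills_def shift_def app_sum app_of_nat_mult simp del: of_nat_mult intro!: sum.neutral)

lemma kills_bprod: "kills (T I1 I1) \<Longrightarrow> kills (bprod T n)"
  by (induction n) (auto simp: sh_def intro!: kills_mult kills_shift, simp add: kills_def app_simps)

text \<open>On the unit, left multiplication by \<open>S(t_{i,k})\<close> followed by right
  multiplication by \<open>t_{k,j}\<close> meets no sign, and summing over \<open>k\<close> gives an
  entry of the inverse matrix times \<open>T\<close>.\<close>

lemma mprod_lfam_rfam_kills:
  assumes T: "unital T" and n: "n > 0"
  shows "Rep_endo (mprod (lfam T) (rfam T) i j $ n) unit_vec = 0"
proof -
  have "Rep_endo (lmul (pidx i + pidx k) x * rmul (pidx k + pidx j) y) unit_vec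
     = Rep_endo (rmul (pidx i + pidx j) (x * y)) unit_vec" for k x and y :: 'a
    by (cases i; cases j; cases k) (simp_all add: app_simps lmul.rep_eq rmul.rep_eq)
  then have "Rep_endo (mprod (lfam T) (rfam T) i j $ n) unit_vec
     = Rep_endo (rmul (pidx i + pidx j) ((\<Sum>k\<in>UNIV. minv T i k * T k j) $ n)) unit_vec"
    by (simp add: mprod_def fps_sum_nth fps_mult_nth lfam_def rfam_def rmul_sum app_sum)
  also have "(\<Sum>k\<in>UNIV. minv T i k * T k j) = (if i = j then 1 else 0)"
    using mat_inverses_minv[OF T] by (simp add: mat_inverses_def)
  finally show ?thesis using n by (simp add: rmul_zero app_simps)
qed

text \<open>Every summand in the recursion for the inverse begins with a coefficient of
  \<open>C\<close> of positive degree, and this one acts first.\<close>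

lemma minv_kills:
  assumes C: "\<And>i j n. n > 0 \<Longrightarrow> Rep_endo (C i j $ n) unit_vec = 0" and n: "n > 0"
  shows "Rep_endo (minv C i j $ n) unit_vec = 0"
  using n unfolding minv_def fps_nth_Abs_fps
  by (subst mat_inv_coeff.simps) (simp add: app_simps app_sum C app_zero)

lemma lfam_rfam_bprod_kills:
  fixes T :: "idx \<Rightarrow> idx \<Rightarrow> 'r::ring_1 fps"
  assumes T: "unital T"
  defines "C \<equiv> mprod (lfam T) (rfam T)"
  shows "kills (bprod C p)" and "kills (bprod (dual C) p)"
proof -
  have u: "unital C" unfolding C_def by (intro unital_mprod unital_lfam unital_rfam T)
  have k: "n > 0 \<Longrightarrow> Rep_endo (C i j $ n) unit_vec = 0" for i j n
    unfolding C_def by (rule mprod_lfam_rfam_kills[OF T])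
  show "kills (bprod C p)"
    by (rule kills_bprod) (use u k in \<open>simp add: kills_def unital_def\<close>)
  show "kills (bprod (dual C) p)"
  proof (rule kills_bprod)
    have "Rep_endo (minv C I2 I2 $ n) unit_vec = 0" if "n > 0" for n
      using k that by (rule minv_kills)
    then show "kills (dual C I1 I1)"
      using unital_minv[of C] by (simp add: kills_def unital_def dual_def)
  qed
qed

lemma bprod_coeff_commI:
  assumes "\<And>r. x * T I1 I1 $ r = T I1 I1 $ r * x"
  shows "x * bprod T n $ m = bprod T n $ m * x"
proof (rule coeff_commI, rule bprod_commI)
  fix a
  show "fps_const x * sh T a I1 I1 = sh T a I1 I1 * fps_const x"
    using shift_scommute[of "fps_const x" "T I1 I1" 0 0 a] assms by (simp add: sh_def)
qed

section \<open>Uniform treatment of \<open>b_1\<close> and \<open>b_2\<close>\<close>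

definition side :: "bool \<Rightarrow> (idx \<Rightarrow> idx \<Rightarrow> 'r::ring_1 fps) \<Rightarrow> idx \<Rightarrow> idx \<Rightarrow> 'r fps" where
  "side c T = (if c then T else dual T)"

lemma unital_side: "unital T \<Longrightarrow> unital (side c T)"
  by (simp add: side_def unital_dual)

lemma yang_side: "unital T \<Longrightarrow> yang_rel 0 T \<Longrightarrow> yang_rel 0 (side c T)"
  by (simp add: side_def yang_rel_dual)

text \<open>Dualising reverses the legs; their order is restored because the diagonal entries are
  even and commute.\<close>

lemma bprod_side_mprod:
  fixes A B :: "idx \<Rightarrow> idx \<Rightarrow> 'r::ring_1 fps"
  assumes A: "unital A" "yang_rel 0 A" and B: "unital B" "yang_rel 0 B" and sc: "scommute A B"
    and p: "of_nat p = (0 :: 'r)" "odd p"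
  shows "bprod (side c (mprod A B)) p = bprod (side c A) p * bprod (side c B) p"
proof (cases c)
  case True
  then show ?thesis by (simp add: side_def bprod_mprod[OF A B sc p])
next
  case False
  have sd: "scommute (dual B) (dual A)" by (rule scommute_dual[OF A(1) B(1) sc])
  have "bprod (dual (mprod A B)) p = bprod (dual B) p * bprod (dual A) p"
    unfolding dual_mprod[OF A(1) B(1)]
    by (rule bprod_mprod[OF unital_dual yang_rel_dual[OF B] unital_dual yang_rel_dual[OF A] sd p])
  also have "\<dots> = bprod (dual A) p * bprod (dual B) p"
  proof (rule bprod_commI[symmetric], rule bprod_commI[symmetric])
    show "sh (dual B) b I1 I1 * sh (dual A) a I1 I1 = sh (dual A) a I1 I1 * sh (dual B) b I1 I1" for a b
      using sh_scommute[OF sd, of a I1 I1 b I1 I1] by simp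
  qed
  finally show ?thesis using False by (simp add: side_def)
qed

text \<open>The identity \<open>m (S \<otimes> 1) \<Delta> = \<epsilon>\<close> for the group-like series \<open>b_1\<close> and \<open>b_2\<close>.\<close>

lemma antipode_convolution:
  fixes T :: "idx \<Rightarrow> idx \<Rightarrow> 'r::ring_1 fps"
  assumes T: "unital T" "yang_rel 0 T" and p: "of_nat p = (0 :: 'r)" "odd p" and n: "n > 0"
  shows "(\<Sum>m=0..n. Rep_endo (bprod (side c (lfam T)) p $ m * rmul 0 (bprod (side c T) p $ (n - m))) unit_vec) = 0"
proof -
  let ?A = "lfam T" and ?B = "rfam T"
  note A = unital_lfam[of T] yang_lfam[OF T] and B = unital_rfam[OF T(1)] yang_rfam[OF T(2)]
  have pe: "of_nat p = (0 :: 'r endo)"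
    using rmul_of_nat[of p, where ?'a = 'r] p(1) by (simp add: rmul_zero)
  have "side c ?B I1 I1 $ r = rmul 0 (side c T I1 I1 $ r)" for r
    by (simp add: side_def dual_rfam_11[OF T(1)]) (simp add: rfam_def)
  then have "bprod (side c ?B) p = rser (bprod (side c T) p)" by (rule bprod_rser)
  then have "bprod (side c (mprod ?A ?B)) p = bprod (side c ?A) p * rser (bprod (side c T) p)"
    using bprod_side_mprod[OF A B scommute_lfam_rfam pe p(2)] by simp
  moreover have "kills (bprod (side c (mprod ?A ?B)) p)"
    using lfam_rfam_bprod_kills[OF T(1)] by (simp add: side_def)
  ultimately have "Rep_endo ((bprod (side c ?A) p * rser (bprod (side c T) p)) $ n) unit_vec = 0"
    using n by (simp add: kills_def)
  then show ?thesis by (simp add: fps_mult_nth app_sum rser_def)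
qed

text \<open>The product is built from a diagonal entry, which is even, so the sign is trivial for
  every parity \<open>q\<close>.\<close>

lemma bprod_side_supercomm:
  assumes T: "unital T" and c: "\<And>i j r. x * T i j $ r = (-1) ^ (q * (pidx i + pidx j)) * (T i j $ r * x)"
  shows "x * bprod (side c T) p $ n = bprod (side c T) p $ n * x"
  by (rule bprod_coeff_commI)
    (use c[of I1 I1] supercommute_minv[OF T c, of I2 I2] in \<open>simp add: side_def dual_def minus_one_power_iff\<close>)

lemma rmul_comm_bprod_lfam:
  fixes T :: "idx \<Rightarrow> idx \<Rightarrow> 'r::ring_1 fps"
  shows "rmul d y * bprod (side c (lfam T)) p $ n = bprod (side c (lfam T)) p $ n * rmul d y"
  by (rule bprod_side_supercomm[OF unital_lfam, of _ _ d]) (simp add: lfam_def rmul_lmul mult.commute)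

lemma bprod_side_central:
  fixes T :: "idx \<Rightarrow> idx \<Rightarrow> 'r::ring_1 fps"
  assumes T: "unital T" "yang_rel 0 T" and p: "of_nat p = (0 :: 'r)" "p > 0"
  shows "T i j $ r * bprod (side c T) p $ n = bprod (side c T) p $ n * T i j $ r"
  using bprod_central[OF assms] dual_bprod_central[OF assms] by (simp add: side_def)

section \<open>The ideal and the counit\<close>

definition bser :: "bool \<Rightarrow> nat \<Rightarrow> (ygen,'k::field) ser" where
  "bser c p = (if c then b1 p else b2 p)"

lemma fs_bser [simp]: "fs (bser c p n)"
  by (auto simp: bser_def intro: sfs_b[unfolded sfs_def, rule_format])

lemma (in scalars) hm_bser:
  assumes "yang_rel 0 (tm \<phi>)"
  shows "hm \<phi> (bser c p n) = bprod (side c (tm \<phi>)) p $ n"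
  using hs_b1[OF assms, of p] hs_b2[OF assms, of p]
  by (auto simp: bser_def side_def hs_def fps_eq_iff)

lemma bgens_eq: "bgens p = {bser c p (r * p) | c r. 0 < r}"
  unfolding bgens_def bser_def by (auto split: if_splits)

lemma fs_yker: "x \<in> yker \<Longrightarrow> fs (x :: (ygen,'k::field) fa)"
  unfolding yker_def using fa_ideal_fs fs_yrels by blast

lemma fs_Ip: "x \<in> Ip_lift p \<Longrightarrow> fs (x :: (ygen,'k::field) fa)"
  by (induction rule: Ip_lift.induct) (auto simp: fs_yker bgens_eq)

lemma Ip_word_left: "x \<in> Ip_lift p \<Longrightarrow> fa_mul (fa_word u) x \<in> Ip_lift p"
proof (induction rule: Ip_lift.induct)
  case (ip_ker x)
  then show ?case by (intro Ip_lift.ip_ker) (simp add: yker_def fa_ideal_word_left)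
next
  case (ip_gen b v)
  then show ?case using Ip_lift.ip_gen[of b p "u @ v"] by (simp add: fa_mul_assoc flip: fa_mul_word_word)
qed (simp_all add: fa_mul_add_right fa_mul_smult_right Ip_lift.intros)

lemma Ip_zero: "fa_zero \<in> Ip_lift p"
  by (rule Ip_lift.ip_ker) (simp add: yker_def fa_ideal.fi_zero)

lemma Ip_mul_left: "fs f \<Longrightarrow> x \<in> Ip_lift p \<Longrightarrow> fa_mul f x \<in> Ip_lift p"
  by (induction f rule: fs_induct)
    (simp_all add: Ip_zero fa_mul_add_left fa_mul_smult_left Ip_lift.ip_add Ip_lift.ip_smult Ip_word_left)

lemma Ip_sum: "finite A \<Longrightarrow> (\<And>a. a \<in> A \<Longrightarrow> F a \<in> Ip_lift p) \<Longrightarrow> fa_sum F A \<in> Ip_lift p"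
  by (induction A rule: finite_induct) (simp_all add: Ip_zero fa_sum_insert Ip_lift.ip_add)

lemma hl_zero: "hl fa_zero = 0"
  and hl_one: "hl fa_one = 1"
  and hl_add: "fs f \<Longrightarrow> fs g \<Longrightarrow> hl (fa_add f g) = hl f + hl g"
  and hl_neg: "fs f \<Longrightarrow> hl (fa_neg f) = - hl f"
  and hl_sub: "fs f \<Longrightarrow> fs g \<Longrightarrow> hl (fa_sub f g) = hl f - hl g"
  and hl_smult: "fs f \<Longrightarrow> hl (fa_smult c f) = tsc c * hl f"
  and hl_mul: "fs f \<Longrightarrow> fs g \<Longrightarrow> hl (fa_mul f g) = hl f * hl g"
  and hl_sum: "finite A \<Longrightarrow> (\<And>a. a \<in> A \<Longrightarrow> fs (F a)) \<Longrightarrow> hl (fa_sum F A) = (\<Sum>a\<in>A. hl (F a))"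
  and hl_word: "hl (fa_word w) = prod_list (map (\<lambda>g. tg (Inl g)) w)"
  unfolding hl_def by (simp_all add: tq.hm_zero tq.hm_one tq.hm_add tq.hm_neg tq.hm_sub tq.hm_smult
      tq.hm_mul tq.hm_sum tq.hm_word)

text \<open>\<open>Ip_lift\<close> contains \<open>yker\<close>, so membership depends only on the
  class in \<open>Y\<close>, which \<open>hl\<close> detects.\<close>

lemma Ip_hl_eq:
  assumes "fs x" "y \<in> Ip_lift p" "hl x = hl (y :: (ygen,'k::field) fa)"
  shows "x \<in> Ip_lift p"
proof -
  have y: "fs y" using assms(2) by (rule fs_Ip)
  have "fa_sub x y \<in> yker"
    using assms y by (simp add: hl_sub flip: hl_kernel)
  then have "fa_add (fa_sub x y) y \<in> Ip_lift p"
    by (rule Ip_lift.ip_add[OF Ip_lift.ip_ker assms(2)])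
  moreover have "fa_add (fa_sub x y) y = x" by (simp add: fa_defs)
  ultimately show ?thesis by simp
qed

lemma hl_bser: "hl (bser c p n) = bprod (side c tL) p $ n"
  and hr_bser: "hr (bser c p n) = bprod (side c tR) p $ n"
  using tq.hm_bser[of "\<lambda>g. tg (Inl g)"] tq.hm_bser[of "\<lambda>g. tg (Inr g)"] yang_tLR
  by (simp_all add: hl_def hr_def tL_def tR_def)

lemma tL_Suc: "tL i j $ Suc n = tg (Inl (Tg i j n))" and tR_Suc: "tR i j $ Suc n = tg (Inr (Tg i j n))"
  by (simp_all add: tL_def tR_def tq.tm_nth)

context
  fixes p :: nat
  assumes p: "prime p" "odd p" and char: "of_nat p = (0 :: 'k::field)"
begin

lemma tens_char: "of_nat p = (0 :: 'k tens)"
  using tq.eta_of_nat[of p, where ?'a = 'k] char tq.eta_zero[where ?'a = 'k] by simp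

lemma p_pos: "p > 0" using p by (simp add: prime_gt_0_nat)

text \<open>Degrees other than the multiples of \<open>p\<close> follow from shift invariance, which
  holds only modulo the relations and is therefore used in the image of \<open>hl\<close>. Coproduct
  and antipode involve all degrees.\<close>

lemma bser_mem:
  assumes "n > 0"
  shows "(bser c p n :: (ygen,'k) fa) \<in> Ip_lift p"
proof -
  let ?I = "hl ` (Ip_lift p :: (ygen,'k) fa set)"
  let ?A = "bprod (side c tL) p :: 'k tens fps"
  have inv: "shift 1 ?A = ?A"
    by (rule bprod_shift_invariant[OF unital_side yang_side tens_char p_pos]) (rule unital_tLR yang_tLR)+
  have "?A $ n \<in> ?I"
  proof (rule shift_invariant_coeff_mem[OF inv p(1) tens_char _ _ _ _ assms])
    show "0 \<in> ?I" using hl_zero Ip_zero by (metis image_eqI)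
    fix x y assume x: "x \<in> ?I"
    then obtain f where f: "f \<in> Ip_lift p" "x = hl f" by blast
    have "hl (fa_neg f) = - x" using f fs_Ip[OF f(1)] by (simp add: hl_neg)
    moreover have "fa_neg f \<in> Ip_lift p" unfolding fa_neg_smult by (rule Ip_lift.ip_smult[OF f(1)])
    ultimately show "- x \<in> ?I" by (metis image_eqI)
    assume "y \<in> ?I"
    then obtain g where g: "g \<in> Ip_lift p" "y = hl g" by blast
    have "hl (fa_add f g) = x + y" using f g fs_Ip[OF f(1)] fs_Ip[OF g(1)] by (simp add: hl_add)
    moreover have "fa_add f g \<in> Ip_lift p" using f g by (intro Ip_lift.ip_add)
    ultimately show "x + y \<in> ?I" by (metis image_eqI)
  next
    fix r :: nat assume "r > 0"
    then have "bser c p (r * p) \<in> bgens p" unfolding bgens_eq by blast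
    from Ip_lift.ip_gen[OF this, of "[]"] have "(bser c p (r * p) :: (ygen,'k) fa) \<in> Ip_lift p"
      by (simp flip: fa_one_word)
    then show "?A $ (r * p) \<in> ?I" by (metis hl_bser image_eqI)
  qed
  then obtain y where y: "y \<in> Ip_lift p" "?A $ n = hl y" by blast
  show ?thesis by (rule Ip_hl_eq[OF fs_bser y(1)]) (simp add: hl_bser y(2))
qed

lemma bser_central_left: "hl (fa_word w) * bprod (side c tL) p $ n = bprod (side c tL) p $ n * (hl (fa_word w) :: 'k tens)"
proof (induction w)
  case (Cons g w)
  obtain i j m where g: "g = Tg i j m" by (cases g)
  have "tg (Inl g) * bprod (side c tL) p $ n = bprod (side c tL) p $ n * (tg (Inl g) :: 'k tens)"
    using bprod_side_central[OF unital_tLR(1) yang_tLR(1) tens_char p_pos, of i j "Suc m" c n]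
    by (simp add: g tL_Suc)
  from mult_comm_induct[OF this[symmetric] Cons[symmetric]] show ?case by (simp only: hl_word list.map prod_list.Cons)
qed (simp add: hl_word)

text \<open>The definition gives a left ideal; it is two-sided because the generators are central
  modulo \<open>yker\<close>.\<close>

lemma Ip_word_right:
  assumes "x \<in> (Ip_lift p :: (ygen,'k) fa set)"
  shows "fa_mul x (fa_word u) \<in> Ip_lift p"
  using assms
proof (induction rule: Ip_lift.induct)
  case (ip_ker x)
  then show ?case by (intro Ip_lift.ip_ker) (simp add: yker_def fa_ideal_word_right)
next
  case (ip_gen b v)
  then obtain c r where b: "b = bser c p (r * p)" unfolding bgens_eq by blast
  show ?case
  proof (rule Ip_hl_eq)
    show "fa_mul (fa_word (v @ u)) b \<in> Ip_lift p" using ip_gen by (rule Ip_lift.ip_gen)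
    show "fs (fa_mul (fa_mul (fa_word v) b) (fa_word u))" by (simp add: b)
    show "hl (fa_mul (fa_mul (fa_word v) b) (fa_word u)) = hl (fa_mul (fa_word (v @ u)) b)"
      unfolding b by (simp add: hl_mul hl_bser mult.assoc bser_central_left[symmetric] flip: fa_mul_word_word)
  qed
qed (simp_all add: fa_mul_add_left fa_mul_smult_left Ip_lift.intros)

lemma Ip_mul_right: "fs f \<Longrightarrow> x \<in> (Ip_lift p :: (ygen,'k) fa set) \<Longrightarrow> fa_mul x f \<in> Ip_lift p"
  by (induction f rule: fs_induct)
    (simp_all add: Ip_zero fa_mul_add_right fa_mul_smult_right Ip_lift.ip_add Ip_lift.ip_smult Ip_word_right)

end

text \<open>The counit turns the generating matrix into the identity matrix, so the relevant
  diagonal entry and all its shifted products are 1.\<close>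

lemma base_counit_bser: "n > 0 \<Longrightarrow> base.hm (\<lambda>g. 0) (bser c p n :: (ygen,'k::field) fa) = 0"
proof -
  assume n: "n > 0"
  let ?T = "base.tm (\<lambda>g. 0 :: 'k)"
  have T: "?T i j = (if i = j then 1 else 0)" for i j
    by (rule fps_ext) (simp add: base.tm_nth)
  have Y: "yang_rel 0 ?T" by (simp add: yang_rel_def scomm_def base.tm_nth)
  have "minv ?T i j = ?T i j" for i j
    by (rule minv_unique[OF base.unital_tm]) (simp add: T sum_idx, metis idx.exhaust)
  then have d: "side c ?T I1 I1 = 1" by (simp add: side_def dual_def T)
  have "bprod (side c ?T) m = 1" for m
    by (induction m) (simp_all add: sh_def d)
  then show ?thesis using n by (simp add: base.hm_bser[OF Y])
qed

lemma counit_hm: "counit = base.hm (\<lambda>g. 0)"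
proof -
  have "counit_gen = (\<lambda>g. 0 :: 'a)"
    by (auto simp: counit_gen_def fun_eq_iff split: ygen.split)
  then show ?thesis
    by (intro ext) (simp only: counit_def fa_khom_def base.hm_def base.lin_def)
qed

lemma counit_Ip:
  assumes "prime p" and "x \<in> (Ip_lift p :: (ygen,'k::field) fa set)"
  shows "counit x = 0"
  using assms(2) unfolding counit_hm
proof (induction rule: Ip_lift.induct)
  case (ip_ker x)
  then show ?case unfolding yker_def
    using base.hm_ideal[of yrels "\<lambda>g. 0"] fs_yrels base_counit_yrels by blast
next
  case (ip_gen b u)
  then obtain c r where b: "b = bser c p (r * p)" "r > 0" unfolding bgens_eq by blast
  then have "r * p > 0" using assms(1) by (simp add: prime_gt_0_nat)
  then show ?case by (simp add: b base.hm_mul base_counit_bser)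
next
  case (ip_add x y)
  then show ?case by (simp add: base.hm_add fs_Ip)
next
  case (ip_smult x c)
  then show ?case by (simp add: base.hm_smult fs_Ip)
qed

section \<open>Comultiplication and antipode\<close>

lemma hr_word: "hr (fa_word w) = prod_list (map (\<lambda>g. tg (Inr g)) w)"
  and hr_mul: "fs f \<Longrightarrow> fs g \<Longrightarrow> hr (fa_mul f g) = hr f * hr g"
  by (simp_all add: hr_def tq.hm_word tq.hm_mul)

lemma fs_comult_gen: "fs (comult_gen g)"
  by (cases g) (auto simp: comult_gen_def intro!: fs_sum fs_mul fs_inl fs_inr)

lemma fs_comult: "fs x \<Longrightarrow> fs (comult x)"
  unfolding comult_def by (rule fs_hom) (simp_all add: fs_comult_gen)

lemma hm_comult: "fs x \<Longrightarrow> tq.hm tg (comult x) = tq.hm (\<lambda>g. tq.hm tg (comult_gen g)) x"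
  unfolding comult_def by (rule tq.hm_fa_hom) (simp_all add: fs_comult_gen)

lemma hm_pair: "fs x \<Longrightarrow> fs y \<Longrightarrow> tq.hm tg (fa_mul (inl_hom x) (inr_hom y)) = hl x * hr y"
  by (simp add: tq.hm_mul fs_inl fs_inr hl_inl hr_inr)

lemma hl_tc: "hl (tc i j r) = tL i j $ r" and hr_tc: "hr (tc i j r) = tR i j $ r"
  by (simp_all add: hl_def hr_def tL_def tR_def tq.hm_tc)

lemma tm_comult:
  "tq.tm (\<lambda>g. tq.hm tg (comult_gen g)) = (mprod tL tR :: idx \<Rightarrow> idx \<Rightarrow> 'k::field tens fps)"
proof (intro ext fps_ext)
  fix i j r
  have u: "unital (mprod tL tR :: idx \<Rightarrow> idx \<Rightarrow> 'k tens fps)"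
    by (rule unital_mprod[OF unital_tLR])
  show "tq.tm (\<lambda>g. tq.hm tg (comult_gen g)) i j $ r = (mprod tL tR i j :: 'k tens fps) $ r"
  proof (cases r)
    case 0
    then show ?thesis using u by (simp add: tq.tm_nth unital_def)
  next
    case (Suc n)
    have "(tq.hm tg (comult_gen (Tg i j n)) :: 'k tens) = (\<Sum>k\<in>UNIV. \<Sum>a\<le>Suc n. tL i k $ a * tR k j $ (Suc n - a))"
      unfolding comult_gen_def ygen.case
      by (subst tq.hm_sum, simp, simp add: fs_inl fs_inr, subst tq.hm_sum)
        (simp_all add: fs_inl fs_inr hm_pair hl_tc hr_tc)
    then show ?thesis using Suc
      by (simp add: tq.tm_nth mprod_def fps_sum_nth fps_mult_nth atLeast0AtMost)
  qed
qed

lemma yang_comult: "yang_rel 0 (mprod tL tR)"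
  by (rule yang_rel_mprod[OF unital_tLR yang_tLR scommute_tLR])

section \<open>The ideal \<open>I_p \<otimes> Y + Y \<otimes> I_p\<close> and the coproduct\<close>

lemma fs_tens_Ip: "x \<in> tens_Ip p \<Longrightarrow> fs (x :: (ygen2,'k::field) fa)"
  by (induction rule: tens_Ip.induct) (simp_all add: fs_tens_ideal fs_inl fs_inr fs_Ip)

lemma tens_Ip_hm_eq:
  assumes "fs x" "y \<in> tens_Ip p" "tq.hm tg x = tq.hm tg (y :: (ygen2,'k::field) fa)"
  shows "x \<in> tens_Ip p"
proof -
  have y: "fs y" using assms(2) by (rule fs_tens_Ip)
  have "fa_sub x y \<in> fa_ideal tens_rels"
    using assms y by (simp add: tq.hm_sub flip: tens_kernel)
  then have "fa_add (fa_sub x y) y \<in> tens_Ip p"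
    by (rule tens_Ip.ti_add[OF tens_Ip.ti_ker assms(2)])
  moreover have "fa_add (fa_sub x y) y = x" by (simp add: fa_defs)
  ultimately show ?thesis by simp
qed

lemma tens_Ip_zero: "fa_zero \<in> tens_Ip p"
  by (rule tens_Ip.ti_ker) (rule fa_ideal.fi_zero)

lemma tens_Ip_left: "fs y \<Longrightarrow> x \<in> Ip_lift p \<Longrightarrow> fa_mul (inl_hom x) (inr_hom y) \<in> tens_Ip p"
  unfolding inr_hom_def
  by (induction y rule: fs_induct)
    (simp_all add: fa_hom_zero fa_hom_add fa_hom_smult fa_mul_add_right fa_mul_smult_right tens_Ip_zero
      tens_Ip.ti_add tens_Ip.ti_smult tens_Ip.ti_left[unfolded inr_hom_def])

lemma tens_Ip_right: "fs y \<Longrightarrow> x \<in> Ip_lift p \<Longrightarrow> fa_mul (inl_hom y) (inr_hom x) \<in> tens_Ip p"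
  unfolding inl_hom_def
  by (induction y rule: fs_induct)
    (simp_all add: fa_hom_zero fa_hom_add fa_hom_smult fa_mul_add_left fa_mul_smult_left tens_Ip_zero
      tens_Ip.ti_add tens_Ip.ti_smult tens_Ip.ti_right[unfolded inl_hom_def])

lemma tens_Ip_sum: "finite A \<Longrightarrow> (\<And>a. a \<in> A \<Longrightarrow> F a \<in> tens_Ip p) \<Longrightarrow> fa_sum F A \<in> tens_Ip p"
  by (induction A rule: finite_induct) (simp_all add: tens_Ip_zero fa_sum_insert tens_Ip.ti_add)

lemma tg_hl_commute:
  "\<exists>c. tg (Inr h) * hl (fa_word w) = tsc c * (hl (fa_word w) * tg (Inr h) :: 'k::field tens)"
proof (induction w)
  case Nil
  show ?case by (rule exI[of _ 1]) (simp add: hl_word tq.eta_one)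
next
  case (Cons g w)
  then obtain c :: 'k where c: "tg (Inr h) * hl (fa_word w) = tsc c * (hl (fa_word w) * tg (Inr h))" by blast
  let ?s = "Defs.sgn (ypar g * ypar h) :: 'k"
  have "(tg (Inr h) * hl (fa_word (g # w)) :: 'k tens) = tg (Inr h) * tg (Inl g) * hl (fa_word w)"
    by (simp add: hl_word mult.assoc)
  also have "\<dots> = tsc ?s * (tg (Inl g) * (tg (Inr h) * hl (fa_word w)))"
    unfolding tg_commute tq.eta_sgn by (simp add: mult.assoc)
  also have "\<dots> = tsc ?s * (tsc c * (tg (Inl g) * (hl (fa_word w) * tg (Inr h))))"
    unfolding c by (simp only: tq.eta_left_commute[of "tg (Inl g)"])
  also have "\<dots> = tsc (?s * c) * (hl (fa_word (g # w)) * tg (Inr h))"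
    by (simp add: hl_word tq.eta_mult mult.assoc)
  finally show ?case by blast
qed

text \<open>Left and right letters supercommute, so every word can be sorted up to a scalar. This is
  needed because \<open>tens_Ip\<close> is spanned by pure tensors modulo relations, with no closure
  under multiplication built in.\<close>

lemma tens_word_normal:
  "\<exists>c w1 w2. tq.hm tg (fa_word v) = tsc c * (hl (fa_word w1) * hr (fa_word w2) :: 'k::field tens)"
proof (induction v)
  case Nil
  show ?case by (rule exI[of _ 1], rule exI[of _ "[]"], rule exI[of _ "[]"]) (simp add: hl_word hr_word tq.hm_word tq.eta_one)
next
  case (Cons x v)
  then obtain c :: 'k and w1 w2 where IH: "tq.hm tg (fa_word v) = tsc c * (hl (fa_word w1) * hr (fa_word w2))" by blast
  have hd: "tq.hm tg (fa_word (x # v) :: (ygen2,'k) fa) = tsc c * (tg x * (hl (fa_word w1) * hr (fa_word w2)))"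
    using IH by (simp add: tq.hm_word tq.eta_left_commute)
  show ?case
  proof (cases x)
    case (Inl g)
    then have "tq.hm tg (fa_word (x # v) :: (ygen2,'k) fa) = tsc c * (hl (fa_word (g # w1)) * hr (fa_word w2))"
      using hd by (simp add: hl_word mult.assoc)
    then show ?thesis by blast
  next
    case (Inr h)
    obtain e :: 'k where e: "tg (Inr h) * hl (fa_word w1) = tsc e * (hl (fa_word w1) * tg (Inr h))"
      using tg_hl_commute by blast
    have "(tg x * (hl (fa_word w1) * hr (fa_word w2)) :: 'k tens) = (tg (Inr h) * hl (fa_word w1)) * hr (fa_word w2)"
      by (simp add: Inr mult.assoc)
    also have "\<dots> = tsc e * (hl (fa_word w1) * hr (fa_word (h # w2)))"
      unfolding e by (simp add: hr_word mult.assoc)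
    finally have "tq.hm tg (fa_word (x # v) :: (ygen2,'k) fa) = tsc (c * e) * (hl (fa_word w1) * hr (fa_word (h # w2)))"
      unfolding hd by (simp only: tq.eta_mult mult.assoc)
    then show ?thesis by blast
  qed
qed

lemma hr_bprod_left_commute:
  "hr (fa_word w) * bprod (side c tL) p $ n = bprod (side c tL) p $ n * (hr (fa_word w) :: 'k::field tens)"
proof (induction w)
  case (Cons g w)
  obtain i j m where g: "g = Tg i j m" by (cases g)
  have "(tR i j $ Suc m :: 'k tens) * tL k l $ r = (-1) ^ cross_deg i j k l * (tL k l $ r * tR i j $ Suc m)" for k l r
    using scommute_tLR[unfolded scommute_def, rule_format, of i j "Suc m" k l r]
    by (simp add: mult.commute[of "pidx i + pidx j"])
  from bprod_side_supercomm[OF unital_tLR(1) this]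
  have "(tg (Inr g) :: 'k tens) * bprod (side c tL) p $ n = bprod (side c tL) p $ n * tg (Inr g)"
    by (simp only: g tR_Suc)
  from mult_comm_induct[OF this[symmetric] Cons[symmetric]] show ?case by (simp only: hr_word list.map prod_list.Cons)
qed (simp add: hr_word)

context
  fixes p :: nat
  assumes p: "prime p" "odd p" and char: "of_nat p = (0 :: 'k::field)"
begin

text \<open>Each summand of the coproduct of a coefficient of degree \<open>n > 0\<close> has
  positive degree in at least one leg. The factor \<open>f\<close>, later the coproduct of a word,
  is sorted into pure tensors and absorbed leg by leg.\<close>

lemma comult_term_mem:
  fixes f :: "(ygen2,'k) fa"
  assumes "fs f" and n: "n > 0"
  shows "\<exists>y\<in>tens_Ip p. tq.hm tg y = tq.hm tg f * (\<Sum>m\<le>n. bprod (side c tL) p $ m * bprod (side c tR) p $ (n - m))"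
  using assms(1)
proof (induction f rule: fs_induct)
  case zero
  show ?case by (rule bexI[OF _ tens_Ip_zero]) (simp add: tq.hm_zero)
next
  case (add a v f)
  let ?S = "\<Sum>m\<le>n. bprod (side c tL) p $ m * bprod (side c tR) p $ (n - m) :: 'k tens"
  obtain y where y: "y \<in> tens_Ip p" "tq.hm tg y = tq.hm tg f * ?S" using add.IH by (rule bexE)
  obtain e w1 w2 where nf: "tq.hm tg (fa_word v :: (ygen2,'k) fa) = tsc e * (hl (fa_word w1) * hr (fa_word w2))"
    using tens_word_normal by blast
  let ?F = "\<lambda>m. fa_mul (inl_hom (fa_mul (fa_word w1) (bser c p m))) (inr_hom (fa_mul (fa_word w2) (bser c p (n - m)))) :: (ygen2,'k) fa"
  have F: "?F m \<in> tens_Ip p" for m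
  proof (cases "m > 0")
    case True
    then show ?thesis by (intro tens_Ip_left Ip_word_left bser_mem[OF p char]) simp_all
  next
    case False
    then show ?thesis using n by (intro tens_Ip_right Ip_word_left bser_mem[OF p char]) simp_all
  qed
  \<comment> \<open>The right word passes the coefficient in the left leg without sign, since that
    coefficient is even.\<close>
  have hF: "tq.hm tg (?F m) = hl (fa_word w1) * hr (fa_word w2) * (bprod (side c tL) p $ m * bprod (side c tR) p $ (n - m))" for m
  proof -
    have "tq.hm tg (?F m) = hl (fa_word w1) * (bprod (side c tL) p $ m * hr (fa_word w2)) * bprod (side c tR) p $ (n - m)"
      by (simp add: hm_pair hl_mul hr_mul hl_bser hr_bser mult.assoc)
    then show ?thesis by (simp only: hr_bprod_left_commute[symmetric] mult.assoc)
  qed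
  have fsF: "fs (?F m)" for m using F by (rule fs_tens_Ip)
  let ?y = "fa_add (fa_smult a (fa_smult e (fa_sum ?F {..n}))) y"
  have mem: "?y \<in> tens_Ip p"
    by (intro tens_Ip.ti_add tens_Ip.ti_smult tens_Ip_sum F y(1)) simp
  have eqn: "tq.hm tg ?y = tq.hm tg (fa_add (fa_smult a (fa_word v)) f) * ?S"
  proof -
    have sumF: "tq.hm tg (fa_sum ?F {..n}) = hl (fa_word w1) * hr (fa_word w2) * ?S"
      by (simp only: tq.hm_sum finite_atMost fsF hF sum_distrib_left)
    have "tq.hm tg ?y = tsc a * (tsc e * tq.hm tg (fa_sum ?F {..n})) + tq.hm tg y"
      using fs_tens_Ip[OF y(1)] fsF by (simp only: tq.hm_add tq.hm_smult fs_smult fs_sum finite_atMost)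
    also have "\<dots> = tsc a * (tq.hm tg (fa_word v) * ?S) + tq.hm tg f * ?S"
      unfolding sumF nf y(2) by (simp only: mult.assoc)
    also have "\<dots> = tq.hm tg (fa_add (fa_smult a (fa_word v)) f) * ?S"
      using add.hyps by (simp only: tq.hm_add tq.hm_smult fs_smult fs_word distrib_right mult.assoc)
    finally show ?thesis .
  qed
  show ?case by (rule bexI[where x = ?y]) (rule eqn, rule mem)
qed

lemma comult_Ip:
  assumes "x \<in> (Ip_lift p :: (ygen,'k) fa set)"
  shows "comult x \<in> tens_Ip p"
  using assms
proof (induction rule: Ip_lift.induct)
  case (ip_ker x)
  have fsx: "fs x" using ip_ker by (rule fs_yker)
  let ?\<phi> = "\<lambda>g. tq.hm tg (comult_gen g) :: 'k tens"
  have "\<forall>r\<in>yrels. tq.hm ?\<phi> r = 0"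
    unfolding tq.hm_yrels_iff tm_comult by (rule yang_comult)
  then have "fs r \<and> tq.hm ?\<phi> r = 0" if "r \<in> yrels" for r
    using that fs_yrels by (intro conjI) (simp_all only:)
  from conjunct2[OF tq.hm_ideal[OF this ip_ker[unfolded yker_def]]]
  have "tq.hm ?\<phi> x = 0" .
  then have "tq.hm tg (comult x) = 0" by (simp add: hm_comult[OF fsx])
  then show ?case
    by (intro tens_Ip.ti_ker iffD1[OF tens_kernel[OF fs_comult[OF fsx]]])
next
  case (ip_gen b u)
  then obtain c r where b: "b = bser c p (r * p)" "r > 0" unfolding bgens_eq by blast
  let ?n = "r * p"
  have n: "?n > 0" using b(2) p(1) by (simp add: prime_gt_0_nat)
  have "tq.hm tg (comult b) = bprod (side c (mprod tL tR)) p $ ?n"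
    using tq.hm_bser[of "\<lambda>g. tq.hm tg (comult_gen g)" c p ?n] yang_comult
    by (simp add: hm_comult b(1) tm_comult)
  also have "bprod (side c (mprod tL tR)) p = bprod (side c tL) p * (bprod (side c tR) p :: 'k tens fps)"
    by (rule bprod_side_mprod[OF unital_tLR(1) yang_tLR(1) unital_tLR(2) yang_tLR(2) scommute_tLR
          tens_char[OF p char] p(2)])
  finally have "tq.hm tg (comult b) = (\<Sum>m\<le>?n. bprod (side c tL) p $ m * bprod (side c tR) p $ (?n - m))"
    by (simp add: fps_mult_nth atLeast0AtMost)
  then have "tq.hm tg (comult (fa_mul (fa_word u) b)) = tq.hm tg (comult (fa_word u))
      * (\<Sum>m\<le>?n. bprod (side c tL) p $ m * bprod (side c tR) p $ (?n - m))"
    by (simp add: hm_comult tq.hm_mul b(1))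
  moreover obtain y where y: "y \<in> tens_Ip p" "tq.hm tg y = tq.hm tg (comult (fa_word u :: (ygen,'k) fa))
      * (\<Sum>m\<le>?n. bprod (side c tL) p $ m * bprod (side c tR) p $ (?n - m))"
    using comult_term_mem[OF fs_comult[OF fs_word] n, of u c] by (rule bexE)
  ultimately show ?case
    by (intro tens_Ip_hm_eq[OF _ y(1)]) (simp_all only: y(2) fs_comult fs_mul fs_word fs_bser b(1))
next
  case (ip_add x y)
  then show ?case unfolding comult_def by (simp add: fa_hom_add fs_Ip tens_Ip.ti_add)
next
  case (ip_smult x c)
  then show ?case unfolding comult_def by (simp add: fa_hom_smult fs_Ip tens_Ip.ti_smult)
qed

end

section \<open>The antipode\<close>

lemma antipode_lin: "antipode f = (\<lambda>v. base.lin (\<lambda>w. word_sign w * fa_prod_list (rev (map antipode_gen w)) v) f)"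
  by (simp add: antipode_def base.lin_def mult.assoc)

lemma antipode_zero: "antipode fa_zero = fa_zero"
  and antipode_add: "fs f \<Longrightarrow> fs g \<Longrightarrow> antipode (fa_add f g) = fa_add (antipode f) (antipode g)"
  and antipode_smult: "fs f \<Longrightarrow> antipode (fa_smult c f) = fa_smult c (antipode f)"
  and antipode_word: "antipode (fa_word w) = fa_smult (word_sign w) (fa_prod_list (rev (map antipode_gen w)))"
  unfolding antipode_lin
  by (simp_all add: base.lin_zero base.lin_add base.lin_smult base.lin_word)
    (simp_all add: fa_add_def fa_smult_def fa_zero_def)

lemma fs_antipode_gen: "fs (antipode_gen g)"
  by (cases g) (simp add: antipode_gen_def)

lemma fs_antipode_word: "fs (fa_prod_list (rev (map antipode_gen w)))"
  by (rule fs_prod_list) (auto simp: fs_antipode_gen)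

lemma fs_antipode: "fs f \<Longrightarrow> fs (antipode f)"
  by (induction f rule: fs_induct)
    (simp_all add: antipode_zero antipode_add antipode_smult antipode_word fs_antipode_word)

text \<open>That these scalars commute with all operators is what the compatibility condition in the
  type \<open>endo\<close> provides.\<close>

interpretation es: scalars "\<lambda>c :: 'k::field. rmul 0 (tsc c)"
proof
  fix a b :: 'k and f :: "'k tens endo"
  show "rmul 0 (tsc (a + b)) = rmul 0 (tsc a) + rmul 0 (tsc b)" by (simp add: tq.eta_add rmul_add)
  show "rmul 0 (tsc (a * b)) = rmul 0 (tsc a) * rmul 0 (tsc b)" by (simp add: tq.eta_mult rmul_mult)
  show "rmul 0 (tsc 1 :: 'k tens) = 1" by (simp add: tq.eta_one rmul_one)
  have "central (tsc a)" by (simp add: central_def tq.eta_central)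
  moreover have "Rep_endo (rmul 0 (tsc a)) z = pscale (tsc a) z" for z
    by (simp add: rmul.rep_eq pscale_def tq.eta_central)
  ultimately show "rmul 0 (tsc a) * f = f * rmul 0 (tsc a)"
    by (intro endo_eqI) (simp only: app_simps app_pscale)
qed

text \<open>Left multiplication by the antipode of a generator; the operator of a word, applied to
  the unit, then computes the antipode of the word.\<close>

definition antipode_op :: "ygen \<Rightarrow> 'k::field tens endo" where
  "antipode_op g = (case g of Tg i j n \<Rightarrow> lmul (pidx i + pidx j) (minv tL i j $ Suc n))"

lemma hl_antipode_gen: "hl (antipode_gen (Tg i j n)) = minv tL i j $ Suc n"
  by (simp add: antipode_gen_def hl_def tL_def tq.hm_mat_inv)

lemma antipode_op_eq: "antipode_op g = lmul (ypar g) (hl (antipode_gen g))"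
  by (cases g) (simp add: antipode_op_def ypar_def hl_antipode_gen)

lemma tm_antipode_op: "es.tm antipode_op = (lfam tL :: idx \<Rightarrow> idx \<Rightarrow> 'k::field tens endo fps)"
proof (intro ext fps_ext)
  fix i j r
  show "es.tm antipode_op i j $ r = (lfam tL i j :: 'k tens endo fps) $ r"
    using unital_lfam[of "tL :: idx \<Rightarrow> idx \<Rightarrow> 'k tens fps"]
    by (cases r) (simp_all add: es.tm_nth unital_def antipode_op_def lfam_def)
qed

text \<open>Forgets the grading: for an element that is not homogeneous the two parities end up in
  different components, and the sum is its value in the ring.\<close>

definition esum :: "'r::ring_1 \<times> 'r \<Rightarrow> 'r" where "esum z = fst z + snd z"

lemma esum_add: "esum (x + y) = esum x + esum y"
  by (simp add: esum_def)

lemma esum_zero: "esum 0 = 0"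
  by (simp add: esum_def)

lemma esum_sum: "esum (\<Sum>a\<in>A. f a) = (\<Sum>a\<in>A. esum (f a))"
  by (induction A rule: infinite_finite_induct) (simp_all add: esum_zero esum_add)

lemma esum_rmul: "esum (Rep_endo (rmul d y) z) = esum z * y"
  by (simp add: esum_def rmul.rep_eq distrib_right add.commute)

lemma rmul_unit: "Rep_endo (rmul d y) unit_vec = (if even d then (y, 0) else (0, y))"
  by (simp add: rmul.rep_eq)

definition odd_letters :: "ygen list \<Rightarrow> nat" where
  "odd_letters w = length (filter (\<lambda>g. odd (ypar g)) w)"

lemma odd_letters_snoc: "odd_letters (w @ [g]) = odd_letters w + (if odd (ypar g) then 1 else 0)"
  by (simp add: odd_letters_def)

lemma word_sign_snoc: "tsc (word_sign (w @ [g])) =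
    (if odd (ypar g) then (-1) ^ odd_letters w else 1) * (tsc (word_sign w) :: 'k::field tens)"
proof -
  \<comment> \<open>The identity \<open>C(m + 1, 2) = m + C(m, 2)\<close>: a further odd letter
    passes the \<open>m\<close> odd letters before it.\<close>
  have half: "(m + 1) * (m + 1 - 1) div 2 = m + m * (m - 1) div 2" for m :: nat
  proof -
    have "(m + 1) * (m + 1 - 1) = m * (m - 1) + m * 2" by (cases m) simp_all
    then show ?thesis by simp
  qed
  have ws: "word_sign w = (Defs.sgn (odd_letters w * (odd_letters w - 1) div 2) :: 'k)" for w
    by (simp add: word_sign_def Let_def odd_letters_def)
  show ?thesis
  proof (cases "odd (ypar g)")
    case True
    then have "odd_letters (w @ [g]) = odd_letters w + 1" by (simp add: odd_letters_snoc)
    then show ?thesis using True by (simp only: ws half tq.eta_sgn power_add if_True simp_thms)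
  next
    case False
    then show ?thesis by (simp add: ws odd_letters_snoc)
  qed
qed

text \<open>A further letter multiplies by its antipode on the left, and the sign of
  \<open>lmul\<close> on the odd component is the increment of \<open>word_sign\<close>. The result
  sits in the component given by the parity of the word.\<close>

lemma antipode_op_word:
  "Rep_endo (prod_list (map antipode_op w)) unit_vec
    = Rep_endo (rmul (odd_letters w) (hl (antipode (fa_word w)) :: 'k::field tens)) unit_vec"
proof (induction w rule: rev_induct)
  case Nil
  show ?case
    by (simp add: app_simps antipode_word fa_prod_list_def word_sign_def odd_letters_def hl_smult hl_one tq.eta_sgn rmul_unit)
next
  case (snoc g w)
  let ?s = "hl (antipode_gen g) :: 'k tens" and ?P = "hl (fa_prod_list (rev (map antipode_gen w))) :: 'k tens"
  have w: "hl (antipode (fa_word w)) = tsc (word_sign w) * ?P"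
    by (simp add: antipode_word hl_smult fs_antipode_word)
  have "(fa_prod_list (rev (map antipode_gen (w @ [g]))) :: (ygen,'k) fa) = fa_mul (antipode_gen g) (fa_prod_list (rev (map antipode_gen w)))"
    by (simp add: fa_prod_list_def)
  then have "hl (antipode (fa_word (w @ [g]))) = tsc (word_sign (w @ [g])) * (?s * ?P)"
    by (simp only: antipode_word hl_smult hl_mul fs_mul fs_antipode_word fs_antipode_gen)
  also have "\<dots> = (if odd (ypar g) then (-1) ^ odd_letters w else 1) * (?s * hl (antipode (fa_word w)))"
    unfolding word_sign_snoc w by (simp only: mult.assoc tq.eta_left_commute)
  finally have wg: "hl (antipode (fa_word (w @ [g])))
     = (if odd (ypar g) then (-1) ^ odd_letters w else 1) * (?s * hl (antipode (fa_word w)))" .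
  have "Rep_endo (prod_list (map antipode_op (w @ [g]))) unit_vec
     = Rep_endo (lmul (ypar g) ?s) (Rep_endo (rmul (odd_letters w) (hl (antipode (fa_word w)))) unit_vec)"
    using snoc by (simp add: app_simps antipode_op_eq[of g])
  then show ?case
    unfolding wg odd_letters_snoc by (auto simp: rmul_unit lmul.rep_eq minus_one_power_iff)
qed

lemma esum_antipode:
  fixes x :: "(ygen,'k::field) fa"
  shows "fs x \<Longrightarrow> esum (Rep_endo (es.hm antipode_op x) unit_vec) = hl (antipode x)"
proof (induction x rule: fs_induct)
  case zero
  show ?case by (simp add: es.hm_zero antipode_zero hl_zero app_simps esum_zero)
next
  case (add c w f)
  have "esum (Rep_endo (es.hm antipode_op (fa_word w)) unit_vec) = hl (antipode (fa_word w :: (ygen,'k) fa))"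
    unfolding es.hm_word antipode_op_word esum_rmul by (simp add: esum_def)
  moreover have "Rep_endo (rmul 0 (tsc c) * g) z = Rep_endo (rmul 0 (tsc c)) (Rep_endo g z)" for g z
    unfolding es.eta_central[of c g] by (simp add: app_simps)
  ultimately show ?case using add
    by (simp add: es.hm_add es.hm_smult antipode_add antipode_smult app_simps(3) esum_add esum_rmul
        hl_add hl_smult fs_antipode tq.eta_central)
qed

context
  fixes p :: nat
  assumes p: "prime p" "odd p" and char: "of_nat p = (0 :: 'k::field)"
begin

text \<open>Solve the convolution identity for the summand \<open>m = n\<close>, whose second factor
  is the constant coefficient 1; in every other summand \<open>n - m\<close> is positive.\<close>

lemma antipode_bser_mem:
  assumes n: "n > 0"
  shows "antipode (bser c p n :: (ygen,'k) fa) \<in> Ip_lift p"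
proof -
  let ?b = "bser c p :: nat \<Rightarrow> (ygen,'k) fa"
  have hm: "es.hm antipode_op (?b m) = bprod (side c (lfam tL)) p $ m" for m
    using es.hm_bser[of antipode_op c p m] yang_lfam[OF unital_tLR(1) yang_tLR(1)]
    by (simp add: tm_antipode_op)
  have "esum (\<Sum>m=0..n. Rep_endo (bprod (side c (lfam tL)) p $ m * rmul 0 (bprod (side c tL) p $ (n - m))) unit_vec)
     = (0 :: 'k tens)"
    by (subst antipode_convolution[OF unital_tLR(1) yang_tLR(1) tens_char[OF p char] p(2) n]) (rule esum_zero)
  then have "(\<Sum>m=0..n. hl (antipode (?b m)) * hl (?b (n - m))) = 0"
    by (simp add: esum_sum app_simps esum_rmul hm[symmetric] esum_antipode hl_bser)
  moreover have "hl (?b 0) = 1"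
    by (induction p) (simp_all add: hl_bser sh_def unital_side[OF unital_tLR(1), unfolded unital_def])
  ultimately have "hl (antipode (?b n)) = - (\<Sum>m<n. hl (antipode (?b m)) * hl (?b (n - m)))"
    unfolding atLeast0AtMost lessThan_Suc_atMost[symmetric] by (simp add: eq_neg_iff_add_eq_0 add.commute)
  also have "\<dots> = hl (fa_neg (fa_sum (\<lambda>m. fa_mul (antipode (?b m)) (?b (n - m))) {..<n}))"
    by (simp add: hl_neg hl_sum hl_mul fs_antipode)
  finally show ?thesis
  proof (rule Ip_hl_eq[rotated 2])
    show "fs (antipode (?b n))" by (simp add: fs_antipode)
    show "fa_neg (fa_sum (\<lambda>m. fa_mul (antipode (?b m)) (?b (n - m))) {..<n}) \<in> Ip_lift p"
      unfolding fa_neg_smult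
      by (intro Ip_lift.ip_smult Ip_sum Ip_mul_left bser_mem[OF p char] fs_antipode) auto
  qed
qed

text \<open>For a generator \<open>b\<close> the point is \<open>S(w b) = S(b) S(w)\<close>, without
  sign as \<open>b\<close> is even; the right-hand side lies in the ideal because this is
  two-sided.\<close>

lemma antipode_Ip:
  assumes "x \<in> (Ip_lift p :: (ygen,'k) fa set)"
  shows "antipode x \<in> Ip_lift p"
  using assms
proof (induction rule: Ip_lift.induct)
  case (ip_ker x)
  have fsx: "fs x" using ip_ker by (rule fs_yker)
  have "\<forall>r\<in>yrels. es.hm (antipode_op :: ygen \<Rightarrow> 'k tens endo) r = 0"
    unfolding es.hm_yrels_iff tm_antipode_op by (rule yang_lfam[OF unital_tLR(1) yang_tLR(1)])
  then have "fs r \<and> es.hm antipode_op r = 0" if "r \<in> yrels" for r :: "(ygen,'k) fa"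
    using that fs_yrels by (intro conjI) (simp_all only:)
  from conjunct2[OF es.hm_ideal[OF this ip_ker[unfolded yker_def]]]
  have "es.hm antipode_op x = 0" .
  then have "hl (antipode x) = 0"
    using esum_antipode[OF fsx] by (simp add: app_simps esum_zero)
  then show ?case using hl_kernel[OF fs_antipode[OF fsx]] by (intro Ip_lift.ip_ker) blast
next
  case (ip_gen b u)
  then obtain c r where b: "b = bser c p (r * p)" "r > 0" unfolding bgens_eq by blast
  have n: "r * p > 0" using b(2) p(1) by (simp add: prime_gt_0_nat)
  let ?y = "hl (antipode (fa_word u))" and ?d = "odd_letters u"
  have hm: "es.hm antipode_op b = bprod (side c (lfam tL)) p $ (r * p)"
    using es.hm_bser[of antipode_op c p "r * p"] yang_lfam[OF unital_tLR(1) yang_tLR(1)]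
    by (simp add: tm_antipode_op b(1))
  have "hl (antipode (fa_mul (fa_word u) b))
     = esum (Rep_endo (es.hm antipode_op (fa_mul (fa_word u) b)) unit_vec)"
    by (rule esum_antipode[symmetric]) (simp add: b(1))
  \<comment> \<open>On the unit the operator of the word acts like right multiplication by its
    antipode, and this commutes with the left multiplications that make up the operator of
    \<open>b\<close>.\<close>
  also have "Rep_endo (es.hm antipode_op (fa_mul (fa_word u) b)) unit_vec
     = Rep_endo (rmul ?d ?y * es.hm antipode_op b) unit_vec"
    by (simp add: es.hm_mul b(1) app_simps es.hm_word antipode_op_word)
  also have "rmul ?d ?y * es.hm antipode_op b = es.hm antipode_op b * rmul ?d ?y"
    unfolding hm by (rule rmul_comm_bprod_lfam)
  also have "esum (Rep_endo (es.hm antipode_op b * rmul ?d ?y) unit_vec) = hl (antipode b) * ?y"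
    by (simp add: app_simps esum_rmul esum_antipode b(1))
  also have "\<dots> = hl (fa_mul (antipode b) (antipode (fa_word u)))"
    by (simp add: hl_mul fs_antipode b(1))
  finally show ?case
  proof (rule Ip_hl_eq[rotated 2])
    show "fs (antipode (fa_mul (fa_word u) b))" by (simp add: fs_antipode b(1))
    show "fa_mul (antipode b) (antipode (fa_word u)) \<in> Ip_lift p"
      unfolding b(1) by (intro Ip_mul_right[OF p char] antipode_bser_mem n fs_antipode fs_word)
  qed
next
  case (ip_add x y)
  then show ?case by (simp add: antipode_add fs_Ip Ip_lift.ip_add)
next
  case (ip_smult x c)
  then show ?case by (simp add: antipode_smult fs_Ip Ip_lift.ip_smult)
qed

end

theorem theorem2p6:
  fixes p :: nat
  assumes "prime p" and "p > 2"
    and "CHAR('k::field) = p"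
    and "\<forall>q :: 'k poly. degree q > 0 \<longrightarrow> (\<exists>x. poly q x = 0)"
  shows "(\<forall>x \<in> (Ip_lift p :: (ygen,'k) fa set). \<forall>u.
             fa_mul (fa_word u) x \<in> Ip_lift p \<and> fa_mul x (fa_word u) \<in> Ip_lift p)
       \<and> (\<forall>x \<in> (Ip_lift p :: (ygen,'k) fa set). comult x \<in> tens_Ip p)
       \<and> (\<forall>x \<in> (Ip_lift p :: (ygen,'k) fa set). counit x = 0)
       \<and> (\<forall>x \<in> (Ip_lift p :: (ygen,'k) fa set). antipode x \<in> Ip_lift p)"
proof -
  have odd: "odd p" using assms(1,2) by (rule prime_odd_nat)
  have char: "of_nat p = (0 :: 'k)" using of_nat_CHAR[where ?'a = 'k] assms(3) by simp
  show ?thesis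
    using Ip_word_left Ip_word_right[OF assms(1) odd char] comult_Ip[OF assms(1) odd char]
      counit_Ip[OF assms(1)] antipode_Ip[OF assms(1) odd char] by blast
qed

end
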